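(* Let $\mathbb{F}_8=\mathbb{F}_2(a)$ be the field with eight elements, where $a^3+a^2+1=0$, and let $A=\mathcal{M}_2(\mathbb{F}_8)$ be the ring of $2\times 2$ matrices over $\mathbb{F}_8$. Let $\sigma:A\to A$ be the $\mathbb{F}_2$-algebra automorphism that squares each matrix entry, i.e. $\sigma\begin{pmatrix} x_0 & x_1 \\ x_2 & x_3 \end{pmatrix}=\begin{pmatrix} x_0^2 & x_1^2 \\ x_2^2 & x_3^2 \end{pmatrix}$, and let $\delta:A\to A$ be the inner $\sigma$-derivation $\delta(X)=MX-\sigma(X)M$ with $M=\begin{pmatrix} 0 & 0 \\ 0 & a \end{pmatrix}$. Then the ring extension $\mathbb{F}_2[x]\subseteq A[x;\sigma,\delta]$ is biseparable but is not a Frobenius extension of second kind (that is, it is not $\kappa$-Frobenius for any ring automorphism $\kappa$ of $\mathbb{F}_2[x]$).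
   Context: All rings are associative and unital. The Ore extension $A[x;\sigma,\delta]$ is the ring of polynomials in $x$ with coefficients in $A$ written on the left, with multiplication determined by $xb=\sigma(b)x+\delta(b)$ for $b\in A$; $\mathbb{F}_2[x]$ is the commutative polynomial ring, regarded as the subring of polynomials with coefficients in $\mathbb{F}_2=\mathbb{F}_2 1_A$. Let $C\subseteq B$ be a unital ring extension. - It is separable if there exists $p\in B\otimes_C B$ with $bp=pb$ for all $b\in B$ and $\mu(p)=1$, where $\mu:B\otimes_C B\to B$, $b_1\otimes b_2\mapsto b_1b_2$. - It is split if there exists a $C$-bimodule morphism $\xi:B\to C$ with $\xi(1)=1$. - It is biseparable if it is split, separable, and $B$ is finitely generated projective both as a left $C$-module and as a right $C$-module. - Given a ring automorphism $\kappa:C\to C$, the extension is $\kappa$-Frobenius if $B$ is a finitely generated projective right $C$-module and there is an isomorphism of $C$-$B$-bimodules from $B$ to $B^{*_\kappa}$, where $B^{*_\kappa}$ is the set of right $C$-module morphisms $f:B\to C$ with $C$-$B$-bimodule structure $(cfb)(u)=\kappa(c)f(bu)$ for $c\in C$, $b,u\in B$. It is a Frobenius extension of second kind if it is $\kappa$-Frobenius for some ring automorphism $\kappa$ of $C$. *)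

theory Defs
  imports
    "HOL-Algebra.Subrings"
    "HOL-Algebra.UnivPoly"
    "HOL-Algebra.Free_Abelian_Groups"
    "Jordan_Normal_Form.Matrix"
begin

section \<open>Ore extensions\<close>

text \<open>
  Elements are coefficient sequences: \<open>p\<close> stands for the sum of the \<open>p i x\<^sup>i\<close>, coefficients on the
  left. From \<open>x b = \<sigma>(b) x + \<delta>(b)\<close>, left multiplication by \<open>x\<close> is the operator \<open>ore_shift\<close>, and
  \<open>p q\<close> is the sum of the \<open>p i (x\<^sup>i q)\<close>.
\<close>

definition ore_shift ::
  "('a, 'm) ring_scheme \<Rightarrow> ('a \<Rightarrow> 'a) \<Rightarrow> ('a \<Rightarrow> 'a) \<Rightarrow> (nat \<Rightarrow> 'a) \<Rightarrow> nat \<Rightarrow> 'a" where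
  "ore_shift R \<sigma> \<delta> q n =
     (case n of 0 \<Rightarrow> \<zero>\<^bsub>R\<^esub> | Suc m \<Rightarrow> \<sigma> (q m)) \<oplus>\<^bsub>R\<^esub> \<delta> (q n)"

definition ore_extension ::
  "('a, 'm) ring_scheme \<Rightarrow> ('a \<Rightarrow> 'a) \<Rightarrow> ('a \<Rightarrow> 'a) \<Rightarrow> (nat \<Rightarrow> 'a) ring" where
  "ore_extension R \<sigma> \<delta> = \<lparr>
     carrier = up R,
     monoid.mult = (\<lambda>p q n. \<Oplus>\<^bsub>R\<^esub>i \<in> {i. p i \<noteq> \<zero>\<^bsub>R\<^esub>}. p i \<otimes>\<^bsub>R\<^esub> (ore_shift R \<sigma> \<delta> ^^ i) q n),
     one = (\<lambda>n. if n = 0 then \<one>\<^bsub>R\<^esub> else \<zero>\<^bsub>R\<^esub>),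
     ring.zero = (\<lambda>n. \<zero>\<^bsub>R\<^esub>),
     add = (\<lambda>p q n. p n \<oplus>\<^bsub>R\<^esub> q n)\<rparr>"


section \<open>Modules over noncommutative rings\<close>

text \<open>
  \<^locale>\<open>module\<close> requires a commutative base ring, so only its record type is used here.
  Right \<open>R\<close>-modules are left modules over the opposite ring.
\<close>

definition opposite_ring :: "('a, 'm) ring_scheme \<Rightarrow> ('a, 'm) ring_scheme" where
  "opposite_ring R = R\<lparr>monoid.mult := \<lambda>x y. y \<otimes>\<^bsub>R\<^esub> x\<rparr>"

definition module_hom ::
  "('r, 'k) ring_scheme \<Rightarrow> ('r, 'm) module \<Rightarrow> ('r, 'n) module \<Rightarrow> ('m \<Rightarrow> 'n) set" where
  "module_hom R M N = {f \<in> carrier M \<rightarrow>\<^sub>E carrier N.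
     (\<forall>u \<in> carrier M. \<forall>v \<in> carrier M. f (u \<oplus>\<^bsub>M\<^esub> v) = f u \<oplus>\<^bsub>N\<^esub> f v) \<and>
     (\<forall>r \<in> carrier R. \<forall>u \<in> carrier M. f (r \<odot>\<^bsub>M\<^esub> u) = r \<odot>\<^bsub>N\<^esub> f u)}"

definition free_module :: "('r, 'k) ring_scheme \<Rightarrow> 'i set \<Rightarrow> ('r, 'i \<Rightarrow> 'r) module" where
  "free_module R I = \<lparr>
     carrier = {f \<in> I \<rightarrow>\<^sub>E carrier R. finite {i \<in> I. f i \<noteq> \<zero>\<^bsub>R\<^esub>}},
     monoid.mult = undefined, one = undefined,
     ring.zero = (\<lambda>i\<in>I. \<zero>\<^bsub>R\<^esub>),
     add = (\<lambda>f g. \<lambda>i\<in>I. f i \<oplus>\<^bsub>R\<^esub> g i),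
     smult = (\<lambda>r f. \<lambda>i\<in>I. r \<otimes>\<^bsub>R\<^esub> f i)\<rparr>"

definition finitely_generated :: "('r, 'k) ring_scheme \<Rightarrow> ('r, 'm) module \<Rightarrow> bool" where
  "finitely_generated R M \<longleftrightarrow> (\<exists>X. finite X \<and> X \<subseteq> carrier M \<and>
     (\<forall>u \<in> carrier M. \<exists>r \<in> X \<rightarrow> carrier R. u = (\<Oplus>\<^bsub>M\<^esub>x\<in>X. r x \<odot>\<^bsub>M\<^esub> x)))"

text \<open>
  A module is projective if it is (isomorphic to) a direct summand of a free module. Basis index sets
  of type \<^typ>\<open>'m set\<close> suffice: a projective module is a summand of the free module on its own
  carrier.
\<close>

definition projective :: "('r, 'k) ring_scheme \<Rightarrow> ('r, 'm) module \<Rightarrow> bool" where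
  "projective R M \<longleftrightarrow> (\<exists>I :: 'm set.
     \<exists>\<iota> \<in> module_hom R M (free_module R I). \<exists>\<pi> \<in> module_hom R (free_module R I) M.
       \<forall>u \<in> carrier M. \<pi> (\<iota> u) = u)"


section \<open>Ring extensions\<close>

text \<open>An extension \<open>C \<subseteq> B\<close> is given by the ring \<open>B\<close> and the carrier \<open>C\<close> of the subring.\<close>

definition ring_extension :: "('b, 'm) ring_scheme \<Rightarrow> 'b set \<Rightarrow> bool" where
  "ring_extension B C \<longleftrightarrow> ring B \<and> subring C B"

text \<open>
  A subset \<open>S\<close> of \<open>B\<close> with scalars from \<open>B\<close> acting by left, respectively right, multiplication;
  used with \<open>S = B\<close> and \<open>S = C\<close>.
\<close>

definition left_mult_module :: "('b, 'm) ring_scheme \<Rightarrow> 'b set \<Rightarrow> ('b, 'b) module" where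
  "left_mult_module B S = \<lparr>carrier = S, monoid.mult = monoid.mult B, one = one B, ring.zero = ring.zero B, add = add B,
     smult = (\<lambda>b u. b \<otimes>\<^bsub>B\<^esub> u)\<rparr>"

definition right_mult_module :: "('b, 'm) ring_scheme \<Rightarrow> 'b set \<Rightarrow> ('b, 'b) module" where
  "right_mult_module B S = \<lparr>carrier = S, monoid.mult = monoid.mult B, one = one B, ring.zero = ring.zero B, add = add B,
     smult = (\<lambda>b u. u \<otimes>\<^bsub>B\<^esub> b)\<rparr>"

definition left_fg_projective :: "('b, 'm) ring_scheme \<Rightarrow> 'b set \<Rightarrow> bool" where
  "left_fg_projective B C \<longleftrightarrow>
     finitely_generated (B\<lparr>carrier := C\<rparr>) (left_mult_module B (carrier B)) \<and>
     projective (B\<lparr>carrier := C\<rparr>) (left_mult_module B (carrier B))"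

definition right_fg_projective :: "('b, 'm) ring_scheme \<Rightarrow> 'b set \<Rightarrow> bool" where
  "right_fg_projective B C \<longleftrightarrow>
     finitely_generated (opposite_ring (B\<lparr>carrier := C\<rparr>)) (right_mult_module B (carrier B)) \<and>
     projective (opposite_ring (B\<lparr>carrier := C\<rparr>)) (right_mult_module B (carrier B))"

definition split_extension :: "('b, 'm) ring_scheme \<Rightarrow> 'b set \<Rightarrow> bool" where
  "split_extension B C \<longleftrightarrow> (\<exists>\<xi>.
     \<xi> \<in> module_hom (B\<lparr>carrier := C\<rparr>)
           (left_mult_module B (carrier B)) (left_mult_module B C) \<and>
     \<xi> \<in> module_hom (opposite_ring (B\<lparr>carrier := C\<rparr>))
           (right_mult_module B (carrier B)) (right_mult_module B C) \<and>
     \<xi> \<one>\<^bsub>B\<^esub> = \<one>\<^bsub>B\<^esub>)"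


subsection \<open>The tensor product of \<open>B\<close> with itself over \<open>C\<close>, and separability\<close>

text \<open>
  The tensor product is the free abelian group on the pairs modulo the bilinearity and balancing
  relations, so its elements are cosets of formal integer combinations of pairs. The two actions of
  \<open>B\<close> and the multiplication map are first given on formal combinations and then passed to cosets.
\<close>

definition tensor_gens :: "('b, 'm) ring_scheme \<Rightarrow> 'b set \<Rightarrow> ('b \<times> 'b \<Rightarrow>\<^sub>0 int) set" where
  "tensor_gens B C =
     {frag_of (u \<oplus>\<^bsub>B\<^esub> v, w) - frag_of (u, w) - frag_of (v, w) | u v w.
        u \<in> carrier B \<and> v \<in> carrier B \<and> w \<in> carrier B} \<union>
     {frag_of (w, u \<oplus>\<^bsub>B\<^esub> v) - frag_of (w, u) - frag_of (w, v) | u v w.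
        u \<in> carrier B \<and> v \<in> carrier B \<and> w \<in> carrier B} \<union>
     {frag_of (u \<otimes>\<^bsub>B\<^esub> c, w) - frag_of (u, c \<otimes>\<^bsub>B\<^esub> w) | u c w.
        u \<in> carrier B \<and> c \<in> C \<and> w \<in> carrier B}"

definition tensor_rels :: "('b, 'm) ring_scheme \<Rightarrow> 'b set \<Rightarrow> ('b \<times> 'b \<Rightarrow>\<^sub>0 int) set" where
  "tensor_rels B C = generate (free_Abelian_group (carrier B \<times> carrier B)) (tensor_gens B C)"

definition tensor_square :: "('b, 'm) ring_scheme \<Rightarrow> 'b set \<Rightarrow> ('b \<times> 'b \<Rightarrow>\<^sub>0 int) set monoid" where
  "tensor_square B C = free_Abelian_group (carrier B \<times> carrier B) Mod tensor_rels B C"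

definition tensor_lact ::
  "('b, 'm) ring_scheme \<Rightarrow> 'b set \<Rightarrow> 'b \<Rightarrow> ('b \<times> 'b \<Rightarrow>\<^sub>0 int) set \<Rightarrow> ('b \<times> 'b \<Rightarrow>\<^sub>0 int) set" where
  "tensor_lact B C b P = (\<Union>z\<in>P. tensor_rels B C #>\<^bsub>free_Abelian_group (carrier B \<times> carrier B)\<^esub>
     frag_extend (\<lambda>(u, v). frag_of (b \<otimes>\<^bsub>B\<^esub> u, v)) z)"

definition tensor_ract ::
  "('b, 'm) ring_scheme \<Rightarrow> 'b set \<Rightarrow> ('b \<times> 'b \<Rightarrow>\<^sub>0 int) set \<Rightarrow> 'b \<Rightarrow> ('b \<times> 'b \<Rightarrow>\<^sub>0 int) set" where
  "tensor_ract B C P b = (\<Union>z\<in>P. tensor_rels B C #>\<^bsub>free_Abelian_group (carrier B \<times> carrier B)\<^esub>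
     frag_extend (\<lambda>(u, v). frag_of (u, v \<otimes>\<^bsub>B\<^esub> b)) z)"

definition tensor_mu :: "('b, 'm) ring_scheme \<Rightarrow> ('b \<times> 'b \<Rightarrow>\<^sub>0 int) set \<Rightarrow> 'b" where
  "tensor_mu B P = the_elem
     ((\<lambda>z. \<Oplus>\<^bsub>B\<^esub>t \<in> Poly_Mapping.keys z. [Poly_Mapping.lookup z t] \<cdot>\<^bsub>B\<^esub> (fst t \<otimes>\<^bsub>B\<^esub> snd t)) ` P)"

definition separable_extension :: "('b, 'm) ring_scheme \<Rightarrow> 'b set \<Rightarrow> bool" where
  "separable_extension B C \<longleftrightarrow> (\<exists>P \<in> carrier (tensor_square B C).
     (\<forall>b \<in> carrier B. tensor_lact B C b P = tensor_ract B C P b) \<and> tensor_mu B P = \<one>\<^bsub>B\<^esub>)"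

definition biseparable_extension :: "('b, 'm) ring_scheme \<Rightarrow> 'b set \<Rightarrow> bool" where
  "biseparable_extension B C \<longleftrightarrow> split_extension B C \<and> separable_extension B C \<and>
     left_fg_projective B C \<and> right_fg_projective B C"


subsection \<open>Frobenius extensions of second kind\<close>

definition right_dual :: "('b, 'm) ring_scheme \<Rightarrow> 'b set \<Rightarrow> ('b \<Rightarrow> 'b) set" where
  "right_dual B C = module_hom (opposite_ring (B\<lparr>carrier := C\<rparr>))
     (right_mult_module B (carrier B)) (right_mult_module B C)"

text \<open>The left \<open>C\<close>-module and right \<open>B\<close>-module structures on the \<open>\<kappa>\<close>-twisted dual.\<close>

definition twisted_dual_left ::
  "('b, 'm) ring_scheme \<Rightarrow> 'b set \<Rightarrow> ('b \<Rightarrow> 'b) \<Rightarrow> ('b, 'b \<Rightarrow> 'b) module" where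
  "twisted_dual_left B C \<kappa> = \<lparr>
     carrier = right_dual B C,
     monoid.mult = undefined, one = undefined,
     ring.zero = (\<lambda>u\<in>carrier B. \<zero>\<^bsub>B\<^esub>),
     add = (\<lambda>f g. \<lambda>u\<in>carrier B. f u \<oplus>\<^bsub>B\<^esub> g u),
     smult = (\<lambda>c f. \<lambda>u\<in>carrier B. \<kappa> c \<otimes>\<^bsub>B\<^esub> f u)\<rparr>"

definition twisted_dual_right ::
  "('b, 'm) ring_scheme \<Rightarrow> 'b set \<Rightarrow> ('b, 'b \<Rightarrow> 'b) module" where
  "twisted_dual_right B C = \<lparr>
     carrier = right_dual B C,
     monoid.mult = undefined, one = undefined,
     ring.zero = (\<lambda>u\<in>carrier B. \<zero>\<^bsub>B\<^esub>),
     add = (\<lambda>f g. \<lambda>u\<in>carrier B. f u \<oplus>\<^bsub>B\<^esub> g u),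
     smult = (\<lambda>b f. \<lambda>u\<in>carrier B. f (b \<otimes>\<^bsub>B\<^esub> u))\<rparr>"

definition kappa_frobenius :: "('b, 'm) ring_scheme \<Rightarrow> 'b set \<Rightarrow> ('b \<Rightarrow> 'b) \<Rightarrow> bool" where
  "kappa_frobenius B C \<kappa> \<longleftrightarrow> right_fg_projective B C \<and> (\<exists>\<phi>.
     bij_betw \<phi> (carrier B) (right_dual B C) \<and>
     \<phi> \<in> module_hom (B\<lparr>carrier := C\<rparr>)
           (left_mult_module B (carrier B)) (twisted_dual_left B C \<kappa>) \<and>
     \<phi> \<in> module_hom (opposite_ring B)
           (right_mult_module B (carrier B)) (twisted_dual_right B C))"

definition frobenius_second_kind :: "('b, 'm) ring_scheme \<Rightarrow> 'b set \<Rightarrow> bool" where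
  "frobenius_second_kind B C \<longleftrightarrow>
     (\<exists>\<kappa> \<in> ring_iso (B\<lparr>carrier := C\<rparr>) (B\<lparr>carrier := C\<rparr>). kappa_frobenius B C \<kappa>)"


section \<open>The example\<close>

definition F2_polys :: "('a, 'm) ring_scheme \<Rightarrow> (nat \<Rightarrow> 'a) set" where
  "F2_polys R = {p \<in> up R. \<forall>n. p n \<in> {\<zero>\<^bsub>R\<^esub>, \<one>\<^bsub>R\<^esub>}}"

definition sq_entries :: "'f::field mat \<Rightarrow> 'f mat" where
  "sq_entries = map_mat (\<lambda>t. t^2)"

definition M_mat :: "'f::field \<Rightarrow> 'f mat" where
  "M_mat a = mat_of_rows_list 2 [[0, 0], [0, a]]"

definition inner_deriv :: "'f::field mat \<Rightarrow> ('f mat \<Rightarrow> 'f mat) \<Rightarrow> 'f mat \<Rightarrow> 'f mat" where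
  "inner_deriv M \<sigma> X = M * X - \<sigma> X * M"

end

theory Submission
  imports Defs "HOL-Computational_Algebra.Polynomial"
begin

text \<open>
  With \<open>y = x - M\<close> one has \<open>y b = \<sigma>(b) y\<close>, so the Ore extension \<open>B\<close> is the ring of \<open>2 \<times> 2\<close> matrices
  over the skew polynomial ring \<open>S\<close> in \<open>y\<close> over the field with eight elements, twisted by the Frobenius
  map, and \<open>x\<close> is the diagonal matrix with entries \<open>y\<close> and \<open>y + a\<close>. Reading off the trace of the
  \<open>(0, 0)\<close> entry splits the extension. The elements \<open>a, a\<^sup>2, a\<^sup>4\<close> form a self-dual normal basis permuted
  by the Frobenius map; combined with the matrix units of the first column and row they give a
  separability idempotent. \<open>B\<close> is free on both sides on a basis of the matrix ring because \<open>\<sigma>\<close> is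
  bijective.

  A \<open>\<kappa>\<close>-Frobenius isomorphism is \<open>s \<mapsto> f (s \<cdot>)\<close> for a right linear \<open>f\<close> with \<open>f (x v) = \<kappa>(x) f(v)\<close>,
  where \<open>\<kappa>(x)\<close> is \<open>x\<close> or \<open>x + 1\<close>. This identity forces \<open>f\<close> to vanish on the \<open>(0, 1)\<close> block. On the
  constants of the \<open>(1, 1)\<close> block it forces either \<open>f = 0\<close>, or a common degree bound \<open>D \<ge> 1\<close> with
  coefficient of degree \<open>D\<close> a nonzero multiple of the field trace. Hence on that block \<open>f (s \<cdot>)\<close> is
  zero or takes a value of degree at least \<open>D\<close> on a constant, so it is never the functional reading
  off the trace of the \<open>(1, 1)\<close> entry.
\<close>

section \<open>Finitely supported sequences\<close>

text \<open>The computation stays with coefficient sequences in x rather than in the coordinate y,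
  because x generates the base ring: a functional linear over it is determined by its values on
  constant matrices. The shape of the proof comes from the tension between left and right
  coefficients. Right linearity is visible on left coefficients, while twisted left linearity can
  only be applied to an element s written as a sum of x^i q_i. Hence both forms, and the conversion
  between them, are needed. Evaluating f on x b = \<sigma>(b) x + \<delta>(b) in two ways gives
  finite linear systems over polynomials for the values of f on the three conjugates of a. Only the
  second column matters for the obstruction, since multiplying s on the right by the matrix unit at
  (1, 1) discards the first. When \<kappa> fixes x, the system of the (1, 1) block has nonzero
  solutions, so f cannot simply be shown to vanish there. The trace in the coefficient of degree D
  is what prevents cancellation: among the summands \<kappa>(x)^i f(q_i b), the last i whose (1, 1)
  entry is nonzero dominates for a suitable b.\<close>

definition monomial :: "('a, 'm) ring_scheme \<Rightarrow> 'a \<Rightarrow> nat \<Rightarrow> nat \<Rightarrow> 'a" where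
  "monomial R a i n = (if n = i then a else \<zero>\<^bsub>R\<^esub>)"

definition shift_seq :: "('a, 'm) ring_scheme \<Rightarrow> (nat \<Rightarrow> 'a) \<Rightarrow> nat \<Rightarrow> 'a" where
  "shift_seq R p n = (case n of 0 \<Rightarrow> \<zero>\<^bsub>R\<^esub> | Suc m \<Rightarrow> p m)"

text \<open>The additive extension of maps given on the monomials a x^i. It serves twice: with
  \<open>a \<otimes> (X ^^ i) q\<close> as the value at a x^i it is the product with q, and with
  \<open>(X ^^ i) (monomial R a 0)\<close> it is the passage from right to left
  coefficients.\<close>

definition ext_sum ::
  "('a, 'm) ring_scheme \<Rightarrow> (nat \<Rightarrow> 'a \<Rightarrow> nat \<Rightarrow> 'a) \<Rightarrow> (nat \<Rightarrow> 'a) \<Rightarrow> nat \<Rightarrow> 'a" where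
  "ext_sum R g p n = (\<Oplus>\<^bsub>R\<^esub>i \<in> {i. p i \<noteq> \<zero>\<^bsub>R\<^esub>}. g i (p i) n)"

context ring
begin

lemma up_coeff_closed [simp]: "p \<in> up R \<Longrightarrow> p n \<in> carrier R"
  by (auto simp: up_def)

lemma up_memI:
  assumes "\<And>n. p n \<in> carrier R" and "\<And>n. n > N \<Longrightarrow> p n = \<zero>"
  shows "p \<in> up R"
  using assms by (intro mem_upI exI[of _ N] bound.intro) simp_all

lemma up_bounded:
  assumes "p \<in> up R"
  obtains N where "\<And>n. n > N \<Longrightarrow> p n = \<zero>"
proof -
  obtain N where "bound \<zero> N p" using assms unfolding up_def by blast
  then show thesis by (intro that[of N] bound.bound)
qed

lemma up_zero_closed [simp]: "(\<lambda>n. \<zero>) \<in> up R"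
  by (rule up_memI[of _ 0]) simp_all

lemma up_plus_closed [simp]: "p \<in> up R \<Longrightarrow> q \<in> up R \<Longrightarrow> (\<lambda>n. p n \<oplus> q n) \<in> up R"
  by (rule up_add_closed)

lemma monomial_closed [simp]: "a \<in> carrier R \<Longrightarrow> monomial R a i \<in> up R"
  by (rule up_memI[of _ i]) (simp_all add: monomial_def)

lemma shift_seq_closed [simp]:
  assumes "p \<in> up R"
  shows "shift_seq R p \<in> up R"
proof -
  obtain N where "\<And>n. n > N \<Longrightarrow> p n = \<zero>" using up_bounded[OF assms] by blast
  then show ?thesis
    using assms by (intro up_memI[of _ "Suc N"]) (auto simp: shift_seq_def split: nat.split)
qed

lemma shift_seq_add:
  "shift_seq R (\<lambda>n. p n \<oplus> q n) = (\<lambda>n. shift_seq R p n \<oplus> shift_seq R q n)"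
  by (auto simp: shift_seq_def fun_eq_iff split: nat.split)

lemma shift_seq_zero: "shift_seq R (\<lambda>n. \<zero>) = (\<lambda>n. \<zero>)"
  by (auto simp: shift_seq_def fun_eq_iff split: nat.split)

lemma shift_seq_monomial: "shift_seq R (monomial R a i) = monomial R a (Suc i)"
  by (auto simp: shift_seq_def monomial_def fun_eq_iff split: nat.split)

lemma monomial_zero: "monomial R \<zero> i = (\<lambda>n. \<zero>)"
  by (auto simp: monomial_def)

lemma monomial_add:
  "a \<in> carrier R \<Longrightarrow> b \<in> carrier R \<Longrightarrow>
    monomial R (a \<oplus> b) i = (\<lambda>n. monomial R a i n \<oplus> monomial R b i n)"
  by (auto simp: monomial_def)

lemma up_induct [consumes 2, case_names zero add]:
  assumes "p \<in> up R" and "range p \<subseteq> S"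
    and zero: "P (\<lambda>n. \<zero>)"
    and add: "\<And>p a i. p \<in> up R \<Longrightarrow> range p \<subseteq> insert \<zero> S \<Longrightarrow> a \<in> S \<Longrightarrow> a \<in> carrier R \<Longrightarrow> P p
      \<Longrightarrow> P (\<lambda>n. p n \<oplus> monomial R a i n)"
  shows "P p"
proof -
  have "P p" if "p \<in> up R" "range p \<subseteq> insert \<zero> S" "\<And>n. n \<ge> N \<Longrightarrow> p n = \<zero>" for N p
    using that
  proof (induction N arbitrary: p)
    case 0
    then have "p = (\<lambda>n. \<zero>)" by auto
    with zero show ?case by simp
  next
    case (Suc N)
    let ?p = "\<lambda>n. if n = N then \<zero> else p n"
    have "?p \<in> up R" using Suc.prems(1,3) by (intro up_memI[of _ N]) auto
    moreover have "range ?p \<subseteq> insert \<zero> S" using Suc.prems(2) by auto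
    moreover have "?p n = \<zero>" if "n \<ge> N" for n
      using that Suc.prems(3)[of n] by auto
    ultimately have *: "P ?p" by (intro Suc.IH)
    show ?case
    proof (cases "p N = \<zero>")
      case True
      then have "?p = p" by auto
      with * show ?thesis by simp
    next
      case False
      then have "p N \<in> S" using Suc.prems(2) by (metis insertE rangeI subsetD)
      moreover have "p = (\<lambda>n. ?p n \<oplus> monomial R (p N) N n)"
        using Suc.prems(1) by (auto simp: monomial_def)
      ultimately show ?thesis
        using add[OF \<open>?p \<in> up R\<close> \<open>range ?p \<subseteq> _\<close> _ _ *, of "p N" N] Suc.prems(1) by simp
    qed
  qed
  moreover obtain N where "\<And>n. n \<ge> Suc N \<Longrightarrow> p n = \<zero>"
    using up_bounded[OF assms(1)] Suc_le_lessD by metis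
  ultimately show ?thesis
    using assms(1,2) by blast
qed

text \<open>Induction along Horner's scheme. It suits right coefficients, where the shift becomes
  left multiplication by x.\<close>

lemma up_shift_induct [consumes 2, case_names zero add]:
  assumes "p \<in> up R" and "range p \<subseteq> S"
    and zero: "P (\<lambda>n. \<zero>)"
    and add: "\<And>p a. p \<in> up R \<Longrightarrow> range p \<subseteq> S \<Longrightarrow> a \<in> S \<Longrightarrow> a \<in> carrier R \<Longrightarrow> P p
      \<Longrightarrow> P (\<lambda>n. shift_seq R p n \<oplus> monomial R a 0 n)"
  shows "P p"
proof -
  have "P p" if "p \<in> up R" "range p \<subseteq> S" "\<And>n. n \<ge> N \<Longrightarrow> p n = \<zero>" for N p
    using that
  proof (induction N arbitrary: p)
    case 0
    then have "p = (\<lambda>n. \<zero>)" by auto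
    with zero show ?case by simp
  next
    case (Suc N)
    let ?p = "\<lambda>n. p (Suc n)"
    have "?p n = \<zero>" if "n \<ge> N" for n
      using that Suc.prems(3)[of "Suc n"] by auto
    moreover have "?p \<in> up R"
      using Suc.prems(1,3) by (intro up_memI[of _ N]) auto
    moreover have "range ?p \<subseteq> S" using Suc.prems(2) by auto
    ultimately have "P (\<lambda>n. shift_seq R ?p n \<oplus> monomial R (p 0) 0 n)"
      using Suc.prems(1,2) by (intro add Suc.IH) auto
    moreover have "(\<lambda>n. shift_seq R ?p n \<oplus> monomial R (p 0) 0 n) = p"
      using Suc.prems(1) by (auto simp: shift_seq_def monomial_def fun_eq_iff split: nat.split)
    ultimately show ?case by simp
  qed
  moreover obtain N where "\<And>n. n \<ge> Suc N \<Longrightarrow> p n = \<zero>"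
    using up_bounded[OF assms(1)] Suc_le_lessD by metis
  ultimately show ?thesis
    using assms(1,2) by blast
qed

lemma up_induct_carrier [consumes 1, case_names zero add]:
  assumes "p \<in> up R" and "P (\<lambda>n. \<zero>)"
    and "\<And>p a i. p \<in> up R \<Longrightarrow> a \<in> carrier R \<Longrightarrow> P p \<Longrightarrow> P (\<lambda>n. p n \<oplus> monomial R a i n)"
  shows "P p"
proof -
  have "range p \<subseteq> carrier R" using assms(1) by auto
  with assms(1) show ?thesis
    by (induction p rule: up_induct) (use assms in auto)
qed

end

section \<open>Additive extension from monomials\<close>

locale seq_family = ring +
  fixes g :: "nat \<Rightarrow> 'a \<Rightarrow> nat \<Rightarrow> 'a"
  assumes g_closed [simp]: "a \<in> carrier R \<Longrightarrow> g i a \<in> up R"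
    and g_add: "a \<in> carrier R \<Longrightarrow> b \<in> carrier R \<Longrightarrow> g i (a \<oplus> b) = (\<lambda>n. g i a n \<oplus> g i b n)"
begin

lemma g_zero: "g i \<zero> n = \<zero>"
proof -
  have "g i \<zero> n \<oplus> g i \<zero> n = g i \<zero> n"
    using g_add[of \<zero> \<zero> i] by (simp add: fun_eq_iff)
  then show ?thesis by simp
qed

lemma ext_sum_superset:
  assumes "p \<in> up R" "finite J" "{i. p i \<noteq> \<zero>} \<subseteq> J"
  shows "ext_sum R g p n = (\<Oplus>i\<in>J. g i (p i) n)"
  unfolding ext_sum_def
  using assms by (intro add.finprod_mono_neutral_cong_left) (auto simp: g_zero)

lemma finite_support: "p \<in> up R \<Longrightarrow> finite {i. p i \<noteq> \<zero>}"
  by (metis (mono_tags, lifting) finite_nat_set_iff_bounded_le linorder_not_le mem_Collect_eq up_bounded)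

lemma ext_sum_zero: "ext_sum R g (\<lambda>n. \<zero>) = (\<lambda>n. \<zero>)"
  by (auto simp: ext_sum_def)

lemma ext_sum_add:
  assumes "p \<in> up R" "q \<in> up R"
  shows "ext_sum R g (\<lambda>n. p n \<oplus> q n) = (\<lambda>n. ext_sum R g p n \<oplus> ext_sum R g q n)"
proof
  fix n
  let ?J = "{i. p i \<noteq> \<zero>} \<union> {i. q i \<noteq> \<zero>}"
  have J: "finite ?J" using assms finite_support by auto
  have "ext_sum R g (\<lambda>n. p n \<oplus> q n) n = (\<Oplus>i\<in>?J. g i (p i \<oplus> q i) n)"
    using assms J by (intro ext_sum_superset) auto
  also have "\<dots> = (\<Oplus>i\<in>?J. g i (p i) n \<oplus> g i (q i) n)"
    using assms by (intro finsum_cong) (auto simp: g_add)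
  also have "\<dots> = (\<Oplus>i\<in>?J. g i (p i) n) \<oplus> (\<Oplus>i\<in>?J. g i (q i) n)"
    using assms by (intro finsum_addf) auto
  also have "\<dots> = ext_sum R g p n \<oplus> ext_sum R g q n"
    using assms J by (simp add: ext_sum_superset[of _ ?J])
  finally show "ext_sum R g (\<lambda>n. p n \<oplus> q n) n = \<dots>" .
qed

lemma ext_sum_monomial:
  assumes "a \<in> carrier R"
  shows "ext_sum R g (monomial R a i) = g i a"
proof
  fix n
  have "ext_sum R g (monomial R a i) n = (\<Oplus>j\<in>{i}. g j (monomial R a i j) n)"
    using assms by (intro ext_sum_superset) (auto simp: monomial_def)
  then show "ext_sum R g (monomial R a i) n = g i a n"
    using assms by (simp add: monomial_def)
qed

lemma ext_sum_closed [simp]: "p \<in> up R \<Longrightarrow> ext_sum R g p \<in> up R"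
proof (induction p rule: up_induct_carrier)
  case zero
  then show ?case by (simp add: ext_sum_zero)
next
  case (add p a i)
  then show ?case by (simp add: ext_sum_add ext_sum_monomial)
qed

end

text \<open>Only additivity is asked, so that the pair for the inverse twist is an instance as well.
  Its second map \<delta>' = -\<delta>\<sigma>' obeys the product rule with the sides exchanged,
  \<delta>'(ab) = a \<delta>'(b) + \<delta>'(a) \<sigma>'(b), and so does not fit
  \<open>ore_ext\<close> in general.\<close>

locale ore_maps = ring +
  fixes \<sigma> \<delta> :: "'a \<Rightarrow> 'a"
  assumes \<sigma>_closed [simp]: "a \<in> carrier R \<Longrightarrow> \<sigma> a \<in> carrier R"
    and \<delta>_closed [simp]: "a \<in> carrier R \<Longrightarrow> \<delta> a \<in> carrier R"
    and \<sigma>_add: "a \<in> carrier R \<Longrightarrow> b \<in> carrier R \<Longrightarrow> \<sigma> (a \<oplus> b) = \<sigma> a \<oplus> \<sigma> b"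
    and \<delta>_add: "a \<in> carrier R \<Longrightarrow> b \<in> carrier R \<Longrightarrow> \<delta> (a \<oplus> b) = \<delta> a \<oplus> \<delta> b"
begin

abbreviation X :: "(nat \<Rightarrow> 'a) \<Rightarrow> nat \<Rightarrow> 'a" where
  "X \<equiv> ore_shift R \<sigma> \<delta>"

lemma \<sigma>_zero [simp]: "\<sigma> \<zero> = \<zero>"
  using \<sigma>_add[of \<zero> \<zero>] by simp

lemma \<delta>_zero [simp]: "\<delta> \<zero> = \<zero>"
  using \<delta>_add[of \<zero> \<zero>] by simp

lemma X_closed [simp]:
  assumes "p \<in> up R"
  shows "X p \<in> up R"
proof -
  obtain N where "\<And>n. n > N \<Longrightarrow> p n = \<zero>" using up_bounded[OF assms] by blast
  then show ?thesis
    using assms by (intro up_memI[of _ "Suc N"]) (auto simp: ore_shift_def split: nat.split)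
qed

lemma X_add:
  "p \<in> up R \<Longrightarrow> q \<in> up R \<Longrightarrow> X (\<lambda>n. p n \<oplus> q n) = (\<lambda>n. X p n \<oplus> X q n)"
  by (auto simp: ore_shift_def fun_eq_iff \<sigma>_add \<delta>_add a_ac split: nat.split)

lemma X_zero: "X (\<lambda>n. \<zero>) = (\<lambda>n. \<zero>)"
  by (auto simp: ore_shift_def fun_eq_iff split: nat.split)

lemma X_monomial:
  "a \<in> carrier R \<Longrightarrow>
    X (monomial R a i) = (\<lambda>n. monomial R (\<sigma> a) (Suc i) n \<oplus> monomial R (\<delta> a) i n)"
  by (auto simp: ore_shift_def monomial_def fun_eq_iff split: nat.split)

text \<open>Left and right multiplication by x commute: an instance of associativity, obtained
  before the ring structure.\<close>

lemma X_shift: "p \<in> up R \<Longrightarrow> X (shift_seq R p) = shift_seq R (X p)"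
  by (auto simp: ore_shift_def shift_seq_def fun_eq_iff split: nat.split)

lemma Xpow_closed [simp]: "p \<in> up R \<Longrightarrow> (X ^^ i) p \<in> up R"
  by (induction i) auto

lemma Xpow_add:
  "p \<in> up R \<Longrightarrow> q \<in> up R \<Longrightarrow>
    (X ^^ i) (\<lambda>n. p n \<oplus> q n) = (\<lambda>n. (X ^^ i) p n \<oplus> (X ^^ i) q n)"
  by (induction i) (auto simp: X_add)

lemma Xpow_shift: "p \<in> up R \<Longrightarrow> (X ^^ i) (shift_seq R p) = shift_seq R ((X ^^ i) p)"
  by (induction i) (auto simp: X_shift)

text \<open>Reads its argument as right coefficients, that is as the sum of the x^i p_i, and returns
  the left coefficients of that element.\<close>

definition right_form :: "(nat \<Rightarrow> 'a) \<Rightarrow> nat \<Rightarrow> 'a" where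
  "right_form = ext_sum R (\<lambda>i a. (X ^^ i) (monomial R a 0))"

sublocale rf: seq_family R "\<lambda>i a. (X ^^ i) (monomial R a 0)"
  by unfold_locales (auto simp: monomial_add Xpow_add)

lemma right_form_closed [simp]: "p \<in> up R \<Longrightarrow> right_form p \<in> up R"
  by (simp add: right_form_def)

lemma right_form_zero: "right_form (\<lambda>n. \<zero>) = (\<lambda>n. \<zero>)"
  by (simp add: right_form_def rf.ext_sum_zero)

lemma right_form_add:
  "p \<in> up R \<Longrightarrow> q \<in> up R \<Longrightarrow>
    right_form (\<lambda>n. p n \<oplus> q n) = (\<lambda>n. right_form p n \<oplus> right_form q n)"
  by (simp add: right_form_def rf.ext_sum_add)

lemma right_form_monomial:
  "a \<in> carrier R \<Longrightarrow> right_form (monomial R a i) = (X ^^ i) (monomial R a 0)"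
  by (simp add: right_form_def rf.ext_sum_monomial)

lemma right_form_shift: "p \<in> up R \<Longrightarrow> right_form (shift_seq R p) = X (right_form p)"
  by (induction p rule: up_induct_carrier)
    (simp_all add: shift_seq_zero right_form_zero X_zero shift_seq_add right_form_add X_add
      shift_seq_monomial right_form_monomial)

text \<open>Right multiplication by \<open>x\<close> is \<^const>\<open>shift_seq\<close>; on right coefficients it is the shift
  operator of the inverse twist, because \<open>a x = x \<sigma>\<^sup>-\<^sup>1(a) - \<delta>(\<sigma>\<^sup>-\<^sup>1(a))\<close>.\<close>

lemma right_form_inverse_shift:
  assumes "ore_maps R \<sigma>' \<delta>'"
    and \<sigma>\<sigma>': "\<And>a. a \<in> carrier R \<Longrightarrow> \<sigma> (\<sigma>' a) = a"
    and \<delta>\<sigma>': "\<And>a. a \<in> carrier R \<Longrightarrow> \<delta> (\<sigma>' a) \<oplus> \<delta>' a = \<zero>"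
    and "p \<in> up R"
  shows "right_form (ore_shift R \<sigma>' \<delta>' p) = shift_seq R (right_form p)"
proof -
  interpret inv: ore_maps R \<sigma>' \<delta>' by fact
  have X_const: "(\<lambda>n. X (monomial R (\<sigma>' a) 0) n \<oplus> monomial R (\<delta>' a) 0 n) = shift_seq R (monomial R a 0)"
    if "a \<in> carrier R" for a
  proof
    fix n
    have "X (monomial R (\<sigma>' a) 0) n = monomial R a 1 n \<oplus> monomial R (\<delta> (\<sigma>' a)) 0 n"
      using that by (simp add: X_monomial \<sigma>\<sigma>')
    then show "X (monomial R (\<sigma>' a) 0) n \<oplus> monomial R (\<delta>' a) 0 n = shift_seq R (monomial R a 0) n"
      using that \<delta>\<sigma>'[of a] by (simp add: shift_seq_monomial) (simp add: monomial_def)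
  qed
  show ?thesis
    using \<open>p \<in> up R\<close>
  proof (induction p rule: up_induct_carrier)
    case zero
    then show ?case by (simp add: inv.X_zero right_form_zero shift_seq_zero)
  next
    case (add p a i)
    have "right_form (inv.X (monomial R a i)) =
        (\<lambda>n. (X ^^ i) (X (monomial R (\<sigma>' a) 0)) n \<oplus> (X ^^ i) (monomial R (\<delta>' a) 0) n)"
      using add.hyps by (simp add: inv.X_monomial right_form_add right_form_monomial funpow_Suc_right
        del: funpow.simps)
    also have "\<dots> = (X ^^ i) (shift_seq R (monomial R a 0))"
      using add.hyps by (subst X_const[symmetric]) (simp_all add: Xpow_add)
    also have "\<dots> = shift_seq R (right_form (monomial R a i))"
      using add.hyps by (simp add: Xpow_shift right_form_monomial)
    finally show ?case
      using add by (simp add: inv.X_add right_form_add shift_seq_add)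
  qed
qed

text \<open>The right coefficients of a x^i arise from the constant a by i steps of the inverse
  shift, since under \<open>right_form\<close> each step is a multiplication by x on the right.
  Hence the conversion built from the inverse twist computes right coefficients, and every element
  has them.\<close>

lemma right_form_inverse:
  assumes "ore_maps R \<sigma>' \<delta>'"
    and \<sigma>\<sigma>': "\<And>a. a \<in> carrier R \<Longrightarrow> \<sigma> (\<sigma>' a) = a"
    and \<delta>\<sigma>': "\<And>a. a \<in> carrier R \<Longrightarrow> \<delta> (\<sigma>' a) \<oplus> \<delta>' a = \<zero>"
    and "p \<in> up R"
  shows "right_form (ore_maps.right_form R \<sigma>' \<delta>' p) = p"
proof -
  interpret inv: ore_maps R \<sigma>' \<delta>' by fact
  have *: "right_form ((inv.X ^^ i) (monomial R a 0)) = monomial R a i" if "a \<in> carrier R" for a i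
    using that
    by (induction i)
      (simp_all add: right_form_monomial right_form_inverse_shift[OF assms(1-3)] shift_seq_monomial)
  show ?thesis
    using \<open>p \<in> up R\<close>
  proof (induction p rule: up_induct_carrier)
    case zero
    show ?case by (simp only: inv.right_form_zero right_form_zero)
  next
    case (add p a i)
    have "right_form (inv.right_form (\<lambda>n. p n \<oplus> monomial R a i n)) =
        right_form (\<lambda>n. inv.right_form p n \<oplus> (inv.X ^^ i) (monomial R a 0) n)"
      using add.hyps by (simp only: inv.right_form_add inv.right_form_monomial monomial_closed)
    also have "\<dots> = (\<lambda>n. right_form (inv.right_form p) n \<oplus> right_form ((inv.X ^^ i) (monomial R a 0)) n)"
      using add.hyps by (intro right_form_add) auto
    also have "\<dots> = (\<lambda>n. p n \<oplus> monomial R a i n)"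
      using add.hyps by (simp only: add.IH *)
    finally show ?case .
  qed
qed

end

section \<open>The Ore extension is a ring\<close>

lemma ore_extension_simps [simp]:
  "carrier (ore_extension R \<sigma> \<delta>) = up R"
  "\<zero>\<^bsub>ore_extension R \<sigma> \<delta>\<^esub> = (\<lambda>n. \<zero>\<^bsub>R\<^esub>)"
  "p \<oplus>\<^bsub>ore_extension R \<sigma> \<delta>\<^esub> q = (\<lambda>n. p n \<oplus>\<^bsub>R\<^esub> q n)"
  by (simp_all add: ore_extension_def)

lemma ore_extension_one: "\<one>\<^bsub>ore_extension R \<sigma> \<delta>\<^esub> = monomial R \<one>\<^bsub>R\<^esub> 0"
  by (auto simp: ore_extension_def monomial_def)

locale ore_ext = ore_maps +
  assumes \<sigma>_mult: "a \<in> carrier R \<Longrightarrow> b \<in> carrier R \<Longrightarrow> \<sigma> (a \<otimes> b) = \<sigma> a \<otimes> \<sigma> b"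
    and \<sigma>_one [simp]: "\<sigma> \<one> = \<one>"
    and \<delta>_mult: "a \<in> carrier R \<Longrightarrow> b \<in> carrier R \<Longrightarrow> \<delta> (a \<otimes> b) = \<sigma> a \<otimes> \<delta> b \<oplus> \<delta> a \<otimes> b"
begin

abbreviation B :: "(nat \<Rightarrow> 'a) ring" where
  "B \<equiv> ore_extension R \<sigma> \<delta>"

lemma \<delta>_one [simp]: "\<delta> \<one> = \<zero>"
  using \<delta>_mult[of \<one> \<one>] by simp

lemma up_scale_closed [simp]: "a \<in> carrier R \<Longrightarrow> p \<in> up R \<Longrightarrow> (\<lambda>n. a \<otimes> p n) \<in> up R"
  using up_smult_closed by simp

lemma X_scale:
  "a \<in> carrier R \<Longrightarrow> q \<in> up R \<Longrightarrow>
    X (\<lambda>n. a \<otimes> q n) = (\<lambda>n. \<sigma> a \<otimes> X q n \<oplus> \<delta> a \<otimes> q n)"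
  by (auto simp: ore_shift_def fun_eq_iff \<sigma>_mult \<delta>_mult r_distr a_ac split: nat.split)

lemma mult_family: "q \<in> up R \<Longrightarrow> seq_family R (\<lambda>i a n. a \<otimes> (X ^^ i) q n)"
  by unfold_locales (auto simp: l_distr)

lemma B_mult: "p \<otimes>\<^bsub>B\<^esub> q = ext_sum R (\<lambda>i a n. a \<otimes> (X ^^ i) q n) p"
  by (auto simp: ore_extension_def ext_sum_def)

lemma B_mult_closed [simp]: "p \<in> up R \<Longrightarrow> q \<in> up R \<Longrightarrow> p \<otimes>\<^bsub>B\<^esub> q \<in> up R"
  by (simp add: B_mult seq_family.ext_sum_closed[OF mult_family])

lemma B_l_distr:
  "p \<in> up R \<Longrightarrow> p' \<in> up R \<Longrightarrow> q \<in> up R \<Longrightarrow>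
    (\<lambda>n. p n \<oplus> p' n) \<otimes>\<^bsub>B\<^esub> q = (\<lambda>n. (p \<otimes>\<^bsub>B\<^esub> q) n \<oplus> (p' \<otimes>\<^bsub>B\<^esub> q) n)"
  unfolding B_mult by (rule seq_family.ext_sum_add[OF mult_family])

lemma B_monomial_mult:
  "a \<in> carrier R \<Longrightarrow> q \<in> up R \<Longrightarrow> monomial R a i \<otimes>\<^bsub>B\<^esub> q = (\<lambda>n. a \<otimes> (X ^^ i) q n)"
  unfolding B_mult by (rule seq_family.ext_sum_monomial[OF mult_family])

lemma B_zero_mult: "(\<lambda>n. \<zero>) \<otimes>\<^bsub>B\<^esub> q = (\<lambda>n. \<zero>)"
  unfolding B_mult by (auto simp: ext_sum_def)

lemma B_r_distr:
  assumes "p \<in> up R" "q \<in> up R" "q' \<in> up R"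
  shows "p \<otimes>\<^bsub>B\<^esub> (\<lambda>n. q n \<oplus> q' n) = (\<lambda>n. (p \<otimes>\<^bsub>B\<^esub> q) n \<oplus> (p \<otimes>\<^bsub>B\<^esub> q') n)"
  using assms(1)
proof (induction p rule: up_induct_carrier)
  case zero
  then show ?case by (simp add: B_zero_mult)
next
  case (add p a i)
  then show ?case
    using assms by (simp add: B_l_distr B_monomial_mult Xpow_add r_distr a_ac)
qed

text \<open>Associativity with left factor x; \<open>B_scale_mult\<close> is the case of a constant
  left factor. Every left multiplication is a sum of composites of these two, which gives
  \<open>B_assoc\<close>. The product rules of \<sigma> and \<delta> enter here, through
  \<open>X_scale\<close>.\<close>

lemma B_X_mult:
  assumes "q \<in> up R" "r \<in> up R"
  shows "X q \<otimes>\<^bsub>B\<^esub> r = X (q \<otimes>\<^bsub>B\<^esub> r)"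
  using assms(1)
proof (induction q rule: up_induct_carrier)
  case zero
  then show ?case by (simp add: B_zero_mult X_zero)
next
  case (add q a i)
  then show ?case
    using assms by (simp add: B_l_distr B_monomial_mult X_add X_monomial X_scale)
qed

lemma B_scale_mult:
  assumes "a \<in> carrier R" "q \<in> up R" "r \<in> up R"
  shows "(\<lambda>n. a \<otimes> q n) \<otimes>\<^bsub>B\<^esub> r = (\<lambda>n. a \<otimes> (q \<otimes>\<^bsub>B\<^esub> r) n)"
  using assms(2)
proof (induction q rule: up_induct_carrier)
  case zero
  then show ?case using assms by (simp add: B_zero_mult)
next
  case (add q b i)
  have "(\<lambda>n. a \<otimes> monomial R b i n) = monomial R (a \<otimes> b) i"
    using assms add.hyps by (auto simp: monomial_def)
  then show ?case
    using assms add
    by (simp add: B_l_distr B_monomial_mult r_distr m_assoc)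
qed

lemma B_Xpow_mult:
  "q \<in> up R \<Longrightarrow> r \<in> up R \<Longrightarrow> (X ^^ i) q \<otimes>\<^bsub>B\<^esub> r = (X ^^ i) (q \<otimes>\<^bsub>B\<^esub> r)"
  by (induction i) (auto simp: B_X_mult)

lemma B_assoc:
  assumes "p \<in> up R" "q \<in> up R" "r \<in> up R"
  shows "(p \<otimes>\<^bsub>B\<^esub> q) \<otimes>\<^bsub>B\<^esub> r = p \<otimes>\<^bsub>B\<^esub> (q \<otimes>\<^bsub>B\<^esub> r)"
  using assms(1)
proof (induction p rule: up_induct_carrier)
  case zero
  then show ?case by (simp add: B_zero_mult)
next
  case (add p a i)
  then show ?case
    using assms by (simp add: B_l_distr B_monomial_mult B_scale_mult B_Xpow_mult)
qed

lemma Xpow_one: "(X ^^ i) (monomial R \<one> 0) = monomial R \<one> i"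
proof (induction i)
  case (Suc i)
  then show ?case by (simp add: X_monomial monomial_zero)
qed simp

lemma B_mult_one:
  assumes "p \<in> up R"
  shows "p \<otimes>\<^bsub>B\<^esub> monomial R \<one> 0 = p"
  using assms
proof (induction p rule: up_induct_carrier)
  case zero
  then show ?case by (simp add: B_zero_mult)
next
  case (add p a i)
  then have "monomial R a i \<otimes>\<^bsub>B\<^esub> monomial R \<one> 0 = monomial R a i"
    by (simp add: B_monomial_mult Xpow_one) (auto simp: monomial_def)
  with add show ?case by (simp add: B_l_distr)
qed

lemma B_one_mult: "p \<in> up R \<Longrightarrow> monomial R \<one> 0 \<otimes>\<^bsub>B\<^esub> p = p"
  by (simp add: B_monomial_mult)

lemma B_ring: "ring B"
proof (rule ringI)
  show "abelian_group B"
  proof (rule abelian_groupI)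
    fix p assume "p \<in> carrier B"
    then show "\<exists>q\<in>carrier B. q \<oplus>\<^bsub>B\<^esub> p = \<zero>\<^bsub>B\<^esub>"
      using up_a_inv_closed[of p] by (intro bexI[of _ "\<lambda>n. \<ominus> p n"]) (auto simp: l_neg)
  qed (auto simp: a_ac)
  show "Group.monoid B"
    by (rule monoidI) (auto simp: ore_extension_one B_assoc B_one_mult B_mult_one)
qed (auto simp: B_l_distr B_r_distr)

abbreviation x :: "nat \<Rightarrow> 'a" where
  "x \<equiv> monomial R \<one> 1"

lemma x_mult: "p \<in> up R \<Longrightarrow> x \<otimes>\<^bsub>B\<^esub> p = X p"
  by (simp add: B_monomial_mult)

lemma const_mult_const:
  "a \<in> carrier R \<Longrightarrow> b \<in> carrier R \<Longrightarrow>
    monomial R a 0 \<otimes>\<^bsub>B\<^esub> monomial R b 0 = monomial R (a \<otimes> b) 0"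
  by (auto simp: B_monomial_mult) (auto simp: monomial_def)

lemma X_monomial_one: "X (monomial R \<one> i) = monomial R \<one> (Suc i)"
  by (simp add: X_monomial monomial_zero)

lemma mult_x:
  assumes "p \<in> up R"
  shows "p \<otimes>\<^bsub>B\<^esub> x = shift_seq R p"
  using assms
proof (induction p rule: up_induct_carrier)
  case zero
  then show ?case by (simp add: B_zero_mult shift_seq_zero)
next
  case (add p a i)
  have "(X ^^ i) x = monomial R \<one> (Suc i)"
    by (induction i) (simp_all add: X_monomial_one)
  then have "monomial R a i \<otimes>\<^bsub>B\<^esub> x = shift_seq R (monomial R a i)"
    using add by (simp add: B_monomial_mult shift_seq_monomial) (auto simp: monomial_def)
  with add show ?case by (simp add: B_l_distr shift_seq_add)
qed

lemma x_pow_mult: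
  "p \<in> up R \<Longrightarrow> monomial R \<one> i \<otimes>\<^bsub>B\<^esub> p = (X ^^ i) p"
  by (simp add: B_monomial_mult)

end

section \<open>Dual bases and projectivity\<close>

text \<open>Instantiated both with C and with its opposite ring, so that one dual basis argument
  yields projectivity on the left and on the right.\<close>

locale left_module = R?: ring R + M?: abelian_group M
  for R :: "('r, 'k) ring_scheme" (structure) and M :: "('r, 'm) module" (structure) +
  assumes sm_closed: "r \<in> carrier R \<Longrightarrow> u \<in> carrier M \<Longrightarrow> r \<odot>\<^bsub>M\<^esub> u \<in> carrier M"
    and sm_l_distr: "r \<in> carrier R \<Longrightarrow> s \<in> carrier R \<Longrightarrow> u \<in> carrier M \<Longrightarrow>
      (r \<oplus>\<^bsub>R\<^esub> s) \<odot>\<^bsub>M\<^esub> u = r \<odot>\<^bsub>M\<^esub> u \<oplus>\<^bsub>M\<^esub> s \<odot>\<^bsub>M\<^esub> u"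
    and sm_r_distr: "r \<in> carrier R \<Longrightarrow> u \<in> carrier M \<Longrightarrow> v \<in> carrier M \<Longrightarrow>
      r \<odot>\<^bsub>M\<^esub> (u \<oplus>\<^bsub>M\<^esub> v) = r \<odot>\<^bsub>M\<^esub> u \<oplus>\<^bsub>M\<^esub> r \<odot>\<^bsub>M\<^esub> v"
    and sm_assoc: "r \<in> carrier R \<Longrightarrow> s \<in> carrier R \<Longrightarrow> u \<in> carrier M \<Longrightarrow>
      (r \<otimes>\<^bsub>R\<^esub> s) \<odot>\<^bsub>M\<^esub> u = r \<odot>\<^bsub>M\<^esub> (s \<odot>\<^bsub>M\<^esub> u)"
begin

lemma sm_zero: "r \<in> carrier R \<Longrightarrow> r \<odot>\<^bsub>M\<^esub> \<zero>\<^bsub>M\<^esub> = \<zero>\<^bsub>M\<^esub>"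
  using sm_r_distr[of r "\<zero>\<^bsub>M\<^esub>" "\<zero>\<^bsub>M\<^esub>"] sm_closed[of r "\<zero>\<^bsub>M\<^esub>"] by simp

lemma sm_finsum:
  assumes "finite K" "r \<in> carrier R" "h \<in> K \<rightarrow> carrier M"
  shows "r \<odot>\<^bsub>M\<^esub> (\<Oplus>\<^bsub>M\<^esub>i\<in>K. h i) = (\<Oplus>\<^bsub>M\<^esub>i\<in>K. r \<odot>\<^bsub>M\<^esub> h i)"
  using assms
proof (induction K rule: finite_induct)
  case empty
  then show ?case by (simp add: sm_zero)
next
  case (insert i K)
  moreover have "(\<Oplus>\<^bsub>M\<^esub>i\<in>K. h i) \<in> carrier M" using insert by (intro M.finsum_closed) auto
  ultimately show ?case
    by (simp add: M.finsum_insert sm_r_distr sm_closed Pi_def)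
qed

text \<open>The dual basis lemma: the coordinates embed the module into a free one, and evaluation
  splits the embedding. The basis is a set of module elements, not an indexed family, because
  \<open>projective\<close> takes its index sets in the type of the module.\<close>

lemma dual_basis_imp_fg_projective:
  assumes K: "finite K" "K \<subseteq> carrier M"
    and f_closed: "\<And>k u. k \<in> K \<Longrightarrow> u \<in> carrier M \<Longrightarrow> f k u \<in> carrier R"
    and f_add: "\<And>k u v. k \<in> K \<Longrightarrow> u \<in> carrier M \<Longrightarrow> v \<in> carrier M \<Longrightarrow>
      f k (u \<oplus>\<^bsub>M\<^esub> v) = f k u \<oplus>\<^bsub>R\<^esub> f k v"
    and f_sm: "\<And>k r u. k \<in> K \<Longrightarrow> r \<in> carrier R \<Longrightarrow> u \<in> carrier M \<Longrightarrow>
      f k (r \<odot>\<^bsub>M\<^esub> u) = r \<otimes>\<^bsub>R\<^esub> f k u"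
    and f_basis: "\<And>u. u \<in> carrier M \<Longrightarrow> (\<Oplus>\<^bsub>M\<^esub>k\<in>K. f k u \<odot>\<^bsub>M\<^esub> k) = u"
  shows "finitely_generated R M \<and> projective R M"
proof
  have "\<exists>r\<in>K \<rightarrow> carrier R. u = (\<Oplus>\<^bsub>M\<^esub>k\<in>K. r k \<odot>\<^bsub>M\<^esub> k)" if "u \<in> carrier M" for u
    using that f_closed by (intro bexI[of _ "\<lambda>k. f k u"]) (auto simp: f_basis)
  then show "finitely_generated R M"
    unfolding finitely_generated_def using K by blast
  define \<iota> where "\<iota> = (\<lambda>u\<in>carrier M. \<lambda>k\<in>K. f k u)"
  define \<pi> where "\<pi> = (\<lambda>c\<in>carrier (free_module R K). \<Oplus>\<^bsub>M\<^esub>k\<in>K. c k \<odot>\<^bsub>M\<^esub> k)"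
  have \<iota>: "\<iota> \<in> module_hom R M (free_module R K)"
    unfolding module_hom_def
  proof (intro CollectI conjI ballI)
    show "\<iota> \<in> carrier M \<rightarrow>\<^sub>E carrier (free_module R K)"
      using K f_closed by (auto simp: \<iota>_def free_module_def)
    show "\<iota> (u \<oplus>\<^bsub>M\<^esub> v) = \<iota> u \<oplus>\<^bsub>free_module R K\<^esub> \<iota> v" if "u \<in> carrier M" "v \<in> carrier M" for u v
      using that f_add by (auto simp: \<iota>_def free_module_def)
    show "\<iota> (r \<odot>\<^bsub>M\<^esub> u) = r \<odot>\<^bsub>free_module R K\<^esub> \<iota> u" if "r \<in> carrier R" "u \<in> carrier M" for r u
      using that f_sm by (auto simp: \<iota>_def free_module_def sm_closed)
  qed
  have free: "c k \<in> carrier R" if "c \<in> carrier (free_module R K)" "k \<in> K" for c k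
    using that by (auto simp: free_module_def)
  have free_add: "c \<oplus>\<^bsub>free_module R K\<^esub> d \<in> carrier (free_module R K)"
    if "c \<in> carrier (free_module R K)" "d \<in> carrier (free_module R K)" for c d
    using that K by (auto simp: free_module_def)
  have free_sm: "r \<odot>\<^bsub>free_module R K\<^esub> c \<in> carrier (free_module R K)"
    if "c \<in> carrier (free_module R K)" "r \<in> carrier R" for c r
    using that K by (auto simp: free_module_def)
  have \<pi>: "\<pi> \<in> module_hom R (free_module R K) M"
    unfolding module_hom_def
  proof (intro CollectI conjI ballI)
    show "\<pi> \<in> carrier (free_module R K) \<rightarrow>\<^sub>E carrier M"
      using K free by (auto simp: \<pi>_def subset_iff sm_closed intro!: M.finsum_closed)
    show "\<pi> (c \<oplus>\<^bsub>free_module R K\<^esub> d) = \<pi> c \<oplus>\<^bsub>M\<^esub> \<pi> d"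
      if c: "c \<in> carrier (free_module R K)" and d: "d \<in> carrier (free_module R K)" for c d
    proof -
      have "\<pi> (c \<oplus>\<^bsub>free_module R K\<^esub> d) = (\<Oplus>\<^bsub>M\<^esub>k\<in>K. c k \<odot>\<^bsub>M\<^esub> k \<oplus>\<^bsub>M\<^esub> d k \<odot>\<^bsub>M\<^esub> k)"
        unfolding \<pi>_def restrict_apply'[OF free_add[OF c d]]
        using K free[OF c] free[OF d]
        by (intro M.finsum_cong) (auto simp: sm_l_distr sm_closed subset_iff free_module_def simp_implies_def)
      also have "\<dots> = \<pi> c \<oplus>\<^bsub>M\<^esub> \<pi> d"
        using c d K free[OF c] free[OF d] unfolding \<pi>_def
        by (subst M.finsum_addf) (auto simp: sm_closed subset_iff)
      finally show ?thesis .
    qed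
    show "\<pi> (r \<odot>\<^bsub>free_module R K\<^esub> c) = r \<odot>\<^bsub>M\<^esub> \<pi> c"
      if r: "r \<in> carrier R" and c: "c \<in> carrier (free_module R K)" for r c
    proof -
      have "\<pi> (r \<odot>\<^bsub>free_module R K\<^esub> c) = (\<Oplus>\<^bsub>M\<^esub>k\<in>K. r \<odot>\<^bsub>M\<^esub> (c k \<odot>\<^bsub>M\<^esub> k))"
        unfolding \<pi>_def restrict_apply'[OF free_sm[OF c r]]
        using K r free[OF c]
        by (intro M.finsum_cong) (auto simp: sm_assoc sm_closed subset_iff free_module_def simp_implies_def)
      also have "\<dots> = r \<odot>\<^bsub>M\<^esub> \<pi> c"
        unfolding \<pi>_def restrict_apply'[OF c] using r K free[OF c]
        by (subst sm_finsum) (auto simp: sm_closed subset_iff)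
      finally show ?thesis .
    qed
  qed
  have "\<pi> (\<iota> u) = u" if "u \<in> carrier M" for u
  proof -
    have "\<iota> u \<in> carrier (free_module R K)" using \<iota> that by (auto simp: module_hom_def)
    then have "\<pi> (\<iota> u) = (\<Oplus>\<^bsub>M\<^esub>k\<in>K. f k u \<odot>\<^bsub>M\<^esub> k)"
      using that K f_closed
      by (auto simp: \<pi>_def \<iota>_def subset_iff sm_closed intro!: M.finsum_cong)
    with that f_basis show ?thesis by simp
  qed
  with \<iota> \<pi> show "projective R M"
    unfolding projective_def by blast
qed

end

section \<open>Congruence of formal tensors and separability idempotents\<close>

locale tensor_ring = ring B for B (structure) +
  fixes C
  assumes C_subset: "C \<subseteq> carrier B"
begin

definition lmap :: "'a \<Rightarrow> ('a \<times> 'a \<Rightarrow>\<^sub>0 int) \<Rightarrow> 'a \<times> 'a \<Rightarrow>\<^sub>0 int" where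
  "lmap b = frag_extend (\<lambda>(u, v). frag_of (b \<otimes> u, v))"

definition rmap :: "'a \<Rightarrow> ('a \<times> 'a \<Rightarrow>\<^sub>0 int) \<Rightarrow> 'a \<times> 'a \<Rightarrow>\<^sub>0 int" where
  "rmap b = frag_extend (\<lambda>(u, v). frag_of (u, v \<otimes> b))"

text \<open>Equality in the tensor square, expressed on representatives; cosets then appear only in
  the final criterion.\<close>

definition tcong :: "('a \<times> 'a \<Rightarrow>\<^sub>0 int) \<Rightarrow> ('a \<times> 'a \<Rightarrow>\<^sub>0 int) \<Rightarrow> bool" (infix \<open>\<approx>\<^sub>C\<close> 50) where
  "z \<approx>\<^sub>C w \<longleftrightarrow> z - w \<in> tensor_rels B C"

definition tens :: "('a \<times> 'a \<Rightarrow>\<^sub>0 int) set" where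
  "tens = {z. Poly_Mapping.keys z \<subseteq> carrier B \<times> carrier B}"

lemma tens_simps [simp]:
  "0 \<in> tens"
  "z \<in> tens \<Longrightarrow> w \<in> tens \<Longrightarrow> z + w \<in> tens"
  "z \<in> tens \<Longrightarrow> w \<in> tens \<Longrightarrow> z - w \<in> tens"
  "z \<in> tens \<Longrightarrow> - z \<in> tens"
  "u \<in> carrier B \<Longrightarrow> v \<in> carrier B \<Longrightarrow> frag_of (u, v) \<in> tens"
  using keys_add[of z w] keys_diff[of z w] by (auto simp: tens_def keys_minus)

lemma map_simps [simp]:
  "lmap b (frag_of (u, v)) = frag_of (b \<otimes> u, v)"
  "rmap b (frag_of (u, v)) = frag_of (u, v \<otimes> b)"
  "lmap b 0 = 0" "rmap b 0 = 0"
  "lmap b (z + w) = lmap b z + lmap b w" "rmap b (z + w) = rmap b z + rmap b w"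
  "lmap b (z - w) = lmap b z - lmap b w" "rmap b (z - w) = rmap b z - rmap b w"
  "lmap b (- z) = - lmap b z" "rmap b (- z) = - rmap b z"
  by (simp_all add: lmap_def rmap_def frag_extend_add frag_extend_diff frag_extend_minus)

lemma tens_induct [consumes 1, case_names zero pure diff]:
  assumes "z \<in> tens" "P 0" "\<And>u v. u \<in> carrier B \<Longrightarrow> v \<in> carrier B \<Longrightarrow> P (frag_of (u, v))"
    and "\<And>z w. P z \<Longrightarrow> P w \<Longrightarrow> P (z - w)"
  shows "P z"
proof -
  have "Poly_Mapping.keys z \<subseteq> carrier B \<times> carrier B" using assms(1) by (simp add: tens_def)
  then show ?thesis by (induction z rule: frag_induction) (use assms in auto)
qed

lemma gens_tens: "tensor_gens B C \<subseteq> tens"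
proof -
  have "z \<in> tens" if "z \<in> tensor_gens B C" for z
    using that unfolding tensor_gens_def using C_subset
    by (elim UnE CollectE exE conjE) (simp_all only: tens_simps a_closed m_closed subset_iff)
  then show ?thesis by blast
qed

lemma rels_tens: "z \<in> tensor_rels B C \<Longrightarrow> z \<in> tens"
  unfolding tensor_rels_def
proof (induction z rule: generate.induct)
  case (inv h)
  then have "h \<in> tens" using gens_tens by blast
  then show ?case by (simp add: tens_def keys_minus)
next
  case (eng h1 h2)
  then show ?case by simp
qed (use gens_tens in auto)

lemma rels_closed:
  "0 \<in> tensor_rels B C"
  "z \<in> tensor_rels B C \<Longrightarrow> w \<in> tensor_rels B C \<Longrightarrow> z + w \<in> tensor_rels B C"
  "z \<in> tensor_rels B C \<Longrightarrow> - z \<in> tensor_rels B C"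
  "z \<in> tensor_rels B C \<Longrightarrow> w \<in> tensor_rels B C \<Longrightarrow> z - w \<in> tensor_rels B C"
  "z \<in> tensor_gens B C \<Longrightarrow> z \<in> tensor_rels B C"
proof -
  let ?G = "free_Abelian_group (carrier B \<times> carrier B)"
  have sub: "subgroup (tensor_rels B C) ?G"
    unfolding tensor_rels_def
    using gens_tens by (intro group.generate_is_subgroup) (auto simp: tens_def)
  show 0: "0 \<in> tensor_rels B C"
    using subgroup.one_closed[OF sub] by simp
  show add: "z + w \<in> tensor_rels B C" if "z \<in> tensor_rels B C" "w \<in> tensor_rels B C" for z w
    using subgroup.m_closed[OF sub that] by simp
  show neg: "- z \<in> tensor_rels B C" if "z \<in> tensor_rels B C" for z
    using subgroup.m_inv_closed[OF sub that] rels_tens[OF that] by (simp add: tens_def)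
  show "z - w \<in> tensor_rels B C" if "z \<in> tensor_rels B C" "w \<in> tensor_rels B C"
    using add[OF that(1) neg[OF that(2)]] by simp
  show "z \<in> tensor_rels B C" if "z \<in> tensor_gens B C"
    using that by (simp add: tensor_rels_def generate.incl)
qed

lemma rels_induct [consumes 1, case_names zero gen add minus]:
  assumes "z \<in> tensor_rels B C" "P 0" "\<And>z. z \<in> tensor_gens B C \<Longrightarrow> P z"
    and "\<And>z w. P z \<Longrightarrow> P w \<Longrightarrow> z \<in> tens \<Longrightarrow> w \<in> tens \<Longrightarrow> P (z + w)" "\<And>z. P z \<Longrightarrow> z \<in> tens \<Longrightarrow> P (- z)"
  shows "P z"
  using assms(1) unfolding tensor_rels_def
proof (induction z rule: generate.induct)
  case one
  then show ?case using assms by simp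
next
  case (incl h)
  then show ?case using assms by simp
next
  case (inv h)
  then have "h \<in> tens" using gens_tens by blast
  then show ?case using assms(3,5) inv by (simp add: tens_def)
next
  case (eng h1 h2)
  then show ?case using assms(4) rels_tens by (simp add: tensor_rels_def)
qed

lemma tcong_refl [simp]: "z \<approx>\<^sub>C z"
  by (simp add: tcong_def rels_closed)

lemma tcong_sym: "z \<approx>\<^sub>C w \<Longrightarrow> w \<approx>\<^sub>C z"
  using rels_closed(3)[of "z - w"] by (simp add: tcong_def)

lemma tcong_trans [trans]: "z \<approx>\<^sub>C w \<Longrightarrow> w \<approx>\<^sub>C y \<Longrightarrow> z \<approx>\<^sub>C y"
  using rels_closed(2)[of "z - w" "w - y"] by (simp add: tcong_def)

lemma tcong_eq_trans [trans]: "z \<approx>\<^sub>C w \<Longrightarrow> w = y \<Longrightarrow> z \<approx>\<^sub>C y"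
  and eq_tcong_trans [trans]: "z = w \<Longrightarrow> w \<approx>\<^sub>C y \<Longrightarrow> z \<approx>\<^sub>C y"
  by simp_all

lemma tcong_add: "z \<approx>\<^sub>C w \<Longrightarrow> z' \<approx>\<^sub>C w' \<Longrightarrow> z + z' \<approx>\<^sub>C w + w'"
  using rels_closed(2)[of "z - w" "z' - w'"] by (simp add: tcong_def algebra_simps)

lemma tcong_diff: "z \<approx>\<^sub>C w \<Longrightarrow> z' \<approx>\<^sub>C w' \<Longrightarrow> z - z' \<approx>\<^sub>C w - w'"
  using rels_closed(4)[of "z - w" "z' - w'"] by (simp add: tcong_def algebra_simps)

lemma tcong_l_add:
  assumes "u \<in> carrier B" "v \<in> carrier B" "w \<in> carrier B"
  shows "frag_of (u \<oplus> v, w) \<approx>\<^sub>C frag_of (u, w) + frag_of (v, w)"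
proof -
  have "frag_of (u \<oplus> v, w) - frag_of (u, w) - frag_of (v, w) \<in> tensor_gens B C"
    using assms unfolding tensor_gens_def by blast
  from rels_closed(5)[OF this] show ?thesis by (simp add: tcong_def diff_diff_add)
qed

lemma tcong_r_add:
  assumes "u \<in> carrier B" "v \<in> carrier B" "w \<in> carrier B"
  shows "frag_of (w, u \<oplus> v) \<approx>\<^sub>C frag_of (w, u) + frag_of (w, v)"
proof -
  have "frag_of (w, u \<oplus> v) - frag_of (w, u) - frag_of (w, v) \<in> tensor_gens B C"
    using assms unfolding tensor_gens_def by blast
  from rels_closed(5)[OF this] show ?thesis by (simp add: tcong_def diff_diff_add)
qed

lemma tcong_balanced:
  assumes "u \<in> carrier B" "c \<in> C" "w \<in> carrier B"
  shows "frag_of (u \<otimes> c, w) \<approx>\<^sub>C frag_of (u, c \<otimes> w)"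
proof -
  have "frag_of (u \<otimes> c, w) - frag_of (u, c \<otimes> w) \<in> tensor_gens B C"
    using assms unfolding tensor_gens_def by blast
  from rels_closed(5)[OF this] show ?thesis by (simp add: tcong_def)
qed

lemma tcong_l_zero: "w \<in> carrier B \<Longrightarrow> frag_of (\<zero>, w) \<approx>\<^sub>C 0"
  using rels_closed(3)[of "frag_of (\<zero>, w) - (frag_of (\<zero>, w) + frag_of (\<zero>, w))"] tcong_l_add[of \<zero> \<zero> w]
  by (simp add: tcong_def)

lemma tcong_r_zero: "w \<in> carrier B \<Longrightarrow> frag_of (w, \<zero>) \<approx>\<^sub>C 0"
  using rels_closed(3)[of "frag_of (w, \<zero>) - (frag_of (w, \<zero>) + frag_of (w, \<zero>))"] tcong_r_add[of \<zero> \<zero> w]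
  by (simp add: tcong_def)

text \<open>Multiplying the first factor on the left turns each of the three kinds of relation into
  one of the same kind, so the action descends to the tensor square. \<open>rmap_gens\<close> is the
  mirror image.\<close>

lemma lmap_gens:
  assumes "b \<in> carrier B" "z \<in> tensor_gens B C"
  shows "lmap b z \<in> tensor_rels B C"
  using assms(2) unfolding tensor_gens_def
proof (elim UnE CollectE exE conjE)
  fix u v w
  assume "u \<in> carrier B" "v \<in> carrier B" "w \<in> carrier B"
    and "z = frag_of (u \<oplus> v, w) - frag_of (u, w) - frag_of (v, w)"
  then show ?thesis
    using assms(1) tcong_l_add[of "b \<otimes> u" "b \<otimes> v" w] by (simp add: r_distr tcong_def diff_diff_add)
next
  fix u v w
  assume "u \<in> carrier B" "v \<in> carrier B" "w \<in> carrier B"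
    and "z = frag_of (w, u \<oplus> v) - frag_of (w, u) - frag_of (w, v)"
  then show ?thesis
    using assms(1) tcong_r_add[of u v "b \<otimes> w"] by (simp add: tcong_def diff_diff_add)
next
  fix u c w
  assume "u \<in> carrier B" "c \<in> C" "w \<in> carrier B" "z = frag_of (u \<otimes> c, w) - frag_of (u, c \<otimes> w)"
  then show ?thesis
    using assms(1) tcong_balanced[of "b \<otimes> u" c w] C_subset
    by (simp add: tcong_def m_assoc subset_iff)
qed

lemma rmap_gens:
  assumes "b \<in> carrier B" "z \<in> tensor_gens B C"
  shows "rmap b z \<in> tensor_rels B C"
  using assms(2) unfolding tensor_gens_def
proof (elim UnE CollectE exE conjE)
  fix u v w
  assume "u \<in> carrier B" "v \<in> carrier B" "w \<in> carrier B"
    and "z = frag_of (u \<oplus> v, w) - frag_of (u, w) - frag_of (v, w)"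
  then show ?thesis
    using assms(1) tcong_l_add[of u v "w \<otimes> b"] by (simp add: tcong_def diff_diff_add)
next
  fix u v w
  assume "u \<in> carrier B" "v \<in> carrier B" "w \<in> carrier B"
    and "z = frag_of (w, u \<oplus> v) - frag_of (w, u) - frag_of (w, v)"
  then show ?thesis
    using assms(1) tcong_r_add[of "u \<otimes> b" "v \<otimes> b" w] by (simp add: l_distr tcong_def diff_diff_add)
next
  fix u c w
  assume "u \<in> carrier B" "c \<in> C" "w \<in> carrier B" "z = frag_of (u \<otimes> c, w) - frag_of (u, c \<otimes> w)"
  then show ?thesis
    using assms(1) tcong_balanced[of u c "w \<otimes> b"] C_subset
    by (simp add: tcong_def m_assoc subset_iff)
qed

lemma lmap_rels: "b \<in> carrier B \<Longrightarrow> z \<in> tensor_rels B C \<Longrightarrow> lmap b z \<in> tensor_rels B C"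
  by (rotate_tac, induction z rule: rels_induct) (auto simp: lmap_gens rels_closed)

lemma rmap_rels: "b \<in> carrier B \<Longrightarrow> z \<in> tensor_rels B C \<Longrightarrow> rmap b z \<in> tensor_rels B C"
  by (rotate_tac, induction z rule: rels_induct) (auto simp: rmap_gens rels_closed)

lemma lmap_tcong: "b \<in> carrier B \<Longrightarrow> z \<approx>\<^sub>C w \<Longrightarrow> lmap b z \<approx>\<^sub>C lmap b w"
  using lmap_rels[of b "z - w"] by (simp add: tcong_def)

lemma rmap_tcong: "b \<in> carrier B \<Longrightarrow> z \<approx>\<^sub>C w \<Longrightarrow> rmap b z \<approx>\<^sub>C rmap b w"
  using rmap_rels[of b "z - w"] by (simp add: tcong_def)

lemma lmap_add:
  assumes "z \<in> tens" "b \<in> carrier B" "c \<in> carrier B"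
  shows "lmap (b \<oplus> c) z \<approx>\<^sub>C lmap b z + lmap c z"
  using assms(1)
proof (induction z rule: tens_induct)
  case (diff z w)
  from tcong_diff[OF this] show ?case by (simp add: algebra_simps)
qed (use assms in \<open>simp_all add: l_distr tcong_l_add\<close>)

lemma rmap_add:
  assumes "z \<in> tens" "b \<in> carrier B" "c \<in> carrier B"
  shows "rmap (b \<oplus> c) z \<approx>\<^sub>C rmap b z + rmap c z"
  using assms(1)
proof (induction z rule: tens_induct)
  case (diff z w)
  from tcong_diff[OF this] show ?case by (simp add: algebra_simps)
qed (use assms in \<open>simp_all add: r_distr tcong_r_add\<close>)

lemma map_comp:
  assumes "z \<in> tens" "b \<in> carrier B" "c \<in> carrier B"
  shows "lmap (b \<otimes> c) z = lmap b (lmap c z)"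
    and "rmap (b \<otimes> c) z = rmap c (rmap b z)"
    and "lmap b (rmap c z) = rmap c (lmap b z)"
  using assms(1)
  by (induction z rule: tens_induct) (use assms in \<open>simp_all add: m_assoc\<close>)

text \<open>The centralizer of the class of \<open>z\<close>. It is closed under sums and products,
  so centrality has to be verified only on ring generators: scaled matrix units and x.\<close>

definition tcentral :: "('a \<times> 'a \<Rightarrow>\<^sub>0 int) \<Rightarrow> 'a set" where
  "tcentral z = {b \<in> carrier B. lmap b z \<approx>\<^sub>C rmap b z}"

lemma tcentral_add:
  assumes "z \<in> tens" "b \<in> tcentral z" "c \<in> tcentral z"
  shows "b \<oplus> c \<in> tcentral z"
proof -
  have "lmap (b \<oplus> c) z \<approx>\<^sub>C lmap b z + lmap c z" using assms by (intro lmap_add) (auto simp: tcentral_def)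
  also have "\<dots> \<approx>\<^sub>C rmap b z + rmap c z" using assms by (intro tcong_add) (auto simp: tcentral_def)
  also have "\<dots> \<approx>\<^sub>C rmap (b \<oplus> c) z" using assms by (intro tcong_sym[OF rmap_add]) (auto simp: tcentral_def)
  finally show ?thesis using assms by (simp add: tcentral_def)
qed

lemma tcentral_mult:
  assumes "z \<in> tens" "b \<in> tcentral z" "c \<in> tcentral z"
  shows "b \<otimes> c \<in> tcentral z"
proof -
  have bc: "b \<in> carrier B" "c \<in> carrier B" "lmap b z \<approx>\<^sub>C rmap b z" "lmap c z \<approx>\<^sub>C rmap c z"
    using assms by (auto simp: tcentral_def)
  have "lmap (b \<otimes> c) z = lmap b (lmap c z)" using assms bc by (simp add: map_comp)
  also have "\<dots> \<approx>\<^sub>C lmap b (rmap c z)" using bc by (intro lmap_tcong)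
  also have "\<dots> = rmap c (lmap b z)" using assms bc by (simp add: map_comp)
  also have "\<dots> \<approx>\<^sub>C rmap c (rmap b z)" using bc by (intro rmap_tcong)
  also have "\<dots> = rmap (b \<otimes> c) z" using assms bc by (simp add: map_comp)
  finally show ?thesis using bc by (simp add: tcentral_def)
qed

lemma tcentral_zero:
  assumes "z \<in> tens"
  shows "\<zero> \<in> tcentral z"
proof -
  have "lmap \<zero> z \<approx>\<^sub>C 0 \<and> rmap \<zero> z \<approx>\<^sub>C 0"
    using assms
  proof (induction z rule: tens_induct)
    case (diff z w)
    have "lmap \<zero> z - lmap \<zero> w \<approx>\<^sub>C 0 - 0" "rmap \<zero> z - rmap \<zero> w \<approx>\<^sub>C 0 - 0"
      by (intro tcong_diff; use diff in blast)+
    then show ?case by simp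
  qed (simp_all add: tcong_l_zero tcong_r_zero)
  then have "lmap \<zero> z \<approx>\<^sub>C rmap \<zero> z" by (blast intro: tcong_trans tcong_sym)
  then show ?thesis by (simp add: tcentral_def)
qed

definition mu :: "('a \<times> 'a \<Rightarrow>\<^sub>0 int) \<Rightarrow> 'a" where
  "mu z = (\<Oplus>t \<in> Poly_Mapping.keys z. [Poly_Mapping.lookup z t] \<cdot> (fst t \<otimes> snd t))"

lemma int_multiple:
  fixes i j :: int
  assumes "u \<in> carrier B"
  shows "[i] \<cdot> u \<in> carrier B" and "[(i + j)] \<cdot> u = [i] \<cdot> u \<oplus> [j] \<cdot> u"
    and "[(0 :: int)] \<cdot> u = \<zero>" and "[(1 :: int)] \<cdot> u = u"
proof -
  show "[i] \<cdot> u \<in> carrier B"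
    using group.int_pow_closed[OF a_group, of u i] assms by (simp add: add_pow_def)
  show "[(i + j)] \<cdot> u = [i] \<cdot> u \<oplus> [j] \<cdot> u"
    using group.int_pow_mult[OF a_group, of u i j] assms by (simp add: add_pow_def)
  show "[(0 :: int)] \<cdot> u = \<zero>" "[(1 :: int)] \<cdot> u = u"
    using int_pow_0[of "add_monoid B" u] group.int_pow_1[OF a_group, of u] assms by (simp_all add: add_pow_def)
qed

lemma mu_superset:
  assumes "z \<in> tens" "finite J" "Poly_Mapping.keys z \<subseteq> J" "J \<subseteq> carrier B \<times> carrier B"
  shows "mu z = (\<Oplus>t \<in> J. [Poly_Mapping.lookup z t] \<cdot> (fst t \<otimes> snd t))"
  unfolding mu_def
proof (rule add.finprod_mono_neutral_cong_left)
  show "[Poly_Mapping.lookup z t] \<cdot> (fst t \<otimes> snd t) = \<zero>" if "t \<in> J - Poly_Mapping.keys z" for t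
    using that assms(4) by (auto simp: in_keys_iff int_multiple(3))
  show "(\<lambda>t. [Poly_Mapping.lookup z t] \<cdot> (fst t \<otimes> snd t)) \<in> J \<rightarrow> carrier B"
    using assms(4) by (auto intro!: int_multiple(1))
qed (use assms in auto)

lemma mu_add:
  assumes "z \<in> tens" "w \<in> tens"
  shows "mu (z + w) = mu z \<oplus> mu w"
proof -
  let ?J = "Poly_Mapping.keys z \<union> Poly_Mapping.keys w"
  have J: "finite ?J" "?J \<subseteq> carrier B \<times> carrier B" using assms by (auto simp: tens_def)
  have cl: "fst t \<in> carrier B" "snd t \<in> carrier B" if "t \<in> ?J" for t
    using that J by auto
  have "mu (z + w) = (\<Oplus>t \<in> ?J. [Poly_Mapping.lookup (z + w) t] \<cdot> (fst t \<otimes> snd t))"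
    using assms J keys_add[of z w] by (intro mu_superset) auto
  also have "\<dots> = (\<Oplus>t \<in> ?J. [Poly_Mapping.lookup z t] \<cdot> (fst t \<otimes> snd t) \<oplus>
      [Poly_Mapping.lookup w t] \<cdot> (fst t \<otimes> snd t))"
    using cl by (intro finsum_cong) (auto simp: lookup_add simp_implies_def int_multiple(1,2))
  also have "\<dots> = (\<Oplus>t \<in> ?J. [Poly_Mapping.lookup z t] \<cdot> (fst t \<otimes> snd t)) \<oplus>
      (\<Oplus>t \<in> ?J. [Poly_Mapping.lookup w t] \<cdot> (fst t \<otimes> snd t))"
    using cl by (intro finsum_addf) (auto simp: int_multiple(1))
  also have "\<dots> = mu z \<oplus> mu w"
    using assms J by (simp add: mu_superset[of _ ?J])
  finally show ?thesis .
qed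

lemma mu_closed [simp]: "z \<in> tens \<Longrightarrow> mu z \<in> carrier B"
  unfolding mu_def by (intro finsum_closed) (auto simp: tens_def int_multiple(1))

lemma mu_zero [simp]: "mu 0 = \<zero>"
  by (simp add: mu_def)

lemma mu_pure: "u \<in> carrier B \<Longrightarrow> v \<in> carrier B \<Longrightarrow> mu (frag_of (u, v)) = u \<otimes> v"
  by (simp add: mu_def int_multiple)

lemma mu_minus: "z \<in> tens \<Longrightarrow> mu (- z) = \<ominus> mu z"
  using mu_add[of "- z" z] by (intro minus_equality[symmetric]) auto

lemma mu_diff: "z \<in> tens \<Longrightarrow> w \<in> tens \<Longrightarrow> mu (z - w) = mu z \<ominus> mu w"
  using mu_add[of z "- w"] by (simp add: mu_minus minus_eq)

text \<open>This makes \<open>mu\<close> constant on cosets, so that the image inside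
  \<open>tensor_mu\<close> is a singleton and \<open>the_elem\<close> yields its value.\<close>

lemma mu_rels:
  assumes "z \<in> tensor_rels B C"
  shows "mu z = \<zero>"
  using assms
proof (induction z rule: rels_induct)
  case (gen z)
  then show ?case
    unfolding tensor_gens_def
  proof (elim UnE CollectE exE conjE)
    fix u v w
    assume uvw: "u \<in> carrier B" "v \<in> carrier B" "w \<in> carrier B"
      and z: "z = frag_of (u \<oplus> v, w) - frag_of (u, w) - frag_of (v, w)"
    have "z = frag_of (u \<oplus> v, w) - (frag_of (u, w) + frag_of (v, w))" using z by simp
    also have "mu \<dots> = (u \<oplus> v) \<otimes> w \<ominus> (u \<otimes> w \<oplus> v \<otimes> w)"
      using uvw by (simp only: mu_diff mu_add mu_pure tens_simps a_closed)
    also have "\<dots> = \<zero>" using uvw by (simp add: l_distr r_neg minus_eq)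
    finally show ?thesis .
  next
    fix u v w
    assume uvw: "u \<in> carrier B" "v \<in> carrier B" "w \<in> carrier B"
      and z: "z = frag_of (w, u \<oplus> v) - frag_of (w, u) - frag_of (w, v)"
    have "z = frag_of (w, u \<oplus> v) - (frag_of (w, u) + frag_of (w, v))" using z by simp
    also have "mu \<dots> = w \<otimes> (u \<oplus> v) \<ominus> (w \<otimes> u \<oplus> w \<otimes> v)"
      using uvw by (simp only: mu_diff mu_add mu_pure tens_simps a_closed)
    also have "\<dots> = \<zero>" using uvw by (simp add: r_distr r_neg minus_eq)
    finally show ?thesis .
  next
    fix u c w
    assume ucw: "u \<in> carrier B" "c \<in> C" "w \<in> carrier B"
      and z: "z = frag_of (u \<otimes> c, w) - frag_of (u, c \<otimes> w)"
    then have c: "c \<in> carrier B" using C_subset by blast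
    then have "mu z = u \<otimes> c \<otimes> w \<ominus> u \<otimes> (c \<otimes> w)"
      using ucw unfolding z by (simp only: mu_diff mu_pure tens_simps m_closed)
    also have "\<dots> = \<zero>" using ucw c by (simp add: m_assoc r_neg minus_eq)
    finally show ?thesis .
  qed
qed (simp_all add: mu_add mu_minus)

abbreviation tcoset :: "('a \<times> 'a \<Rightarrow>\<^sub>0 int) \<Rightarrow> ('a \<times> 'a \<Rightarrow>\<^sub>0 int) set" where
  "tcoset z \<equiv> tensor_rels B C #>\<^bsub>free_Abelian_group (carrier B \<times> carrier B)\<^esub> z"

lemma tcoset_iff: "w \<in> tcoset z \<longleftrightarrow> w \<approx>\<^sub>C z"
proof
  show "w \<approx>\<^sub>C z" if "w \<in> tcoset z"
    using that by (auto simp: r_coset_def tcong_def)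
  show "w \<in> tcoset z" if "w \<approx>\<^sub>C z"
    using that unfolding tcong_def r_coset_def mult_free_Abelian_group
    by (intro UN_I[of "w - z"]) simp_all
qed

lemma tcoset_eq: "z \<approx>\<^sub>C w \<Longrightarrow> tcoset z = tcoset w"
  unfolding set_eq_iff tcoset_iff by (blast intro: tcong_trans tcong_sym)

text \<open>The two actions on a coset are unions over all representatives. As the actions respect
  the congruence, all members of such a union are one and the same coset, which can be computed from
  \<open>e\<close>.\<close>

lemma separable_extensionI:
  assumes e: "e \<in> tens" and central: "carrier B \<subseteq> tcentral e" and one: "mu e = \<one>"
  shows "separable_extension B C"
  unfolding separable_extension_def
proof (intro bexI[of _ "tcoset e"] conjI ballI)
  show "tcoset e \<in> carrier (tensor_square B C)"
    using e by (auto simp: tens_def tensor_square_def FactGroup_def RCOSETS_def)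
  fix b assume b: "b \<in> carrier B"
  have "tensor_lact B C b (tcoset e) = (\<Union>z\<in>tcoset e. tcoset (lmap b z))"
    by (simp add: tensor_lact_def lmap_def)
  also have "\<dots> = (\<Union>z\<in>tcoset e. tcoset (lmap b e))"
    using b by (intro SUP_cong refl tcoset_eq lmap_tcong) (simp_all add: tcoset_iff)
  also have "\<dots> = tcoset (lmap b e)"
    using tcoset_iff[of e e] by auto
  also have "\<dots> = tcoset (rmap b e)"
    using b central by (intro tcoset_eq) (auto simp: tcentral_def)
  also have "\<dots> = (\<Union>z\<in>tcoset e. tcoset (rmap b e))"
    using tcoset_iff[of e e] by auto
  also have "\<dots> = (\<Union>z\<in>tcoset e. tcoset (rmap b z))"
    using b by (intro SUP_cong refl tcoset_eq rmap_tcong) (simp_all add: tcoset_iff tcong_sym)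
  also have "\<dots> = tensor_ract B C (tcoset e) b"
    by (simp add: tensor_ract_def rmap_def)
  finally show "tensor_lact B C b (tcoset e) = tensor_ract B C (tcoset e) b" .
next
  have "mu z = \<one>" if "z \<in> tcoset e" for z
  proof -
    have "z - e \<in> tensor_rels B C" using that by (simp add: tcoset_iff tcong_def)
    then have "mu ((z - e) + e) = \<one>"
      using mu_add[of "z - e" e] e rels_tens mu_rels[of "z - e"] by (simp add: one)
    then show ?thesis by simp
  qed
  moreover have "e \<in> tcoset e" by (simp add: tcoset_iff)
  ultimately have "mu ` tcoset e = {\<one>}" by force
  then show "tensor_mu B (tcoset e) = \<one>"
    by (simp add: tensor_mu_def mu_def[abs_def])
qed

end

section \<open>Opposite rings and the regular modules\<close>

lemma opposite_ring_simps [simp]: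
  "carrier (opposite_ring S) = carrier S"
  "\<zero>\<^bsub>opposite_ring S\<^esub> = \<zero>\<^bsub>S\<^esub>" "\<one>\<^bsub>opposite_ring S\<^esub> = \<one>\<^bsub>S\<^esub>"
  "u \<oplus>\<^bsub>opposite_ring S\<^esub> v = u \<oplus>\<^bsub>S\<^esub> v"
  "u \<otimes>\<^bsub>opposite_ring S\<^esub> v = v \<otimes>\<^bsub>S\<^esub> u"
  by (simp_all add: opposite_ring_def)

lemma mult_module_simps [simp]:
  "carrier (left_mult_module S T) = T" "carrier (right_mult_module S T) = T"
  "\<zero>\<^bsub>left_mult_module S T\<^esub> = \<zero>\<^bsub>S\<^esub>" "\<zero>\<^bsub>right_mult_module S T\<^esub> = \<zero>\<^bsub>S\<^esub>"
  "u \<oplus>\<^bsub>left_mult_module S T\<^esub> v = u \<oplus>\<^bsub>S\<^esub> v" "u \<oplus>\<^bsub>right_mult_module S T\<^esub> v = u \<oplus>\<^bsub>S\<^esub> v"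
  "r \<odot>\<^bsub>left_mult_module S T\<^esub> u = r \<otimes>\<^bsub>S\<^esub> u" "r \<odot>\<^bsub>right_mult_module S T\<^esub> u = u \<otimes>\<^bsub>S\<^esub> r"
  by (simp_all add: left_mult_module_def right_mult_module_def)

lemma mult_module_finsum:
  "T = carrier S \<Longrightarrow> finsum (left_mult_module S T) = finsum S"
  "T = carrier S \<Longrightarrow> finsum (right_mult_module S T) = finsum S"
  by (simp_all add: fun_eq_iff finsum_def finprod_def left_mult_module_def right_mult_module_def)

lemma mult_module_abelian_group:
  assumes "ring S"
  shows "abelian_group (left_mult_module S (carrier S))"
    and "abelian_group (right_mult_module S (carrier S))"
proof -
  interpret S: ring S by fact
  have "\<exists>v\<in>carrier S. v \<oplus>\<^bsub>S\<^esub> u = \<zero>\<^bsub>S\<^esub>" if "u \<in> carrier S" for u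
    using that S.l_neg by blast
  then show "abelian_group (left_mult_module S (carrier S))"
    and "abelian_group (right_mult_module S (carrier S))"
    by (auto intro!: abelian_groupI simp: S.a_ac)
qed

lemma opposite_ring_ring:
  assumes "ring S"
  shows "ring (opposite_ring S)"
proof -
  interpret S: ring S by fact
  show ?thesis
  proof (rule ringI)
    show "abelian_group (opposite_ring S)"
      by (rule abelian_groupI) (auto simp: S.a_ac intro!: bexI[of _ "\<ominus>\<^bsub>S\<^esub> _"] S.l_neg)
    show "Group.monoid (opposite_ring S)"
      by (rule monoidI) (auto simp: S.m_assoc)
  qed (auto simp: S.l_distr S.r_distr)
qed

section \<open>Polynomials over the prime field inside an Ore extension\<close>

locale ore_char2 = ore_ext +
  assumes char2: "\<one> \<oplus> \<one> = \<zero>"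
begin

abbreviation C :: "(nat \<Rightarrow> 'a) set" where
  "C \<equiv> F2_polys R"

lemma C_iff: "p \<in> C \<longleftrightarrow> p \<in> up R \<and> range p \<subseteq> {\<zero>, \<one>}"
  unfolding F2_polys_def by blast

lemma C_up [simp]: "p \<in> C \<Longrightarrow> p \<in> up R"
  by (simp add: C_iff)

lemma C_coeff: "p \<in> C \<Longrightarrow> p n = \<zero> \<or> p n = \<one>"
  unfolding F2_polys_def by blast

lemma C_memI: "p \<in> up R \<Longrightarrow> (\<And>n. p n = \<zero> \<or> p n = \<one>) \<Longrightarrow> p \<in> C"
  unfolding F2_polys_def by blast

lemma C_monomial [simp]: "monomial R \<one> i \<in> C"
  by (rule C_memI) (auto simp: monomial_def)

lemma C_zero [simp]: "(\<lambda>n. \<zero>) \<in> C"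
  by (rule C_memI) auto

lemma C_add [simp]:
  assumes "p \<in> C" "q \<in> C"
  shows "(\<lambda>n. p n \<oplus> q n) \<in> C"
proof (rule C_memI)
  show "p n \<oplus> q n = \<zero> \<or> p n \<oplus> q n = \<one>" for n
    using C_coeff[OF assms(1), of n] C_coeff[OF assms(2), of n] by (auto simp: char2)
qed (use assms in simp)

lemma C_shift [simp]: "p \<in> C \<Longrightarrow> shift_seq R p \<in> C"
  by (rule C_memI) (auto simp: shift_seq_def C_coeff split: nat.split)

text \<open>On 0 and 1 the map \<sigma> is the identity and \<delta> vanishes, so x commutes with
  every element of C.\<close>

lemma X_C: "p \<in> C \<Longrightarrow> X p = shift_seq R p"
proof
  fix n assume p: "p \<in> C"
  show "X p n = shift_seq R p n"
    using C_coeff[OF p, of n] C_coeff[OF p, of "n - 1"]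
    by (auto simp: ore_shift_def shift_seq_def split: nat.split)
qed

lemma C_induct [consumes 1, case_names zero add]:
  assumes "c \<in> C" and "P (\<lambda>n. \<zero>)"
    and "\<And>c i. c \<in> C \<Longrightarrow> P c \<Longrightarrow> P (\<lambda>n. c n \<oplus> monomial R \<one> i n)"
  shows "P c"
proof -
  have "c \<in> up R" "range c \<subseteq> {\<zero>, \<one>}" using assms(1) by (auto simp: C_iff)
  then show ?thesis
  proof (induction c rule: up_induct)
    case zero
    show ?case by fact
  next
    case (add p b i)
    then have p: "p \<in> C" by (auto simp: C_iff)
    from \<open>b \<in> {\<zero>, \<one>}\<close> consider "b = \<zero>" | "b = \<one>" by blast
    then show ?case
    proof cases
      case 1
      then show ?thesis using add by (simp add: monomial_zero)
    next
      case 2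
      then show ?thesis using assms(3)[OF p] add by simp
    qed
  qed
qed

lemma Xpow_C [simp]: "p \<in> C \<Longrightarrow> (X ^^ i) p \<in> C"
  by (induction i) (auto simp: X_C)

lemma C_mult [simp]:
  assumes "p \<in> C" "q \<in> C"
  shows "p \<otimes>\<^bsub>B\<^esub> q \<in> C"
  using assms(1)
  by (induction p rule: C_induct) (use assms in \<open>simp_all add: B_zero_mult B_l_distr x_pow_mult\<close>)

lemma B_minus:
  assumes "p \<in> C"
  shows "\<ominus>\<^bsub>B\<^esub> p = p"
proof -
  interpret B: ring B by (rule B_ring)
  have "p n \<oplus> p n = \<zero>" for n
    using C_coeff[OF assms, of n] by (auto simp: char2)
  then show ?thesis
    using assms by (intro B.minus_equality) auto
qed

lemma C_subring: "subring C B"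
proof -
  interpret B: ring B by (rule B_ring)
  show ?thesis
    by (rule B.subringI) (auto simp: ore_extension_one B_minus)
qed

lemma B_ring_extension: "ring_extension B C"
  by (simp add: ring_extension_def B_ring C_subring)

lemma additive_zero:
  assumes "f (\<lambda>n. \<zero>) \<in> up R"
    and "\<And>u v. u \<in> up R \<Longrightarrow> v \<in> up R \<Longrightarrow> f (\<lambda>n. u n \<oplus> v n) = (\<lambda>n. f u n \<oplus> f v n)"
  shows "f (\<lambda>n. \<zero>) = (\<lambda>n. \<zero>)"
proof
  fix n
  have "f (\<lambda>n. \<zero> \<oplus> \<zero>) = (\<lambda>n. f (\<lambda>n. \<zero>) n \<oplus> f (\<lambda>n. \<zero>) n)"
    by (intro assms(2)) simp_all
  then have "f (\<lambda>n. \<zero>) n \<oplus> f (\<lambda>n. \<zero>) n = f (\<lambda>n. \<zero>) n"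
    by (metis l_zero zero_closed)
  then show "f (\<lambda>n. \<zero>) n = \<zero>"
    using assms(1) by simp
qed

text \<open>As a ring C is generated by x, so for an additive map linearity reduces to commuting
  with one operator: \<open>X\<close> on the left, the shift in
  \<open>right_C_linear\<close>.\<close>

lemma left_C_linear:
  assumes f_closed: "\<And>u. u \<in> up R \<Longrightarrow> f u \<in> up R"
    and f_add: "\<And>u v. u \<in> up R \<Longrightarrow> v \<in> up R \<Longrightarrow> f (\<lambda>n. u n \<oplus> v n) = (\<lambda>n. f u n \<oplus> f v n)"
    and f_X: "\<And>u. u \<in> up R \<Longrightarrow> f (X u) = X (f u)"
    and "c \<in> C" "u \<in> up R"
  shows "f (c \<otimes>\<^bsub>B\<^esub> u) = c \<otimes>\<^bsub>B\<^esub> f u"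
proof -
  have f_zero: "f (\<lambda>n. \<zero>) = (\<lambda>n. \<zero>)"
    by (rule additive_zero[of f]) (simp_all add: f_closed f_add)
  have f_Xpow: "f ((X ^^ i) u) = (X ^^ i) (f u)" for i
    using \<open>u \<in> up R\<close> by (induction i) (simp_all add: f_X)
  from \<open>c \<in> C\<close> show ?thesis
    by (induction c rule: C_induct)
      (use assms(5) in \<open>simp_all add: f_zero B_zero_mult B_l_distr x_pow_mult f_add f_Xpow f_closed\<close>)
qed

lemma mult_monomial_Suc:
  assumes "u \<in> up R"
  shows "u \<otimes>\<^bsub>B\<^esub> monomial R \<one> (Suc i) = shift_seq R (u \<otimes>\<^bsub>B\<^esub> monomial R \<one> i)"
proof -
  have "monomial R \<one> (Suc i) = monomial R \<one> i \<otimes>\<^bsub>B\<^esub> x"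
    by (simp add: mult_x shift_seq_monomial del: One_nat_def)
  then have "u \<otimes>\<^bsub>B\<^esub> monomial R \<one> (Suc i) = (u \<otimes>\<^bsub>B\<^esub> monomial R \<one> i) \<otimes>\<^bsub>B\<^esub> x"
    using assms by (simp only: B_assoc monomial_closed one_closed)
  then show ?thesis using assms by (simp only: mult_x B_mult_closed monomial_closed one_closed)
qed

lemma right_C_linear:
  assumes f_closed: "\<And>u. u \<in> up R \<Longrightarrow> f u \<in> up R"
    and f_add: "\<And>u v. u \<in> up R \<Longrightarrow> v \<in> up R \<Longrightarrow> f (\<lambda>n. u n \<oplus> v n) = (\<lambda>n. f u n \<oplus> f v n)"
    and f_shift: "\<And>u. u \<in> up R \<Longrightarrow> f (shift_seq R u) = shift_seq R (f u)"
    and "c \<in> C" "u \<in> up R"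
  shows "f (u \<otimes>\<^bsub>B\<^esub> c) = f u \<otimes>\<^bsub>B\<^esub> c"
proof -
  interpret B: ring B by (rule B_ring)
  have f_zero: "f (\<lambda>n. \<zero>) = (\<lambda>n. \<zero>)"
    by (rule additive_zero[of f]) (simp_all add: f_closed f_add)
  have r_zero: "v \<otimes>\<^bsub>B\<^esub> (\<lambda>n. \<zero>) = (\<lambda>n. \<zero>)" if "v \<in> up R" for v
    using B.r_null[of v] that by simp
  have f_pow: "f (u \<otimes>\<^bsub>B\<^esub> monomial R \<one> i) = f u \<otimes>\<^bsub>B\<^esub> monomial R \<one> i" for i
    using \<open>u \<in> up R\<close> by (induction i) (simp_all add: B_mult_one mult_monomial_Suc f_shift f_closed)
  from \<open>c \<in> C\<close> show ?thesis
    by (induction c rule: C_induct)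
      (use assms(5) in \<open>simp_all add: f_zero r_zero B_r_distr f_add f_pow f_closed\<close>)
qed

text \<open>A linear form over the prime field, with that field realised as {0, 1} inside
  \<open>R\<close>. Applied to each coefficient it therefore maps B into C directly.\<close>

definition F2_functional :: "('a \<Rightarrow> 'a) \<Rightarrow> bool" where
  "F2_functional t \<longleftrightarrow> (\<forall>u\<in>carrier R. t u = \<zero> \<or> t u = \<one>) \<and>
     (\<forall>u\<in>carrier R. \<forall>v\<in>carrier R. t (u \<oplus> v) = t u \<oplus> t v)"

lemma F2_functional_closed: "F2_functional t \<Longrightarrow> u \<in> carrier R \<Longrightarrow> t u \<in> carrier R"
  unfolding F2_functional_def by (metis one_closed zero_closed)

lemma F2_functional_zero: "F2_functional t \<Longrightarrow> t \<zero> = \<zero>"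
  using F2_functional_closed[of t \<zero>] unfolding F2_functional_def
  by (metis add.l_cancel_one zero_closed l_zero)

lemma coeffwise_closed:
  assumes "F2_functional t" "p \<in> up R"
  shows "(\<lambda>n. t (p n)) \<in> C"
proof (rule C_memI)
  obtain N where "\<And>n. n > N \<Longrightarrow> p n = \<zero>" using up_bounded[OF assms(2)] by blast
  then show "(\<lambda>n. t (p n)) \<in> up R"
    using assms by (intro up_memI[of _ N]) (simp_all add: F2_functional_zero F2_functional_closed)
  show "t (p n) = \<zero> \<or> t (p n) = \<one>" for n
    using assms by (auto simp: F2_functional_def)
qed

lemma coeffwise_add:
  assumes "F2_functional t" "p \<in> up R" "q \<in> up R"
  shows "(\<lambda>n. t (p n \<oplus> q n)) = (\<lambda>n. t (p n) \<oplus> t (q n))"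
  using assms by (auto simp: F2_functional_def)

lemma coeffwise_shift:
  assumes "F2_functional t"
  shows "(\<lambda>n. t (shift_seq R p n)) = shift_seq R (\<lambda>n. t (p n))"
  using assms by (auto simp: shift_seq_def fun_eq_iff F2_functional_zero split: nat.split)

text \<open>Right multiplication by x merely shifts left coefficients, so it commutes with every
  coefficientwise map. This supplies the right linear functionals of the whole development,
  including the one that a Frobenius isomorphism will fail to reach.\<close>

lemma coeffwise_right_C_linear:
  assumes "F2_functional t" "p \<in> up R" "c \<in> C"
  shows "(\<lambda>n. t ((p \<otimes>\<^bsub>B\<^esub> c) n)) = (\<lambda>n. t (p n)) \<otimes>\<^bsub>B\<^esub> c"
  using assms
  by (intro right_C_linear[where f = "\<lambda>p n. t (p n)"])
    (auto simp: coeffwise_add coeffwise_shift coeffwise_closed)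

lemma B_finsum:
  assumes "finite K" "g \<in> K \<rightarrow> up R"
  shows "(\<Oplus>\<^bsub>B\<^esub>k\<in>K. g k) = (\<lambda>n. \<Oplus>k\<in>K. g k n)"
proof -
  interpret B: ring B by (rule B_ring)
  from assms show ?thesis
  proof (induction K rule: finite_induct)
    case (insert k K)
    then have "(\<lambda>k. g k n) \<in> K \<rightarrow> carrier R" for n by (auto simp: Pi_def)
    with insert show ?case by (simp add: B.finsum_insert finsum_insert Pi_def)
  qed simp
qed

lemma C_ring: "ring (B\<lparr>carrier := C\<rparr>)"
  using ring.subring_is_ring[OF B_ring C_subring] .

lemma left_module_B: "left_module (B\<lparr>carrier := C\<rparr>) (left_mult_module B (carrier B))"
proof -
  interpret B: ring B by (rule B_ring)
  interpret C: ring "B\<lparr>carrier := C\<rparr>" by (rule C_ring)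
  interpret M: abelian_group "left_mult_module B (carrier B)"
    by (rule mult_module_abelian_group[OF B_ring])
  show ?thesis
    by unfold_locales (auto simp: B_l_distr B_r_distr B_assoc)
qed

lemma right_module_B:
  "left_module (opposite_ring (B\<lparr>carrier := C\<rparr>)) (right_mult_module B (carrier B))"
proof -
  interpret B: ring B by (rule B_ring)
  interpret C: ring "opposite_ring (B\<lparr>carrier := C\<rparr>)" by (rule opposite_ring_ring[OF C_ring])
  interpret M: abelian_group "right_mult_module B (carrier B)"
    by (rule mult_module_abelian_group[OF B_ring])
  show ?thesis
    by unfold_locales (auto simp: B_l_distr B_r_distr B_assoc)
qed

text \<open>Coefficients 0 and 1 commute with x, so c u is the sum of the x^n (c_n u), which
  exhibits its right coefficients.\<close>

lemma C_mult_const: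
  assumes "c \<in> C" "u \<in> carrier R"
  shows "c \<otimes>\<^bsub>B\<^esub> monomial R u 0 = right_form (\<lambda>n. c n \<otimes> u)"
  using assms(1)
proof (induction c rule: C_induct)
  case zero
  then show ?case using assms by (simp add: B_zero_mult right_form_zero)
next
  case (add c i)
  have cu: "(\<lambda>n. c n \<otimes> u) \<in> up R"
  proof -
    obtain N where "\<And>n. n > N \<Longrightarrow> c n = \<zero>" using up_bounded[of c] add(1) by auto
    then show ?thesis using assms add(1) by (intro up_memI[of _ N]) auto
  qed
  have "(\<lambda>n. (c n \<oplus> monomial R \<one> i n) \<otimes> u) = (\<lambda>n. c n \<otimes> u \<oplus> monomial R u i n)"
    using assms add by (auto simp: l_distr) (auto simp: monomial_def)
  with add assms cu show ?case
    by (simp add: B_l_distr x_pow_mult right_form_add right_form_monomial)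
qed

section \<open>Dual bases of the extension, lifted from a basis of the coefficient ring\<close>

context
  fixes K :: "'k set" and e :: "'k \<Rightarrow> 'a" and t :: "'k \<Rightarrow> 'a \<Rightarrow> 'a"
  assumes K: "finite K" and e_inj: "inj_on e K" and e_closed: "\<And>k. k \<in> K \<Longrightarrow> e k \<in> carrier R"
    and t: "\<And>k. k \<in> K \<Longrightarrow> F2_functional (t k)"
    and basis: "\<And>u. u \<in> carrier R \<Longrightarrow> (\<Oplus>k\<in>K. t k u \<otimes> e k) = u"
begin

lemma const_inj: "inj_on (\<lambda>k. monomial R (e k) 0) K"
proof (rule inj_onI)
  fix k l assume "k \<in> K" "l \<in> K" "monomial R (e k) 0 = monomial R (e l) 0"
  then show "k = l" using e_inj by (auto simp: monomial_def fun_eq_iff inj_on_def split: if_splits)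
qed

text \<open>Recovers the index from the basis element, as the dual basis lemma names coordinates by
  module elements.\<close>

abbreviation basis_index :: "(nat \<Rightarrow> 'a) \<Rightarrow> 'k" where
  "basis_index \<equiv> inv_into K (\<lambda>k. monomial R (e k) 0)"

lemma basis_index [simp]: "k \<in> K \<Longrightarrow> basis_index (monomial R (e k) 0) = k"
  using inv_into_f_f[OF const_inj, of k] by simp

text \<open>Expanding each left coefficient in the basis writes p as the sum over k of e_k times the
  polynomial with coefficients t_k(p_n): the basis stays on the left and the scalars on the
  right.\<close>

lemma right_fg_projective_B: "right_fg_projective B C"
proof -
  interpret B: ring B by (rule B_ring)
  let ?f = "\<lambda>w p n. t (basis_index w) (p n)"
  have "(\<Oplus>\<^bsub>B\<^esub>w\<in>(\<lambda>k. monomial R (e k) 0) ` K. w \<otimes>\<^bsub>B\<^esub> ?f w p) = p" if p: "p \<in> up R" for p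
  proof -
    have "(\<Oplus>\<^bsub>B\<^esub>w\<in>(\<lambda>k. monomial R (e k) 0) ` K. w \<otimes>\<^bsub>B\<^esub> ?f w p)
        = (\<Oplus>\<^bsub>B\<^esub>k\<in>K. monomial R (e k) 0 \<otimes>\<^bsub>B\<^esub> (\<lambda>n. t k (p n)))"
      using const_inj p e_closed coeffwise_closed[OF t]
      by (subst B.finsum_reindex) (auto intro!: B.finsum_cong simp: simp_implies_def)
    also have "\<dots> = (\<lambda>n. \<Oplus>k\<in>K. (monomial R (e k) 0 \<otimes>\<^bsub>B\<^esub> (\<lambda>n. t k (p n))) n)"
      using K p e_closed coeffwise_closed[OF t] by (intro B_finsum) auto
    also have "\<dots> = (\<lambda>n. \<Oplus>k\<in>K. t k (p n) \<otimes> e k)"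
    proof
      fix n
      have "(monomial R (e k) 0 \<otimes>\<^bsub>B\<^esub> (\<lambda>n. t k (p n))) n = t k (p n) \<otimes> e k" if "k \<in> K" for k
        using that p e_closed coeffwise_closed[OF t, of k p] C_coeff[OF coeffwise_closed[OF t, of k p], of n]
        by (auto simp: B_monomial_mult)
      then show "(\<Oplus>k\<in>K. (monomial R (e k) 0 \<otimes>\<^bsub>B\<^esub> (\<lambda>n. t k (p n))) n) = (\<Oplus>k\<in>K. t k (p n) \<otimes> e k)"
        using p e_closed F2_functional_closed[OF t] by (intro finsum_cong) (auto simp: simp_implies_def)
    qed
    also have "\<dots> = p" using p by (simp add: basis)
    finally show ?thesis .
  qed
  then show ?thesis
    unfolding right_fg_projective_def
    using K e_closed coeffwise_closed[OF t] coeffwise_add[OF t] coeffwise_right_C_linear[OF t]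
    by (intro left_module.dual_basis_imp_fg_projective[OF right_module_B,
          where K = "(\<lambda>k. monomial R (e k) 0) ` K" and f = ?f])
      (auto simp: mult_module_finsum)
qed

text \<open>The mirror image works on right coefficients: if p is the sum of the x^n q_n, then
  expanding q_n puts the scalars on the left. These coefficients exist because \<sigma> is
  bijective.\<close>

lemma left_fg_projective_B:
  assumes "ore_maps R \<sigma>' \<delta>'"
    and \<sigma>\<sigma>': "\<And>a. a \<in> carrier R \<Longrightarrow> \<sigma> (\<sigma>' a) = a"
    and \<sigma>'\<sigma>: "\<And>a. a \<in> carrier R \<Longrightarrow> \<sigma>' (\<sigma> a) = a"
    and \<delta>\<sigma>': "\<And>a. a \<in> carrier R \<Longrightarrow> \<delta> (\<sigma>' a) \<oplus> \<delta>' a = \<zero>"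
  shows "left_fg_projective B C"
proof -
  interpret B: ring B by (rule B_ring)
  interpret inv: ore_maps R \<sigma>' \<delta>' by fact
  have \<delta>'\<sigma>: "\<delta>' (\<sigma> u) \<oplus> \<delta> u = \<zero>" if "u \<in> carrier R" for u
    using \<delta>\<sigma>'[of "\<sigma> u"] that \<sigma>'\<sigma>[of u] by (simp add: a_comm)
  \<comment> \<open>The same shift lemma with the two twists exchanged: on right coefficients, left
    multiplication by x is a plain shift.\<close>
  have inv_X: "inv.right_form (X p) = shift_seq R (inv.right_form p)" if "p \<in> up R" for p
    using inv.right_form_inverse_shift[OF ore_maps_axioms \<sigma>'\<sigma> \<delta>'\<sigma> that] .
  let ?f = "\<lambda>w p n. t (basis_index w) (inv.right_form p n)"
  have f_X: "?f w (X p) = X (?f w p)" if "w \<in> (\<lambda>k. monomial R (e k) 0) ` K" "p \<in> up R" for w p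
    using that coeffwise_closed[OF t]
    by (auto simp: inv_X coeffwise_shift[OF t] X_C)
  have sum: "(\<Oplus>\<^bsub>B\<^esub>w\<in>(\<lambda>k. monomial R (e k) 0) ` K. ?f w p \<otimes>\<^bsub>B\<^esub> w) = p" if p: "p \<in> up R" for p
  proof -
    let ?q = "inv.right_form p"
    have q: "?q \<in> up R" using p by simp
    have scaled: "(\<lambda>n. t k (?q n) \<otimes> e k) \<in> up R" if "k \<in> K" for k
    proof -
      obtain N where "\<And>n. n > N \<Longrightarrow> ?q n = \<zero>" using up_bounded[OF q] by auto
      then show ?thesis
        using q e_closed t that
        by (intro up_memI[of _ N]) (auto simp: F2_functional_closed F2_functional_zero)
    qed
    have "(\<Oplus>\<^bsub>B\<^esub>w\<in>(\<lambda>k. monomial R (e k) 0) ` K. ?f w p \<otimes>\<^bsub>B\<^esub> w)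
        = (\<Oplus>\<^bsub>B\<^esub>k\<in>K. (\<lambda>n. t k (?q n)) \<otimes>\<^bsub>B\<^esub> monomial R (e k) 0)"
      using const_inj q e_closed coeffwise_closed[OF t]
      by (subst B.finsum_reindex) (auto intro!: B.finsum_cong simp: simp_implies_def)
    also have "\<dots> = (\<Oplus>\<^bsub>B\<^esub>k\<in>K. right_form (\<lambda>n. t k (?q n) \<otimes> e k))"
      using q e_closed coeffwise_closed[OF t] scaled
      by (intro B.finsum_cong) (auto simp: simp_implies_def C_mult_const)
    also have "\<dots> = right_form (\<Oplus>\<^bsub>B\<^esub>k\<in>K. (\<lambda>n. t k (?q n) \<otimes> e k))"
      using K scaled
    proof (induction K rule: finite_induct)
      case empty
      then show ?case by (simp add: right_form_zero)
    next
      case (insert k K')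
      then have "(\<Oplus>\<^bsub>B\<^esub>k\<in>K'. (\<lambda>n. t k (?q n) \<otimes> e k)) \<in> carrier B"
        by (intro B.finsum_closed) (auto simp: Pi_def)
      with insert show ?case by (simp add: B.finsum_insert Pi_def right_form_add)
    qed
    also have "(\<Oplus>\<^bsub>B\<^esub>k\<in>K. (\<lambda>n. t k (?q n) \<otimes> e k)) = ?q"
      using K scaled q by (subst B_finsum) (auto simp: basis)
    also have "right_form ?q = p"
      using right_form_inverse[OF assms(1) \<sigma>\<sigma>' \<delta>\<sigma>' p] .
    finally show ?thesis .
  qed
  have f_lin: "?f w (c \<otimes>\<^bsub>B\<^esub> p) = c \<otimes>\<^bsub>B\<^esub> ?f w p"
    if "w \<in> (\<lambda>k. monomial R (e k) 0) ` K" "c \<in> C" "p \<in> up R" for w c p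
    using that coeffwise_closed[OF t]
    by (intro left_C_linear[where f = "?f w"] f_X)
      (auto simp: inv.right_form_add coeffwise_add[OF t])
  show ?thesis
    unfolding left_fg_projective_def
    using K e_closed coeffwise_closed[OF t] coeffwise_add[OF t] f_lin sum
    by (intro left_module.dual_basis_imp_fg_projective[OF left_module_B,
          where K = "(\<lambda>k. monomial R (e k) 0) ` K" and f = ?f])
      (auto simp: mult_module_finsum inv.right_form_add)
qed

end

text \<open>Invariance under \<sigma> and vanishing on \<delta> say exactly that applying
  \<open>t\<close> to the left coefficients turns x p into the shifted sequence, which in C is again
  left multiplication by x. With right linearity this gives a bimodule map.\<close>

lemma split_extension_B:
  assumes t: "F2_functional t" and t\<sigma>: "\<And>u. u \<in> carrier R \<Longrightarrow> t (\<sigma> u) = t u"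
    and t\<delta>: "\<And>u. u \<in> carrier R \<Longrightarrow> t (\<delta> u) = \<zero>" and t_one: "t \<one> = \<one>"
  shows "split_extension B C"
  unfolding split_extension_def
proof (intro exI conjI)
  let ?\<xi> = "\<lambda>p\<in>up R. \<lambda>n. t (p n)"
  have X: "(\<lambda>n. t (X p n)) = X (\<lambda>n. t (p n))" if p: "p \<in> up R" for p
  proof -
    have "(\<lambda>n. t (X p n)) = shift_seq R (\<lambda>n. t (p n))"
    proof
      fix n
      have "t (X p n) = t (case n of 0 \<Rightarrow> \<zero> | Suc m \<Rightarrow> \<sigma> (p m)) \<oplus> t (\<delta> (p n))"
        unfolding ore_shift_def using t p by (auto simp: F2_functional_def split: nat.split)
      then show "t (X p n) = shift_seq R (\<lambda>n. t (p n)) n"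
        using p F2_functional_closed[OF t] F2_functional_zero[OF t]
        by (auto simp: t\<sigma> t\<delta> shift_seq_def split: nat.split)
    qed
    also have "\<dots> = X (\<lambda>n. t (p n))"
      using coeffwise_closed[OF t p] by (simp add: X_C)
    finally show ?thesis .
  qed
  have "(\<lambda>n. t ((c \<otimes>\<^bsub>B\<^esub> p) n)) = c \<otimes>\<^bsub>B\<^esub> (\<lambda>n. t (p n))" if "c \<in> C" "p \<in> up R" for c p
    using that coeffwise_closed[OF t] coeffwise_add[OF t] X
    by (intro left_C_linear[where f = "\<lambda>p n. t (p n)"]) auto
  then show "?\<xi> \<in> module_hom (B\<lparr>carrier := C\<rparr>) (left_mult_module B (carrier B)) (left_mult_module B C)"
    using coeffwise_closed[OF t] coeffwise_add[OF t] by (auto simp: module_hom_def)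
  show "?\<xi> \<in> module_hom (opposite_ring (B\<lparr>carrier := C\<rparr>))
      (right_mult_module B (carrier B)) (right_mult_module B C)"
    using coeffwise_closed[OF t] coeffwise_add[OF t] coeffwise_right_C_linear[OF t]
    by (auto simp: module_hom_def)
  show "?\<xi> \<one>\<^bsub>B\<^esub> = \<one>\<^bsub>B\<^esub>"
    using F2_functional_zero[OF t] t_one by (auto simp: ore_extension_one monomial_def)
qed

end

section \<open>The field with eight elements and its matrices\<close>

definition elem_mat :: "nat \<Rightarrow> nat \<Rightarrow> 'f::zero \<Rightarrow> 'f mat" where
  "elem_mat i j c = mat 2 2 (\<lambda>(r, s). if r = i \<and> s = j then c else 0)"

lemma elem_mat_closed [simp]: "elem_mat i j c \<in> carrier_mat 2 2"
  by (simp add: elem_mat_def)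

lemma elem_mat_index [simp]:
  "r < 2 \<Longrightarrow> s < 2 \<Longrightarrow> elem_mat i j c $$ (r, s) = (if r = i \<and> s = j then c else 0)"
  by (simp add: elem_mat_def)

lemma mat2_eqI:
  assumes "X \<in> carrier_mat 2 2" "Y \<in> carrier_mat 2 2"
    and "X $$ (0, 0) = Y $$ (0, 0)" "X $$ (0, 1) = Y $$ (0, 1)"
      "X $$ (1, 0) = Y $$ (1, 0)" "X $$ (1, 1) = Y $$ (1, 1)"
  shows "X = Y"
proof (rule eq_matI)
  show "X $$ (i, j) = Y $$ (i, j)" if "i < dim_row Y" "j < dim_col Y" for i j
    using that assms less_2_cases[of i] less_2_cases[of j] by auto
qed (use assms in auto)

lemma mat2_mult_index:
  fixes X Y :: "'f::comm_semiring_1 mat"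
  assumes "X \<in> carrier_mat 2 2" "Y \<in> carrier_mat 2 2" "i < 2" "j < 2"
  shows "(X * Y) $$ (i, j) = X $$ (i, 0) * Y $$ (0, j) + X $$ (i, 1) * Y $$ (1, j)"
  using assms by (simp add: scalar_prod_def numeral_2_eq_2)

locale field8 =
  fixes a :: "'f::field"
  assumes card8: "card (UNIV :: 'f set) = 8"
    and root: "a ^ 3 + a ^ 2 + 1 = 0"
begin

lemma finite_field: "finite (UNIV :: 'f set)"
  using card8 card.infinite by fastforce

text \<open>Translation by 1 permutes the field, so comparing the sum of all elements with its
  translate gives 8 = 0, and a field has no nilpotents.\<close>

lemma two: "(2 :: 'f) = 0"
proof -
  have "(\<Sum>c\<in>(UNIV :: 'f set). c) = (\<Sum>c\<in>(UNIV :: 'f set). c + 1)"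
    by (rule sum.reindex_bij_witness[of _ "\<lambda>c. c + 1" "\<lambda>c. c - 1"]) auto
  also have "\<dots> = (\<Sum>c\<in>(UNIV :: 'f set). c) + of_nat (card (UNIV :: 'f set))"
    by (simp add: sum.distrib)
  finally have "(8 :: 'f) = 0" by (simp add: card8)
  moreover have "(8 :: 'f) = 2 * 2 * 2" by simp
  ultimately show ?thesis by (metis mult_eq_0_iff)
qed

lemma add_self [simp]: "c + c = (0 :: 'f)"
  using two by (metis mult_2 mult_zero_left)

lemma add_self_left [simp]: "c + (c + d) = (d :: 'f)"
  by (simp flip: add.assoc)

lemma minus_eq [simp]: "- c = (c :: 'f)"
  using add_self by (metis minus_unique)

lemma diff_eq [simp]: "c - d = c + (d :: 'f)"
  by (simp add: diff_conv_add_uminus del: add_uminus_conv_diff)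

lemma square_add: "(c + d) ^ 2 = c ^ 2 + (d :: 'f) ^ 2"
  by (simp add: power2_sum two)

text \<open>Multiplication by a nonzero c permutes the nonzero elements; the product of all seven
  thus acquires the factor c^7 without changing.\<close>

lemma pow8: "c ^ 8 = (c :: 'f)"
proof (cases "c = 0")
  case False
  have "c * (\<Prod>y\<in>UNIV-{0}. c * y) = c * c ^ (card (UNIV :: 'f set) - 1) * \<Prod>(UNIV-{0})"
    by (simp add: prod.distrib mult_ac finite_field)
  also have "c * c ^ (card (UNIV :: 'f set) - 1) = c ^ 8"
    by (simp add: card8 flip: power_Suc)
  also have "(\<Prod>y\<in>UNIV-{0}. c * y) = (\<Prod>y\<in>UNIV-{0}. y)"
    by (rule prod.reindex_bij_witness[of _ "\<lambda>y. y / c" "\<lambda>y. c * y"]) (use False in auto)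
  finally show ?thesis
    using finite_field by simp
qed simp

definition \<alpha> :: "nat \<Rightarrow> 'f" where
  "\<alpha> k = a ^ (2 ^ k)"

definition tr :: "'f \<Rightarrow> 'f" where
  "tr c = c + c ^ 2 + c ^ 4"

lemma a3: "a ^ 3 = a ^ 2 + 1"
proof -
  have "a ^ 3 = (a ^ 3 + a ^ 2 + 1) + (a ^ 2 + 1)" by (simp add: add_ac)
  then show ?thesis by (simp add: root)
qed

lemma a4: "a ^ 4 = a ^ 2 + a + 1"
proof -
  have "a ^ 4 = a * a ^ 3" by (simp add: eval_nat_numeral)
  also have "\<dots> = a * (a ^ 2 + 1)" by (simp only: a3)
  also have "\<dots> = a ^ 3 + a" by (simp add: distrib_left power2_eq_square power3_eq_cube)
  finally show ?thesis by (simp add: a3 add_ac)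
qed

lemma a5: "a ^ 5 = a + 1"
proof -
  have "a ^ 5 = a * a ^ 4" by (simp add: eval_nat_numeral)
  also have "\<dots> = a * (a ^ 2 + a + 1)" by (simp only: a4)
  also have "\<dots> = a ^ 3 + a ^ 2 + a" by (simp add: distrib_left power2_eq_square power3_eq_cube)
  finally show ?thesis by (simp add: a3 add_ac)
qed

lemma a6: "a ^ 6 = a ^ 2 + a"
proof -
  have "a ^ 6 = a * a ^ 5" by (simp add: eval_nat_numeral)
  then show ?thesis by (simp add: a5 algebra_simps power2_eq_square)
qed

lemma \<alpha>_simps: "\<alpha> 0 = a" "\<alpha> (Suc 0) = a ^ 2" "\<alpha> 1 = a ^ 2" "\<alpha> 2 = a ^ 4"
  by (simp_all add: \<alpha>_def)

text \<open>The conjugates of \<open>a\<close> form a self-dual normal basis of the field over its prime field.\<close>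

lemma \<alpha>_mult:
  "\<alpha> 0 * \<alpha> 0 = \<alpha> 1" "\<alpha> 1 * \<alpha> 1 = \<alpha> 2" "\<alpha> 2 * \<alpha> 2 = \<alpha> 0"
  "\<alpha> 0 * \<alpha> 1 = \<alpha> 0 + \<alpha> 2" "\<alpha> 0 * \<alpha> 2 = \<alpha> 1 + \<alpha> 2" "\<alpha> 1 * \<alpha> 2 = \<alpha> 0 + \<alpha> 1"
proof -
  show "\<alpha> 0 * \<alpha> 0 = \<alpha> 1" "\<alpha> 1 * \<alpha> 1 = \<alpha> 2"
    by (simp_all add: \<alpha>_simps power2_eq_square power4_eq_xxxx mult.assoc)
  show "\<alpha> 2 * \<alpha> 2 = \<alpha> 0" using pow8[of a] by (simp add: \<alpha>_simps flip: power_add)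
  have "a * a ^ 2 = a ^ 3" "a * a ^ 4 = a ^ 5" "a ^ 2 * a ^ 4 = a ^ 6" by (simp_all add: eval_nat_numeral)
  then show "\<alpha> 0 * \<alpha> 1 = \<alpha> 0 + \<alpha> 2" "\<alpha> 0 * \<alpha> 2 = \<alpha> 1 + \<alpha> 2" "\<alpha> 1 * \<alpha> 2 = \<alpha> 0 + \<alpha> 1"
    by (simp_all only: \<alpha>_simps a3 a4 a5 a6) (simp_all add: add_ac)
qed

lemma \<alpha>_comm: "\<alpha> 1 * \<alpha> 0 = \<alpha> 0 * \<alpha> 1" "\<alpha> 2 * \<alpha> 0 = \<alpha> 0 * \<alpha> 2" "\<alpha> 2 * \<alpha> 1 = \<alpha> 1 * \<alpha> 2"
  by (simp_all only: mult.commute)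

lemma \<alpha>_sum: "\<alpha> 0 + \<alpha> 1 + \<alpha> 2 = 1"
  by (simp add: \<alpha>_simps a4 add_ac)

lemma \<alpha>_square: "\<alpha> 0 ^ 2 = \<alpha> 1" "\<alpha> 1 ^ 2 = \<alpha> 2" "\<alpha> 2 ^ 2 = \<alpha> 0"
  using \<alpha>_mult by (simp_all add: power2_eq_square)

lemma \<alpha>_nonzero [simp]: "\<alpha> k \<noteq> 0"
  using root by (auto simp: \<alpha>_def)

lemma pow4: "c ^ 4 = (c ^ 2) ^ 2" for c :: 'f
  by (simp add: power4_eq_xxxx power2_eq_square mult.assoc)

lemma tr_add: "tr (c + d) = tr c + tr d"
  by (simp only: tr_def pow4 square_add add_ac)

lemma tr_square: "tr (c ^ 2) = tr c"
proof -
  have "((c ^ 2) ^ 2) ^ 2 = c" using pow8[of c] by simp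
  then show ?thesis by (simp only: tr_def pow4 add_ac)
qed

lemma tr_\<alpha>: "tr (\<alpha> 0) = 1" "tr (\<alpha> 1) = 1" "tr (\<alpha> 2) = 1"
proof -
  show 0: "tr (\<alpha> 0) = 1"
    using \<alpha>_sum by (simp add: tr_def \<alpha>_simps)
  show 1: "tr (\<alpha> 1) = 1"
    using tr_square[of "\<alpha> 0"] 0 by (simp only: \<alpha>_square)
  show "tr (\<alpha> 2) = 1"
    using tr_square[of "\<alpha> 1"] 1 by (simp only: \<alpha>_square)
qed

lemma tr_cases: "tr c = 0 \<or> tr c = 1"
proof -
  have "tr c ^ 2 = tr (c ^ 2)" by (simp only: tr_def pow4 square_add)
  then have "tr c * tr c = tr c"
    by (simp only: tr_square flip: power2_eq_square)
  then show ?thesis by simp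
qed

lemma tr_zero [simp]: "tr 0 = 0"
  by (simp add: tr_def)

lemma tr_one [simp]: "tr 1 = 1"
  by (simp add: tr_def)

text \<open>Expanding the traces gives a combination of c, c^2 and c^4. The coefficient of c is the
  sum of the squares of the conjugates, which is their sum, namely 1. The other two equal the second
  elementary symmetric function of the conjugates, which vanishes as the minimal polynomial of a has
  no linear term.\<close>

lemma \<alpha>_basis: "tr (\<alpha> 0 * c) * \<alpha> 0 + tr (\<alpha> 1 * c) * \<alpha> 1 + tr (\<alpha> 2 * c) * \<alpha> 2 = c"
proof -
  have \<alpha>_pow4: "\<alpha> 0 ^ 4 = \<alpha> 2" "\<alpha> 1 ^ 4 = \<alpha> 0" "\<alpha> 2 ^ 4 = \<alpha> 1"
    unfolding pow4 \<alpha>_square by (rule refl)+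
  have "tr (\<alpha> 0 * c) * \<alpha> 0 + tr (\<alpha> 1 * c) * \<alpha> 1 + tr (\<alpha> 2 * c) * \<alpha> 2
      = (\<alpha> 0 * \<alpha> 0 + \<alpha> 1 * \<alpha> 1 + \<alpha> 2 * \<alpha> 2) * c
        + (\<alpha> 0 * \<alpha> 1 + \<alpha> 1 * \<alpha> 2 + \<alpha> 0 * \<alpha> 2) * c ^ 2
        + (\<alpha> 0 * \<alpha> 2 + \<alpha> 0 * \<alpha> 1 + \<alpha> 1 * \<alpha> 2) * c ^ 4"
    unfolding tr_def power_mult_distrib \<alpha>_square \<alpha>_pow4 by (simp only: algebra_simps)
  also have "\<dots> = (\<alpha> 0 + \<alpha> 1 + \<alpha> 2) * c"
    unfolding \<alpha>_mult by (simp add: algebra_simps)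
  finally show ?thesis by (simp only: \<alpha>_sum mult_1_left)
qed

text \<open>The inverse is a witness because the degree 3 is odd, so that 1 has trace 1.\<close>

lemma tr_nondegenerate:
  assumes "c \<noteq> 0"
  obtains d where "tr (c * d) = 1"
proof
  show "tr (c * inverse c) = 1" using assms by simp
qed

text \<open>The coordinates in \<open>\<alpha>_basis\<close> are 0 or 1, so additive statements
  about the field have to be checked on the three conjugates only.\<close>

lemma additive_subset_UNIV:
  assumes "0 \<in> S" "\<alpha> 0 \<in> S" "\<alpha> 1 \<in> S" "\<alpha> 2 \<in> S" "\<And>c d. c \<in> S \<Longrightarrow> d \<in> S \<Longrightarrow> c + d \<in> S"
  shows "c \<in> S"
proof -
  have "tr u * \<alpha> k \<in> S" if "\<alpha> k \<in> S" for u k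
    using tr_cases[of u] that assms(1) by auto
  then show ?thesis
    using \<alpha>_basis[of c] assms by metis
qed

abbreviation A :: "'f mat ring" where
  "A \<equiv> ring_mat TYPE('f) 2 ()"

abbreviation M :: "'f mat" where
  "M \<equiv> M_mat a"

abbreviation \<delta> :: "'f mat \<Rightarrow> 'f mat" where
  "\<delta> \<equiv> inner_deriv M sq_entries"

lemma M_closed [simp]: "M \<in> carrier_mat 2 2"
  by (simp add: M_mat_def mat_of_rows_list_def numeral_2_eq_2)

lemma M_index: "M $$ (0, 0) = 0" "M $$ (0, 1) = 0" "M $$ (1, 0) = 0" "M $$ (1, 1) = a"
  by (simp_all add: M_mat_def mat_of_rows_list_def)

lemma sq_closed [simp]: "X \<in> carrier_mat 2 2 \<Longrightarrow> sq_entries X \<in> carrier_mat 2 2"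
  by (simp add: sq_entries_def)

lemma sq_index [simp]:
  "X \<in> carrier_mat 2 2 \<Longrightarrow> i < 2 \<Longrightarrow> j < 2 \<Longrightarrow> sq_entries X $$ (i, j) = (X $$ (i, j)) ^ 2"
  by (simp add: sq_entries_def)

lemma \<delta>_closed [simp]: "X \<in> carrier_mat 2 2 \<Longrightarrow> \<delta> X \<in> carrier_mat 2 2"
  unfolding inner_deriv_def by (intro minus_carrier_mat mult_carrier_mat[of _ _ 2] sq_closed M_closed)

text \<open>The left factor M affects only row 1 and the right factor only column 1. So the entry
  (0, 0) receives nothing, the off-diagonal entries one term each, and (1, 1) both: this asymmetry
  is what separates splitting from the Frobenius property.\<close>

lemma \<delta>_index:
  assumes "X \<in> carrier_mat 2 2"
  shows "\<delta> X $$ (0, 0) = 0" "\<delta> X $$ (0, 1) = (X $$ (0, 1)) ^ 2 * a"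
    "\<delta> X $$ (1, 0) = a * X $$ (1, 0)" "\<delta> X $$ (1, 1) = a * X $$ (1, 1) + (X $$ (1, 1)) ^ 2 * a"
proof -
  have "\<delta> X $$ (i, j) = (M * X) $$ (i, j) + (sq_entries X * M) $$ (i, j)" if "i < 2" "j < 2" for i j
    using that carrier_matD[OF mult_carrier_mat[OF sq_closed[OF assms] M_closed]]
    by (simp add: inner_deriv_def del: index_mult_mat)
  then show "\<delta> X $$ (0, 0) = 0" "\<delta> X $$ (0, 1) = (X $$ (0, 1)) ^ 2 * a"
    "\<delta> X $$ (1, 0) = a * X $$ (1, 0)" "\<delta> X $$ (1, 1) = a * X $$ (1, 1) + (X $$ (1, 1)) ^ 2 * a"
    using assms by (simp_all add: mat2_mult_index M_index[unfolded One_nat_def] del: index_mult_mat)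
qed

lemma mat_add_index [simp]:
  "X \<in> carrier_mat 2 2 \<Longrightarrow> Y \<in> carrier_mat 2 2 \<Longrightarrow> i < 2 \<Longrightarrow> j < 2 \<Longrightarrow>
    (X + Y) $$ (i, j) = X $$ (i, j) + Y $$ (i, j)"
  by simp

lemma ore_char2_A: "ore_char2 A sq_entries \<delta>"
proof -
  interpret A: ring A by (rule ring_mat)
  show ?thesis
  proof unfold_locales
    fix X Y assume "X \<in> carrier A" "Y \<in> carrier A"
    then have X: "X \<in> carrier_mat 2 2" and Y: "Y \<in> carrier_mat 2 2" by (simp_all add: ring_mat_simps)
    have XY: "X * Y \<in> carrier_mat 2 2" "X + Y \<in> carrier_mat 2 2" using X Y by auto
    show "sq_entries X \<in> carrier A" "\<delta> X \<in> carrier A" using X by (simp_all add: ring_mat_simps)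
    show "sq_entries (X \<oplus>\<^bsub>A\<^esub> Y) = sq_entries X \<oplus>\<^bsub>A\<^esub> sq_entries Y"
      unfolding ring_mat_simps using X Y XY by (intro mat2_eqI) (simp_all add: square_add)
    show "\<delta> (X \<oplus>\<^bsub>A\<^esub> Y) = \<delta> X \<oplus>\<^bsub>A\<^esub> \<delta> Y"
      unfolding ring_mat_simps using X Y XY
      by (intro mat2_eqI) (simp_all add: \<delta>_index[unfolded One_nat_def] square_add algebra_simps)
    show "sq_entries (X \<otimes>\<^bsub>A\<^esub> Y) = sq_entries X \<otimes>\<^bsub>A\<^esub> sq_entries Y"
      unfolding ring_mat_simps using X Y XY
      by (intro mat2_eqI)
        (simp_all add: mat2_mult_index square_add power_mult_distrib mult_carrier_mat[of _ 2 2] del: index_mult_mat)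
    show "\<delta> (X \<otimes>\<^bsub>A\<^esub> Y) = sq_entries X \<otimes>\<^bsub>A\<^esub> \<delta> Y \<oplus>\<^bsub>A\<^esub> \<delta> X \<otimes>\<^bsub>A\<^esub> Y"
      unfolding ring_mat_simps using X Y XY mult_carrier_mat[of "sq_entries X" 2 2 "\<delta> Y" 2]
        mult_carrier_mat[of "\<delta> X" 2 2 Y 2]
      by (intro mat2_eqI)
        (simp_all add: mat2_mult_index \<delta>_index[unfolded One_nat_def] square_add power_mult_distrib
           algebra_simps del: index_mult_mat index_add_mat)
  next
    show "sq_entries \<one>\<^bsub>A\<^esub> = \<one>\<^bsub>A\<^esub>"
      unfolding ring_mat_simps by (intro mat2_eqI) simp_all
    show "\<one>\<^bsub>A\<^esub> \<oplus>\<^bsub>A\<^esub> \<one>\<^bsub>A\<^esub> = \<zero>\<^bsub>A\<^esub>"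
      unfolding ring_mat_simps by (intro mat2_eqI) simp_all
  qed
qed

end

sublocale field8 \<subseteq> ore: ore_char2 "ring_mat TYPE('f) 2 ()" sq_entries "inner_deriv (M_mat a) sq_entries"
  by (rule ore_char2_A)

section \<open>The extension is biseparable\<close>

context field8
begin

lemmas A_simps = ring_mat_simps

abbreviation B :: "(nat \<Rightarrow> 'f mat) ring" where
  "B \<equiv> ore_extension A sq_entries \<delta>"

abbreviation C :: "(nat \<Rightarrow> 'f mat) set" where
  "C \<equiv> F2_polys A"

abbreviation const :: "'f mat \<Rightarrow> nat \<Rightarrow> 'f mat" where
  "const X \<equiv> monomial A X 0"

text \<open>The prime field embedded as scalar matrices. It is applied to traces, whose only nonzero
  value is 1.\<close>

definition bit :: "'f \<Rightarrow> 'f mat" where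
  "bit c = (if c = 0 then 0\<^sub>m 2 2 else 1\<^sub>m 2)"

lemma bit_closed [simp]: "bit c \<in> carrier_mat 2 2"
  by (simp add: bit_def)

lemma bit_functional:
  assumes "\<And>X Y. X \<in> carrier_mat 2 2 \<Longrightarrow> Y \<in> carrier_mat 2 2 \<Longrightarrow> g (X + Y) = g X + g Y"
  shows "ore.F2_functional (\<lambda>X. bit (tr (g X)))"
  unfolding ore.F2_functional_def
proof (intro conjI ballI)
  show "bit (tr (g X)) = \<zero>\<^bsub>A\<^esub> \<or> bit (tr (g X)) = \<one>\<^bsub>A\<^esub>" for X
    by (simp add: bit_def A_simps)
  fix X Y assume XY: "X \<in> carrier A" "Y \<in> carrier A"
  have one: "1\<^sub>m 2 + 1\<^sub>m 2 = (0\<^sub>m 2 2 :: 'f mat)"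
    by (intro mat2_eqI) simp_all
  have "tr (g (X + Y)) = tr (g X) + tr (g Y)"
    using assms XY by (simp add: A_simps tr_add)
  then show "bit (tr (g (X \<oplus>\<^bsub>A\<^esub> Y))) = bit (tr (g X)) \<oplus>\<^bsub>A\<^esub> bit (tr (g Y))"
    using tr_cases[of "g X"] tr_cases[of "g Y"] by (auto simp: bit_def A_simps one)
qed

lemma split_B: "split_extension B C"
proof (rule ore.split_extension_B)
  show "ore.F2_functional (\<lambda>X. bit (tr (X $$ (0, 0))))"
    by (rule bit_functional) simp
  fix X assume "X \<in> carrier A"
  then have X: "X \<in> carrier_mat 2 2" by (simp add: A_simps)
  then show "bit (tr (sq_entries X $$ (0, 0))) = bit (tr (X $$ (0, 0)))"
    by (simp add: tr_square)
  show "bit (tr (\<delta> X $$ (0, 0))) = \<zero>\<^bsub>A\<^esub>"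
    using X by (simp add: \<delta>_index bit_def A_simps)
qed (simp add: bit_def A_simps)

definition basis_elem :: "nat \<times> nat \<times> nat \<Rightarrow> 'f mat" where
  "basis_elem = (\<lambda>(i, j, k). elem_mat i j (\<alpha> k))"

text \<open>By self-duality, the coordinate at \<open>\<alpha> k\<close> of an entry is the trace of
  its product with \<open>\<alpha> k\<close>.\<close>

definition basis_coord :: "nat \<times> nat \<times> nat \<Rightarrow> 'f mat \<Rightarrow> 'f mat" where
  "basis_coord = (\<lambda>(i, j, k) X. bit (tr (\<alpha> k * X $$ (i, j))))"

abbreviation basis_indices :: "(nat \<times> nat \<times> nat) set" where
  "basis_indices \<equiv> {..<2} \<times> {..<2} \<times> {..<3}"

text \<open>By the multiplication table the sum of two different conjugates is a product of
  conjugates, hence nonzero; in characteristic 2 this separates them.\<close>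

lemma \<alpha>_inj: "inj_on \<alpha> {..<3}"
proof -
  have neq: "\<alpha> 0 \<noteq> \<alpha> 1" "\<alpha> 0 \<noteq> \<alpha> 2" "\<alpha> 1 \<noteq> \<alpha> 2"
  proof -
    show "\<alpha> 0 \<noteq> \<alpha> 1"
      using \<alpha>_mult(4) \<alpha>_mult(1) \<alpha>_nonzero[of 0] \<alpha>_sum \<alpha>_square \<alpha>_mult add_self_left
      by (metis (no_types) add_self add.commute add.right_neutral \<alpha>_nonzero)
    show "\<alpha> 0 \<noteq> \<alpha> 2"
      using \<alpha>_mult(4) \<alpha>_nonzero[of 0] \<alpha>_nonzero[of 1] by (metis add_self mult_eq_0_iff)
    show "\<alpha> 1 \<noteq> \<alpha> 2"
      using \<alpha>_mult(5) \<alpha>_nonzero[of 0] \<alpha>_nonzero[of 2] by (metis add_self mult_eq_0_iff)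
  qed
  have "{..<3} = {0, 1, 2 :: nat}" by auto
  with neq show ?thesis by (auto simp: inj_on_def)
qed

lemma basis_elem_inj: "inj_on basis_elem basis_indices"
proof (rule inj_onI)
  fix u v assume u: "u \<in> basis_indices" and v: "v \<in> basis_indices" and eq: "basis_elem u = basis_elem v"
  obtain i j k where ijk: "u = (i, j, k)" by (metis prod_cases3)
  obtain i' j' k' where ijk': "v = (i', j', k')" by (metis prod_cases3)
  have "elem_mat i j (\<alpha> k) $$ (i, j) = elem_mat i' j' (\<alpha> k') $$ (i, j)"
    using eq by (simp only: ijk ijk' basis_elem_def prod.case)
  then have "elem_mat i' j' (\<alpha> k') $$ (i, j) = \<alpha> k"
    using u by (simp add: ijk)
  then have "i = i'" "j = j'" "\<alpha> k' = \<alpha> k"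
    using u v \<alpha>_nonzero[of k] by (auto simp: ijk ijk' split: if_splits)
  then show "u = v"
    using u v \<alpha>_inj by (auto simp: ijk ijk' inj_on_def)
qed

lemma A_finsum_index:
  assumes "finite K" "\<And>k. k \<in> K \<Longrightarrow> g k \<in> carrier_mat 2 2" "i < 2" "j < 2"
  shows "(\<Oplus>\<^bsub>A\<^esub>k\<in>K. g k) $$ (i, j) = (\<Sum>k\<in>K. g k $$ (i, j))"
  using assms(1,2)
proof (induction K rule: finite_induct)
  case empty
  then show ?case using assms by (simp add: A_simps)
next
  case (insert k K)
  then have "(\<Oplus>\<^bsub>A\<^esub>k\<in>K. g k) \<in> carrier_mat 2 2"
    using ore.finsum_closed[of g K] by (auto simp: A_simps)
  moreover have "(\<Oplus>\<^bsub>A\<^esub>k\<in>insert k K. g k) = g k + (\<Oplus>\<^bsub>A\<^esub>k\<in>K. g k)"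
    using insert by (subst ore.finsum_insert) (auto simp: A_simps)
  ultimately show ?case using insert assms by simp
qed

lemma bit_scale: "bit (tr c) * elem_mat i j d = elem_mat i j (tr c * d)"
  using tr_cases[of c]
  by (auto simp: bit_def left_mult_zero_mat[of _ 2 2] left_mult_one_mat[of _ 2 2] intro!: mat2_eqI)

lemma basis_expansion:
  assumes "X \<in> carrier_mat 2 2"
  shows "(\<Oplus>\<^bsub>A\<^esub>k\<in>basis_indices. basis_coord k X \<otimes>\<^bsub>A\<^esub> basis_elem k) = X"
proof -
  have idx: "{..<2} = {0, 1 :: nat}" "{..<3} = {0, 1, 2 :: nat}" by auto
  have summand: "basis_coord (i, j, k) X \<otimes>\<^bsub>A\<^esub> basis_elem (i, j, k)
      = elem_mat i j (tr (\<alpha> k * X $$ (i, j)) * \<alpha> k)" for i j k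
    by (simp add: basis_coord_def basis_elem_def A_simps bit_scale)
  have "(\<Oplus>\<^bsub>A\<^esub>k\<in>basis_indices. basis_coord k X \<otimes>\<^bsub>A\<^esub> basis_elem k) $$ (r, s) = X $$ (r, s)"
    if rs: "r < 2" "s < 2" for r s
  proof -
    have "(\<Oplus>\<^bsub>A\<^esub>k\<in>basis_indices. basis_coord k X \<otimes>\<^bsub>A\<^esub> basis_elem k) $$ (r, s)
        = (\<Sum>k\<in>basis_indices. (basis_coord k X \<otimes>\<^bsub>A\<^esub> basis_elem k) $$ (r, s))"
      using rs by (intro A_finsum_index) (auto simp: summand)
    also have "\<dots> = (\<Sum>i<2. \<Sum>j<2. \<Sum>k<3. (basis_coord (i, j, k) X \<otimes>\<^bsub>A\<^esub> basis_elem (i, j, k)) $$ (r, s))"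
      by (simp add: sum.cartesian_product)
    also have "\<dots> = X $$ (r, s)"
      unfolding summand idx using rs less_2_cases[of r] less_2_cases[of s]
        \<alpha>_basis[of "X $$ (r, s)", unfolded One_nat_def]
      by (auto simp: add.assoc)
    finally show ?thesis .
  qed
  moreover have "(\<Oplus>\<^bsub>A\<^esub>k\<in>basis_indices. basis_coord k X \<otimes>\<^bsub>A\<^esub> basis_elem k) \<in> carrier_mat 2 2"
  proof -
    have "(\<lambda>k. basis_coord k X \<otimes>\<^bsub>A\<^esub> basis_elem k) \<in> basis_indices \<rightarrow> carrier A"
      by (auto simp: summand A_simps(5))
    from ore.finsum_closed[OF this] show ?thesis by (simp add: A_simps(5))
  qed
  ultimately show ?thesis
    using assms by (intro mat2_eqI) simp_all
qed

lemma basis_hyps: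
  "finite basis_indices"
  "\<And>k. k \<in> basis_indices \<Longrightarrow> basis_elem k \<in> carrier A"
  "\<And>k. k \<in> basis_indices \<Longrightarrow> ore.F2_functional (basis_coord k)"
  "\<And>X. X \<in> carrier A \<Longrightarrow> (\<Oplus>\<^bsub>A\<^esub>k\<in>basis_indices. basis_coord k X \<otimes>\<^bsub>A\<^esub> basis_elem k) = X"
proof -
  show "ore.F2_functional (basis_coord k)" if "k \<in> basis_indices" for k
  proof -
    obtain i j l where k: "k = (i, j, l)" by (metis prod_cases3)
    show ?thesis
      using that unfolding k basis_coord_def prod.case
      by (intro bit_functional) (simp add: distrib_left)
  qed
  show "(\<Oplus>\<^bsub>A\<^esub>k\<in>basis_indices. basis_coord k X \<otimes>\<^bsub>A\<^esub> basis_elem k) = X" if "X \<in> carrier A" for X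
    using that by (intro basis_expansion) (simp add: A_simps)
qed (auto simp: basis_elem_def A_simps)

lemma right_fg_projective: "right_fg_projective B C"
  by (rule ore.right_fg_projective_B[OF basis_hyps(1) basis_elem_inj basis_hyps(2-4)])

text \<open>The Frobenius map has order three on the field with eight elements, so its square is its
  inverse.\<close>

abbreviation \<sigma>_inv :: "'f mat \<Rightarrow> 'f mat" where
  "\<sigma>_inv X \<equiv> sq_entries (sq_entries X)"

lemma sq_entries_cube: "X \<in> carrier_mat 2 2 \<Longrightarrow> sq_entries (sq_entries (sq_entries X)) = X"
  for X :: "'f mat"
  by (intro mat2_eqI) (simp_all add: pow8 flip: power_mult)

lemma mat_add_self: "X \<in> carrier_mat 2 2 \<Longrightarrow> X + X = 0\<^sub>m 2 2" for X :: "'f mat"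
  by (intro mat2_eqI) simp_all

text \<open>The sign in -\<delta>\<sigma>' disappears in characteristic 2.\<close>

lemma inverse_maps: "ore_maps A \<sigma>_inv (\<lambda>X. \<delta> (\<sigma>_inv X))"
  by unfold_locales (simp_all add: A_simps ore.\<sigma>_add[unfolded A_simps] ore.\<delta>_add[unfolded A_simps])

lemma left_fg_projective: "left_fg_projective B C"
proof (rule ore.left_fg_projective_B[OF basis_hyps(1) basis_elem_inj basis_hyps(2-4)])
  show "ore_maps A \<sigma>_inv (\<lambda>X. \<delta> (\<sigma>_inv X))" by (rule inverse_maps)
  show "sq_entries (\<sigma>_inv X) = X" "\<sigma>_inv (sq_entries X) = X"
    "\<delta> (\<sigma>_inv X) \<oplus>\<^bsub>A\<^esub> \<delta> (\<sigma>_inv X) = \<zero>\<^bsub>A\<^esub>" if "X \<in> carrier A" for X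
    using that by (simp_all add: A_simps sq_entries_cube mat_add_self)
qed

end

sublocale field8 \<subseteq> T: tensor_ring
  "ore_extension (ring_mat TYPE('f) 2 ()) sq_entries (inner_deriv (M_mat a) sq_entries)"
  "F2_polys (ring_mat TYPE('f) 2 ())"
proof -
  interpret ring B by (rule ore.B_ring)
  show "tensor_ring B C"
    by unfold_locales (simp add: subset_iff)
qed

section \<open>The separability idempotent\<close>

context field8
begin

abbreviation tensor_cong (infix \<open>\<approx>\<^sub>B\<close> 50) where
  "tensor_cong \<equiv> T.tcong"

abbreviation Q :: "nat \<Rightarrow> nat \<Rightarrow> 'f \<Rightarrow> 'f \<Rightarrow> (nat \<Rightarrow> 'f mat) \<times> (nat \<Rightarrow> 'f mat) \<Rightarrow>\<^sub>0 int" where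
  "Q i j c d \<equiv> frag_of (const (elem_mat i 0 c), const (elem_mat 0 j d))"

abbreviation sep_part :: "nat \<Rightarrow> (nat \<Rightarrow> 'f mat) \<times> (nat \<Rightarrow> 'f mat) \<Rightarrow>\<^sub>0 int" where
  "sep_part i \<equiv> Q i i (\<alpha> 0) (\<alpha> 0) + Q i i (\<alpha> 1) (\<alpha> 1) + Q i i (\<alpha> 2) (\<alpha> 2)"

text \<open>The matrix units are taken from the first column and row because these are annihilated by
  \<open>M\<close> on the inner side of the tensor, which makes the element commute with \<open>x\<close>.\<close>

definition sep_elem :: "(nat \<Rightarrow> 'f mat) \<times> (nat \<Rightarrow> 'f mat) \<Rightarrow>\<^sub>0 int" where
  "sep_elem = sep_part 0 + sep_part 1"

lemma const_closed [simp]: "X \<in> carrier_mat 2 2 \<Longrightarrow> monomial A X i \<in> up A"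
  using ore.monomial_closed[of X i] by (simp add: A_simps)

lemma Q_tens [simp]: "Q i j c d \<in> T.tens"
  by (rule T.tens_simps) simp_all

lemma sep_elem_tens: "sep_elem \<in> T.tens"
  unfolding sep_elem_def by (intro T.tens_simps(2) Q_tens)

lemma const_add:
  "X \<in> carrier_mat 2 2 \<Longrightarrow> Y \<in> carrier_mat 2 2 \<Longrightarrow> const (X + Y) = const X \<oplus>\<^bsub>B\<^esub> const Y"
  using ore.monomial_add[of X Y 0] by (simp add: A_simps)

lemma const_mult:
  "X \<in> carrier_mat 2 2 \<Longrightarrow> Y \<in> carrier_mat 2 2 \<Longrightarrow> const X \<otimes>\<^bsub>B\<^esub> const Y = const (X * Y)"
  using ore.const_mult_const[of X Y] by (simp add: A_simps)

lemma const_zero: "const (0\<^sub>m 2 2) = \<zero>\<^bsub>B\<^esub>"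
  using ore.monomial_zero[of 0] by (simp add: A_simps)

lemma elem_mat_add: "elem_mat i j (c + d) = elem_mat i j c + elem_mat i j d" for c d :: 'f
  by (intro mat2_eqI) simp_all

lemma elem_mat_zero: "elem_mat i j 0 = (0\<^sub>m 2 2 :: 'f mat)"
  by (intro mat2_eqI) simp_all

lemma elem_mat_mult:
  fixes c d :: 'f
  assumes "j < 2" "k < 2"
  shows "elem_mat i j c * elem_mat k l d = (if j = k then elem_mat i l (c * d) else 0\<^sub>m 2 2)"
  using assms less_2_cases[of j] less_2_cases[of k] mult_carrier_mat[of "elem_mat i j c" 2 2 "elem_mat k l d" 2]
  by (intro mat2_eqI) (auto simp: mat2_mult_index simp del: index_mult_mat)

lemma Q_l_add: "Q i j (c + c') d \<approx>\<^sub>B Q i j c d + Q i j c' d"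
  unfolding elem_mat_add const_add[OF elem_mat_closed elem_mat_closed]
  by (rule T.tcong_l_add) simp_all

lemma Q_r_add: "Q i j c (d + d') \<approx>\<^sub>B Q i j c d + Q i j c d'"
  unfolding elem_mat_add const_add[OF elem_mat_closed elem_mat_closed]
  by (rule T.tcong_r_add) simp_all

lemma Q_zero: "Q i j 0 d \<approx>\<^sub>B 0" "Q i j c 0 \<approx>\<^sub>B 0"
  unfolding elem_mat_zero const_zero
  by (rule T.tcong_l_zero, simp) (rule T.tcong_r_zero, simp)

text \<open>The tensor of the dual bases, spread over the positions i and j, with c multiplied into
  the left factors; \<open>twisted_r\<close> has c in the right factors. They are the results of
  multiplying \<open>sep_elem\<close> by the matrix unit at (i, j) scaled by c, from the left and
  from the right.\<close>

definition twisted_l :: "nat \<Rightarrow> nat \<Rightarrow> 'f \<Rightarrow> (nat \<Rightarrow> 'f mat) \<times> (nat \<Rightarrow> 'f mat) \<Rightarrow>\<^sub>0 int" where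
  "twisted_l i j c = Q i j (c * \<alpha> 0) (\<alpha> 0) + Q i j (c * \<alpha> 1) (\<alpha> 1) + Q i j (c * \<alpha> 2) (\<alpha> 2)"

definition twisted_r :: "nat \<Rightarrow> nat \<Rightarrow> 'f \<Rightarrow> (nat \<Rightarrow> 'f mat) \<times> (nat \<Rightarrow> 'f mat) \<Rightarrow>\<^sub>0 int" where
  "twisted_r i j c = Q i j (\<alpha> 0) (\<alpha> 0 * c) + Q i j (\<alpha> 1) (\<alpha> 1 * c) + Q i j (\<alpha> 2) (\<alpha> 2 * c)"

lemma twisted_l_add: "twisted_l i j (c + d) \<approx>\<^sub>B twisted_l i j c + twisted_l i j d"
proof -
  have "twisted_l i j (c + d) \<approx>\<^sub>B
      (Q i j (c * \<alpha> 0) (\<alpha> 0) + Q i j (d * \<alpha> 0) (\<alpha> 0))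
      + (Q i j (c * \<alpha> 1) (\<alpha> 1) + Q i j (d * \<alpha> 1) (\<alpha> 1))
      + (Q i j (c * \<alpha> 2) (\<alpha> 2) + Q i j (d * \<alpha> 2) (\<alpha> 2))"
    unfolding twisted_l_def distrib_right by (intro T.tcong_add Q_l_add)
  then show ?thesis by (simp add: twisted_l_def add_ac)
qed

lemma twisted_r_add: "twisted_r i j (c + d) \<approx>\<^sub>B twisted_r i j c + twisted_r i j d"
proof -
  have "twisted_r i j (c + d) \<approx>\<^sub>B
      (Q i j (\<alpha> 0) (\<alpha> 0 * c) + Q i j (\<alpha> 0) (\<alpha> 0 * d))
      + (Q i j (\<alpha> 1) (\<alpha> 1 * c) + Q i j (\<alpha> 1) (\<alpha> 1 * d))
      + (Q i j (\<alpha> 2) (\<alpha> 2 * c) + Q i j (\<alpha> 2) (\<alpha> 2 * d))"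
    unfolding twisted_r_def distrib_left by (intro T.tcong_add Q_r_add)
  then show ?thesis by (simp add: twisted_r_def add_ac)
qed

text \<open>In a self-dual basis multiplication by c has a symmetric matrix over the prime field,
  its entries being tr(c \<alpha>_k \<alpha>_l). So c may pass from one factor to the other. By
  additivity it suffices to read this off the multiplication table for the three conjugates.\<close>

lemma twisted_cong: "twisted_l i j c \<approx>\<^sub>B twisted_r i j c"
proof -
  let ?S = "{c. twisted_l i j c \<approx>\<^sub>B twisted_r i j c}"
  have "0 \<in> ?S"
  proof -
    have "twisted_l i j 0 \<approx>\<^sub>B 0 + 0 + 0" "twisted_r i j 0 \<approx>\<^sub>B 0 + 0 + 0"
      unfolding twisted_l_def twisted_r_def mult_zero_left mult_zero_right
      by (intro T.tcong_add Q_zero)+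
    then show ?thesis by (blast intro: T.tcong_trans T.tcong_sym)
  qed
  moreover have "\<alpha> 0 \<in> ?S"
  proof -
    have "twisted_l i j (\<alpha> 0) \<approx>\<^sub>B Q i j (\<alpha> 1) (\<alpha> 0) + (Q i j (\<alpha> 0) (\<alpha> 1) + Q i j (\<alpha> 2) (\<alpha> 1))
        + (Q i j (\<alpha> 1) (\<alpha> 2) + Q i j (\<alpha> 2) (\<alpha> 2))"
      unfolding twisted_l_def \<alpha>_comm \<alpha>_mult by (intro T.tcong_add Q_l_add T.tcong_refl)
    also have "\<dots> = Q i j (\<alpha> 0) (\<alpha> 1) + (Q i j (\<alpha> 1) (\<alpha> 0) + Q i j (\<alpha> 1) (\<alpha> 2))
        + (Q i j (\<alpha> 2) (\<alpha> 1) + Q i j (\<alpha> 2) (\<alpha> 2))" by (simp only: add_ac)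
    also have "\<dots> \<approx>\<^sub>B twisted_r i j (\<alpha> 0)"
      unfolding twisted_r_def \<alpha>_comm \<alpha>_mult
      by (rule T.tcong_sym) (intro T.tcong_add Q_r_add T.tcong_refl)
    finally show ?thesis by simp
  qed
  moreover have "\<alpha> 1 \<in> ?S"
  proof -
    have "twisted_l i j (\<alpha> 1) \<approx>\<^sub>B (Q i j (\<alpha> 0) (\<alpha> 0) + Q i j (\<alpha> 2) (\<alpha> 0)) + Q i j (\<alpha> 2) (\<alpha> 1)
        + (Q i j (\<alpha> 0) (\<alpha> 2) + Q i j (\<alpha> 1) (\<alpha> 2))"
      unfolding twisted_l_def \<alpha>_comm \<alpha>_mult by (intro T.tcong_add Q_l_add T.tcong_refl)
    also have "\<dots> = (Q i j (\<alpha> 0) (\<alpha> 0) + Q i j (\<alpha> 0) (\<alpha> 2)) + Q i j (\<alpha> 1) (\<alpha> 2)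
        + (Q i j (\<alpha> 2) (\<alpha> 0) + Q i j (\<alpha> 2) (\<alpha> 1))" by (simp only: add_ac)
    also have "\<dots> \<approx>\<^sub>B twisted_r i j (\<alpha> 1)"
      unfolding twisted_r_def \<alpha>_comm \<alpha>_mult
      by (rule T.tcong_sym) (intro T.tcong_add Q_r_add T.tcong_refl)
    finally show ?thesis by simp
  qed
  moreover have "\<alpha> 2 \<in> ?S"
  proof -
    have "twisted_l i j (\<alpha> 2) \<approx>\<^sub>B (Q i j (\<alpha> 1) (\<alpha> 0) + Q i j (\<alpha> 2) (\<alpha> 0))
        + (Q i j (\<alpha> 0) (\<alpha> 1) + Q i j (\<alpha> 1) (\<alpha> 1)) + Q i j (\<alpha> 0) (\<alpha> 2)"
      unfolding twisted_l_def \<alpha>_comm \<alpha>_mult by (intro T.tcong_add Q_l_add T.tcong_refl)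
    also have "\<dots> = (Q i j (\<alpha> 0) (\<alpha> 1) + Q i j (\<alpha> 0) (\<alpha> 2))
        + (Q i j (\<alpha> 1) (\<alpha> 0) + Q i j (\<alpha> 1) (\<alpha> 1)) + Q i j (\<alpha> 2) (\<alpha> 0)" by (simp only: add_ac)
    also have "\<dots> \<approx>\<^sub>B twisted_r i j (\<alpha> 2)"
      unfolding twisted_r_def \<alpha>_comm \<alpha>_mult
      by (rule T.tcong_sym) (intro T.tcong_add Q_r_add T.tcong_refl)
    finally show ?thesis by simp
  qed
  moreover have "c + d \<in> ?S" if "c \<in> ?S" "d \<in> ?S" for c d
  proof -
    have "twisted_l i j (c + d) \<approx>\<^sub>B twisted_l i j c + twisted_l i j d" by (rule twisted_l_add)
    also have "\<dots> \<approx>\<^sub>B twisted_r i j c + twisted_r i j d" using that by (intro T.tcong_add) auto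
    also have "\<dots> \<approx>\<^sub>B twisted_r i j (c + d)" by (rule T.tcong_sym[OF twisted_r_add])
    finally show ?thesis by simp
  qed
  ultimately have "c \<in> ?S" by (rule additive_subset_UNIV)
  then show ?thesis by simp
qed

lemma lmap_sep_part:
  assumes "j < 2" "l < 2"
  shows "T.lmap (const (elem_mat i j c)) (sep_part l) \<approx>\<^sub>B (if j = l then twisted_l i j c else 0)"
proof (cases "j = l")
  case True
  then have "T.lmap (const (elem_mat i j c)) (sep_part l) = twisted_l i j c"
    using assms by (simp add: const_mult elem_mat_mult twisted_l_def)
  with True show ?thesis by simp
next
  case False
  then have "T.lmap (const (elem_mat i j c)) (sep_part l) \<approx>\<^sub>B 0 + 0 + 0"
    unfolding T.map_simps using assms
    by (intro T.tcong_add) (simp_all add: const_mult elem_mat_mult const_zero T.tcong_l_zero del: ore_extension_simps(2))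
  with False show ?thesis by simp
qed

lemma rmap_sep_part:
  assumes "i < 2" "l < 2"
  shows "T.rmap (const (elem_mat i j c)) (sep_part l) \<approx>\<^sub>B (if i = l then twisted_r i j c else 0)"
proof (cases "i = l")
  case True
  then have "T.rmap (const (elem_mat i j c)) (sep_part l) = twisted_r i j c"
    using assms by (simp add: const_mult elem_mat_mult twisted_r_def)
  with True show ?thesis by simp
next
  case False
  then have "T.rmap (const (elem_mat i j c)) (sep_part l) \<approx>\<^sub>B 0 + 0 + 0"
    unfolding T.map_simps using assms
    by (intro T.tcong_add) (simp_all add: const_mult elem_mat_mult const_zero T.tcong_r_zero del: ore_extension_simps(2))
  with False show ?thesis by simp
qed

text \<open>A unit at (i, j) acts from the left only on the part of index j and from the right only
  on the part of index i, and both times produces the sum at position (i, j).\<close>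

lemma elem_central:
  assumes "i < 2" "j < 2"
  shows "const (elem_mat i j c) \<in> T.tcentral sep_elem"
proof -
  have "T.lmap (const (elem_mat i j c)) sep_elem \<approx>\<^sub>B
      (if j = 0 then twisted_l i j c else 0) + (if j = 1 then twisted_l i j c else 0)"
    unfolding sep_elem_def T.map_simps(5)[of _ "sep_part 0"] using assms
    by (intro T.tcong_add lmap_sep_part) simp_all
  also have "\<dots> = twisted_l i j c" using less_2_cases[OF assms(2)] by auto
  also have "\<dots> \<approx>\<^sub>B twisted_r i j c" by (rule twisted_cong)
  also have "\<dots> = (if i = 0 then twisted_r i j c else 0) + (if i = 1 then twisted_r i j c else 0)"
    using less_2_cases[OF assms(1)] by auto
  also have "\<dots> \<approx>\<^sub>B T.rmap (const (elem_mat i j c)) sep_elem"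
    unfolding sep_elem_def T.map_simps(6)[of _ "sep_part 0"] using assms
    by (intro T.tcong_sym[OF T.tcong_add] rmap_sep_part) simp_all
  finally show ?thesis by (simp add: T.tcentral_def)
qed

lemma const_central:
  assumes "X \<in> carrier_mat 2 2"
  shows "const X \<in> T.tcentral sep_elem"
proof -
  let ?E = "\<lambda>i j. elem_mat i j (X $$ (i, j))"
  have "X = ?E 0 0 + ?E 0 1 + (?E 1 0 + ?E 1 1)"
    using assms by (intro mat2_eqI) simp_all
  then have "const X = const (?E 0 0 + ?E 0 1 + (?E 1 0 + ?E 1 1))" by simp
  also have "\<dots> = (const (?E 0 0) \<oplus>\<^bsub>B\<^esub> const (?E 0 1)) \<oplus>\<^bsub>B\<^esub> (const (?E 1 0) \<oplus>\<^bsub>B\<^esub> const (?E 1 1))"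
    by (simp add: const_add del: ore_extension_simps)
  also have "\<dots> \<in> T.tcentral sep_elem"
    by (intro T.tcentral_add sep_elem_tens elem_central) simp_all
  finally show ?thesis .
qed

lemma x_const:
  assumes "X \<in> carrier_mat 2 2"
  shows "ore.x \<otimes>\<^bsub>B\<^esub> const X = const (sq_entries X) \<otimes>\<^bsub>B\<^esub> ore.x \<oplus>\<^bsub>B\<^esub> const (\<delta> X)"
  using assms ore.X_monomial[of X 0] ore.x_mult[of "const X"] ore.mult_x[of "const (sq_entries X)"]
    ore.shift_seq_monomial[of "sq_entries X" 0]
  by (simp add: A_simps)

lemma \<delta>_elem_col: "i < 2 \<Longrightarrow> \<delta> (elem_mat i 0 c) = elem_mat i 0 (if i = 1 then a * c else 0)"
  by (intro mat2_eqI) (simp_all add: \<delta>_index[unfolded One_nat_def])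

lemma \<delta>_elem_row: "j < 2 \<Longrightarrow> \<delta> (elem_mat 0 j d) = elem_mat 0 j (if j = 1 then d ^ 2 * a else 0)"
  by (intro mat2_eqI) (simp_all add: \<delta>_index[unfolded One_nat_def])

lemma sq_elem: "sq_entries (elem_mat i j c) = elem_mat i j (c ^ 2)" for c :: 'f
  by (intro mat2_eqI) simp_all

lemma x_closed: "ore.x \<in> up A" "ore.x \<in> C"
  by (rule ore.C_up[OF ore.C_monomial], rule ore.C_monomial)

text \<open>Commuting x past the first factor leaves a \<delta>-term; being in C, x then crosses the
  tensor sign, and commuting it past the second factor leaves another. Both factors have been
  squared on the way.\<close>

lemma lmap_x_Q:
  assumes "i < 2"
  shows "T.lmap ore.x (Q i i c d) \<approx>\<^sub>B
    T.rmap ore.x (Q i i (c ^ 2) (d ^ 2))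
      + (Q i i (c ^ 2) (d ^ 2 * (if i = 1 then a else 0)) + Q i i ((if i = 1 then a else 0) * c) d)"
proof -
  let ?u = "\<lambda>c. const (elem_mat i 0 c)" and ?v = "\<lambda>d. const (elem_mat 0 i d)"
  let ?a = "if i = 1 then a else 0"
  have cl: "?u c \<in> carrier B" "?v c \<in> carrier B" "ore.x \<in> carrier B" for c
    using x_closed by simp_all
  have xu: "ore.x \<otimes>\<^bsub>B\<^esub> ?u c = ?u (c ^ 2) \<otimes>\<^bsub>B\<^esub> ore.x \<oplus>\<^bsub>B\<^esub> ?u (?a * c)"
    using assms x_const[of "elem_mat i 0 c"] by (simp add: sq_elem \<delta>_elem_col if_distrib if_distribR cong: if_cong)
  have xv: "ore.x \<otimes>\<^bsub>B\<^esub> ?v d = ?v (d ^ 2) \<otimes>\<^bsub>B\<^esub> ore.x \<oplus>\<^bsub>B\<^esub> ?v (d ^ 2 * ?a)"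
    using assms x_const[of "elem_mat 0 i d"] by (simp add: sq_elem \<delta>_elem_row if_distrib if_distribR cong: if_cong)
  have 1: "frag_of (?u (c ^ 2) \<otimes>\<^bsub>B\<^esub> ore.x \<oplus>\<^bsub>B\<^esub> ?u (?a * c), ?v d) \<approx>\<^sub>B
      frag_of (?u (c ^ 2) \<otimes>\<^bsub>B\<^esub> ore.x, ?v d) + Q i i (?a * c) d"
    by (intro T.tcong_l_add T.m_closed cl)
  have 2: "frag_of (?u (c ^ 2) \<otimes>\<^bsub>B\<^esub> ore.x, ?v d) + Q i i (?a * c) d \<approx>\<^sub>B
      frag_of (?u (c ^ 2), ore.x \<otimes>\<^bsub>B\<^esub> ?v d) + Q i i (?a * c) d"
    by (intro T.tcong_add[OF T.tcong_balanced T.tcong_refl] cl x_closed)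
  have 3: "frag_of (?u (c ^ 2), ?v (d ^ 2) \<otimes>\<^bsub>B\<^esub> ore.x \<oplus>\<^bsub>B\<^esub> ?v (d ^ 2 * ?a)) + Q i i (?a * c) d \<approx>\<^sub>B
      (frag_of (?u (c ^ 2), ?v (d ^ 2) \<otimes>\<^bsub>B\<^esub> ore.x) + Q i i (c ^ 2) (d ^ 2 * ?a)) + Q i i (?a * c) d"
    by (intro T.tcong_add[OF T.tcong_r_add T.tcong_refl] T.m_closed cl)
  show ?thesis
    using T.tcong_trans[OF T.tcong_trans[OF 1 2[unfolded xv]] 3]
    by (simp only: T.map_simps xu add.assoc)
qed

text \<open>Characteristic 2 passes to the tensor square through additivity in c; this lets the two
  \<delta>-terms cancel.\<close>

lemma twisted_l_double: "twisted_l i j c + twisted_l i j c \<approx>\<^sub>B 0"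
proof -
  have "twisted_l i j (c + c) \<approx>\<^sub>B 0 + 0 + 0"
    unfolding twisted_l_def add_self mult_zero_left by (intro T.tcong_add Q_zero)
  then show ?thesis
    using T.tcong_trans[OF T.tcong_sym[OF twisted_l_add]] by simp
qed

text \<open>Squaring permutes the conjugates cyclically, so the main terms of
  \<open>lmap_x_Q\<close> reassemble to the same sum multiplied by x on the right. The
  \<delta>-terms form \<open>twisted_r\<close> and \<open>twisted_l\<close> for one common scalar;
  these are congruent, and their sum is zero.\<close>

lemma x_sep_part:
  assumes "i < 2"
  shows "T.lmap ore.x (sep_part i) \<approx>\<^sub>B T.rmap ore.x (sep_part i)"
proof -
  let ?a = "if i = 1 then a else 0"
  have "T.lmap ore.x (sep_part i) \<approx>\<^sub>B
      (T.rmap ore.x (Q i i (\<alpha> 1) (\<alpha> 1)) + (Q i i (\<alpha> 1) (\<alpha> 1 * ?a) + Q i i (?a * \<alpha> 0) (\<alpha> 0)))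
      + (T.rmap ore.x (Q i i (\<alpha> 2) (\<alpha> 2)) + (Q i i (\<alpha> 2) (\<alpha> 2 * ?a) + Q i i (?a * \<alpha> 1) (\<alpha> 1)))
      + (T.rmap ore.x (Q i i (\<alpha> 0) (\<alpha> 0)) + (Q i i (\<alpha> 0) (\<alpha> 0 * ?a) + Q i i (?a * \<alpha> 2) (\<alpha> 2)))"
    unfolding T.map_simps(5) using lmap_x_Q[OF assms] \<alpha>_square
    by (intro T.tcong_add) metis+
  also have "\<dots> = T.rmap ore.x (sep_part i) + (twisted_r i i ?a + twisted_l i i ?a)"
    unfolding T.map_simps(6) twisted_l_def twisted_r_def by (simp only: add_ac)
  also have "\<dots> \<approx>\<^sub>B T.rmap ore.x (sep_part i) + (twisted_l i i ?a + twisted_l i i ?a)"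
    by (intro T.tcong_add T.tcong_refl T.tcong_sym[OF twisted_cong])
  also have "\<dots> \<approx>\<^sub>B T.rmap ore.x (sep_part i) + 0"
    by (intro T.tcong_add T.tcong_refl twisted_l_double)
  finally show ?thesis by simp
qed

lemma x_central: "ore.x \<in> T.tcentral sep_elem"
proof -
  have "T.lmap ore.x sep_elem \<approx>\<^sub>B T.rmap ore.x sep_elem"
    unfolding sep_elem_def T.map_simps(5)[of _ "sep_part 0"] T.map_simps(6)[of _ "sep_part 0"]
    by (intro T.tcong_add x_sep_part) simp_all
  then show ?thesis using x_closed by (simp add: T.tcentral_def)
qed

lemma monomial_central: "X \<in> carrier_mat 2 2 \<Longrightarrow> monomial A X i \<in> T.tcentral sep_elem"
proof (induction i)
  case 0
  then show ?case by (rule const_central)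
next
  case (Suc i)
  have "monomial A X (Suc i) = monomial A X i \<otimes>\<^bsub>B\<^esub> ore.x"
    using Suc.prems by (simp only: ore.mult_x const_closed ore.shift_seq_monomial)
  with Suc show ?case using T.tcentral_mult sep_elem_tens x_central by simp
qed

lemma all_central: "carrier B \<subseteq> T.tcentral sep_elem"
proof
  fix p assume "p \<in> carrier B"
  then have "p \<in> up A" by simp
  then show "p \<in> T.tcentral sep_elem"
  proof (induction p rule: ore.up_induct_carrier)
    case zero
    then show ?case using T.tcentral_zero[OF sep_elem_tens] by simp
  next
    case (add p X i)
    then show ?case
      using T.tcentral_add[OF sep_elem_tens, of p "monomial A X i"] monomial_central[of X i]
      by (simp add: A_simps)
  qed
qed

text \<open>The squares of the conjugates sum to the trace of a, which is 1; the two parts thus give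
  the two diagonal idempotents.\<close>

lemma mu_sep_elem: "T.mu sep_elem = \<one>\<^bsub>B\<^esub>"
proof -
  have part: "T.mu (sep_part i) = const (elem_mat i i 1)" if "i < 2" for i
  proof -
    have "T.mu (sep_part i) = const (elem_mat i i (\<alpha> 0 * \<alpha> 0)) \<oplus>\<^bsub>B\<^esub> const (elem_mat i i (\<alpha> 1 * \<alpha> 1))
        \<oplus>\<^bsub>B\<^esub> const (elem_mat i i (\<alpha> 2 * \<alpha> 2))"
      by (simp add: T.mu_add T.mu_pure const_mult elem_mat_mult del: ore_extension_simps(3))
    also have "\<dots> = const (elem_mat i i (\<alpha> 1 + \<alpha> 2 + \<alpha> 0))"
      by (simp only: \<alpha>_mult elem_mat_add const_add elem_mat_closed add_carrier_mat)
    also have "\<alpha> 1 + \<alpha> 2 + \<alpha> 0 = 1" using \<alpha>_sum by (simp only: add_ac)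
    finally show ?thesis .
  qed
  have "T.mu sep_elem = const (elem_mat 0 0 1) \<oplus>\<^bsub>B\<^esub> const (elem_mat 1 1 1)"
    unfolding sep_elem_def by (subst T.mu_add) (simp_all add: part[unfolded One_nat_def] del: ore_extension_simps(3))
  also have "\<dots> = const (elem_mat 0 0 1 + elem_mat 1 1 1)"
    by (simp only: const_add elem_mat_closed)
  also have "elem_mat 0 0 1 + elem_mat 1 1 1 = (1\<^sub>m 2 :: 'f mat)"
    by (intro mat2_eqI) simp_all
  finally show ?thesis by (simp add: ore_extension_one A_simps)
qed

lemma separable_B: "separable_extension B C"
  using sep_elem_tens all_central mu_sep_elem by (rule T.separable_extensionI)

lemma biseparable_B: "biseparable_extension B C"
  unfolding biseparable_extension_def
  using split_B separable_B left_fg_projective right_fg_projective by blast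

end

section \<open>The extension is not Frobenius of second kind\<close>

text \<open>Normalization by \<open>algebra_simps\<close> does not know that 2 = 0. The witness
  \<open>v\<close> collects the even part, so that the remaining equation is an identity over the
  integers.\<close>

lemma char2_linear:
  fixes u v w w' :: "'a::idom"
  assumes "(2 :: 'a) = 0" "w = w'" "u = 2 * v + (w - w')"
  shows "u = 0"
  using assms by simp

text \<open>The unknowns are the values of f on the three conjugates placed at (0, 1), and
  \<open>k\<close> is the image of x. In each case elimination with the nonzero z and z + 1 leaves
  only the zero solution.\<close>

lemma off_diagonal_zero:
  fixes z g0 g1 g2 k :: "'a::idom"
  assumes two: "(2 :: 'a) = 0" and z: "z \<noteq> 0" "z + 1 \<noteq> 0" and k: "k = z \<or> k = z + 1"
    and eqs: "g1 * z + (g0 + g2) = k * g0" "g2 * z + (g1 + g2) = k * g1" "g0 * z + g1 = k * g2"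
  shows "g0 = 0 \<and> g1 = 0 \<and> g2 = 0"
  using k
proof
  assume k: "k = z"
  have "(z + 1) * (g2 - g1) = 0"
    by (rule char2_linear[OF two eqs(2), of _ "- g1"]) (simp add: k algebra_simps)
  then have 12: "g1 = g2" using z by simp
  have "(z + 1) * (g1 - g0) = 0"
    by (rule char2_linear[OF two eqs(1), of _ "- g0"]) (simp add: k 12 algebra_simps)
  then have 01: "g0 = g1" using z by simp
  have "g0 = 0"
    by (rule char2_linear[OF two eqs(3), of _ 0]) (simp add: k 01 12 algebra_simps)
  then show ?thesis using 01 12 by simp
next
  assume k: "k = z + 1"
  \<comment> \<open>Adding the three equations cancels all terms with z and leaves g1 + g2 =
    0.\<close>
  have sum: "(g1 * z + (g0 + g2)) + (g2 * z + (g1 + g2)) + (g0 * z + g1) = k * g0 + k * g1 + k * g2"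
    by (simp only: eqs)
  have "g1 - g2 = 0"
    by (rule char2_linear[OF two sum, of _ "- g2"]) (simp add: k algebra_simps)
  then have 12: "g1 = g2" by simp
  have g2: "g2 = 0"
    by (rule char2_linear[OF two eqs(2), of _ 0]) (simp add: k 12 algebra_simps)
  have "z * g0 = 0"
    by (rule char2_linear[OF two eqs(1), of _ "z * g0"]) (simp add: k 12 g2 algebra_simps)
  then show ?thesis using z g2 12 by simp
qed

text \<open>The system of the (1, 1) block when x is sent to x + 1; the equations successively
  identify the three unknowns and then annihilate them.\<close>

lemma diagonal_twisted_zero:
  fixes z g0 g1 g2 :: "'a::idom"
  assumes two: "(2 :: 'a) = 0" and z: "z \<noteq> 0" "z + 1 \<noteq> 0"
    and eqs: "g1 * z + (g1 + g0 + g2) = (z + 1) * g0" "g2 * z + (g0 + g1) = (z + 1) * g1"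
      "g0 * z + g2 = (z + 1) * g2"
  shows "g0 = 0 \<and> g1 = 0 \<and> g2 = 0"
proof -
  have "z * (g0 - g2) = 0"
    by (rule char2_linear[OF two eqs(3), of _ 0]) (simp add: algebra_simps)
  then have 02: "g0 = g2" using z by simp
  have "(z + 1) * (g1 - g2) = 0"
    by (rule char2_linear[OF two eqs(1), of _ "- g2"]) (simp add: 02 algebra_simps)
  then have 12: "g1 = g2" using z by simp
  have "g2 = 0"
    by (rule char2_linear[OF two eqs(2), of _ 0]) (simp add: 02 12 algebra_simps)
  then show ?thesis using 02 12 by simp
qed

text \<open>When x is fixed the system of the (1, 1) block has nonzero solutions, for example g0 =
  (z + 1)^2, g1 = z^2 + z + 1, g2 = z (z + 1). In general z g0 = (z + 1) g2 and g2 = (z + 1) (g1 -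
  g0). The first equation equates degrees and leading coefficients of g0 and g2; the second makes
  the degree positive and g1 a perturbation of g0 in lower degree.\<close>

lemma diagonal_leading_coeffs:
  fixes g0 g1 g2 :: "'f::field poly"
  defines "z \<equiv> [:0, 1:]"
  assumes two: "(2 :: 'f poly) = 0" and nz: "g0 \<noteq> 0 \<or> g1 \<noteq> 0 \<or> g2 \<noteq> 0"
    and eqs: "g1 * z + (g1 + g0 + g2) = z * g0" "g2 * z + (g0 + g1) = z * g1"
      "g0 * z + g2 = z * g2"
  obtains D l where "D \<ge> 1" "l \<noteq> 0" "\<And>g. g \<in> {g0, g1, g2} \<Longrightarrow> coeff g D = l \<and> degree g \<le> D"
proof
  have z1: "z + 1 \<noteq> 0" "degree (z + 1) = 1" "lead_coeff (z + 1) = 1" "z \<noteq> 0" "degree z = 1" "lead_coeff z = 1"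
    by (simp_all add: z_def one_pCons)
  have "z * g0 - (z + 1) * g2 = 0"
    by (rule char2_linear[OF two eqs(3), of _ "- g2"]) (simp add: algebra_simps)
  then have 02: "z * g0 = (z + 1) * g2" by simp
  have "(z + 1) * (g1 - g0) - g2 = 0"
    by (rule char2_linear[OF two eqs(1), of _ "- (g0 + g2)"]) (simp add: algebra_simps)
  then have 12: "g2 = (z + 1) * (g1 - g0)" by simp
  have g0: "g0 \<noteq> 0"
  proof
    assume "g0 = 0"
    moreover from this have "g2 = 0" using 02 z1 by simp
    ultimately show False using 12 z1 nz by simp
  qed
  then have g2: "g2 \<noteq> 0" using 02 z1 by auto
  then have d: "g1 - g0 \<noteq> 0" using 12 by auto
  have "degree (z * g0) = degree ((z + 1) * g2)" using 02 by simp
  then have deg02: "degree g0 = degree g2" using z1 g0 g2 by (simp add: degree_mult_eq)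
  have "lead_coeff (z * g0) = lead_coeff ((z + 1) * g2)" using 02 by simp
  then have lead02: "lead_coeff g0 = lead_coeff g2" using z1 by (simp only: lead_coeff_mult mult_1_left)
  have deg12: "degree g2 = 1 + degree (g1 - g0)"
    using arg_cong[OF 12, of degree] z1 d by (simp add: degree_mult_eq)
  have g1: "g1 = g0 + (g1 - g0)" by simp
  have "degree g1 \<le> degree g0"
    using degree_add_le_max[of g0 "g1 - g0"] deg02 deg12 by simp
  moreover have "coeff (g1 - g0) (degree g0) = 0"
    using deg02 deg12 by (intro coeff_eq_0) simp
  ultimately show "coeff g (degree g0) = lead_coeff g0 \<and> degree g \<le> degree g0"
    if "g \<in> {g0, g1, g2}" for g
    using that deg02 lead02 by auto
  show "degree g0 \<ge> 1" using deg02 deg12 by simp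
  show "lead_coeff g0 \<noteq> 0" using g0 by simp
qed

section \<open>Translation to commutative polynomials and automorphisms of the base ring\<close>

context field8
begin

text \<open>On C each coefficient is the zero or the identity matrix, so a single entry determines
  it, and the map is multiplicative there. The target is an integral domain with a degree
  function.\<close>

definition to_poly :: "(nat \<Rightarrow> 'f mat) \<Rightarrow> 'f poly" where
  "to_poly p = Abs_poly (\<lambda>n. p n $$ (0, 0))"

lemma coeff_to_poly:
  assumes "p \<in> up A"
  shows "coeff (to_poly p) n = p n $$ (0, 0)"
proof -
  obtain N where "\<And>n. n > N \<Longrightarrow> p n = \<zero>\<^bsub>A\<^esub>" using ore.up_bounded[OF assms] by blast
  then have "\<forall>n>N. p n $$ (0, 0) = 0" by (simp add: A_simps)
  then have "\<forall>\<^sub>\<infinity>n. p n $$ (0, 0) = 0" unfolding MOST_nat by blast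
  then show ?thesis by (simp add: to_poly_def Abs_poly_inverse)
qed

lemma up_coeff: "p \<in> up A \<Longrightarrow> p n \<in> carrier_mat 2 2"
  using ore.up_coeff_closed[of p n] by (simp add: A_simps)

lemma to_poly_add:
  "p \<in> up A \<Longrightarrow> q \<in> up A \<Longrightarrow> to_poly (p \<oplus>\<^bsub>B\<^esub> q) = to_poly p + to_poly q"
  using ore.up_plus_closed[of p q] up_coeff
  by (intro poly_eqI) (simp add: coeff_to_poly A_simps)

lemma to_poly_zero: "to_poly \<zero>\<^bsub>B\<^esub> = 0"
  using ore.up_zero_closed by (intro poly_eqI) (simp add: coeff_to_poly A_simps)

lemma to_poly_shift:
  assumes "p \<in> up A"
  shows "to_poly (shift_seq A p) = [:0, 1:] * to_poly p"
proof -
  have "to_poly (shift_seq A p) = pCons 0 (to_poly p)"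
    using assms ore.shift_seq_closed[OF assms]
    by (intro poly_eqI) (simp add: coeff_to_poly coeff_pCons shift_seq_def A_simps split: nat.split)
  then show ?thesis by simp
qed

lemma to_poly_monomial: "to_poly (monomial A \<one>\<^bsub>A\<^esub> i) = [:0, 1:] ^ i"
proof (induction i)
  case 0
  have "monomial A \<one>\<^bsub>A\<^esub> 0 \<in> up A" by (intro ore.monomial_closed ore.one_closed)
  then show ?case
    by (intro poly_eqI) (simp add: coeff_to_poly, simp add: monomial_def A_simps)
next
  case (Suc i)
  have "monomial A \<one>\<^bsub>A\<^esub> (Suc i) = shift_seq A (monomial A \<one>\<^bsub>A\<^esub> i)"
    by (simp only: ore.shift_seq_monomial)
  with Suc show ?case
    by (simp only: to_poly_shift ore.monomial_closed ore.one_closed power_Suc)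
qed

lemma to_poly_mult:
  assumes "c \<in> C" "d \<in> C"
  shows "to_poly (c \<otimes>\<^bsub>B\<^esub> d) = to_poly c * to_poly d"
  using assms(1)
proof (induction c rule: ore.C_induct)
  case zero
  then show ?case using to_poly_zero by (simp add: ore.B_zero_mult)
next
  case (add c i)
  have pow: "to_poly ((ore.X ^^ i) d) = [:0, 1:] ^ i * to_poly d"
  proof (induction i)
    case (Suc i)
    have "(ore.X ^^ i) d \<in> C" using assms(2) by (rule ore.Xpow_C)
    with Suc show ?case by (simp add: ore.X_C to_poly_shift mult.assoc)
  qed simp
  have mono: "monomial A \<one>\<^bsub>A\<^esub> i \<in> up A" by (rule ore.C_up[OF ore.C_monomial])
  have "to_poly ((c \<oplus>\<^bsub>B\<^esub> monomial A \<one>\<^bsub>A\<^esub> i) \<otimes>\<^bsub>B\<^esub> d)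
      = to_poly (c \<otimes>\<^bsub>B\<^esub> d \<oplus>\<^bsub>B\<^esub> (ore.X ^^ i) d)"
    using add assms(2) mono by (simp add: ore.B_l_distr ore.x_pow_mult)
  also have "\<dots> = (to_poly c + [:0, 1:] ^ i) * to_poly d"
    using add assms(2) ore.C_mult
    by (subst to_poly_add) (simp_all add: pow distrib_right)
  also have "to_poly c + [:0, 1:] ^ i = to_poly (c \<oplus>\<^bsub>B\<^esub> monomial A \<one>\<^bsub>A\<^esub> i)"
    using add mono by (subst to_poly_add) (simp_all only: ore.C_up to_poly_monomial)
  finally show ?case by simp
qed

lemma poly_two: "(2 :: 'f poly) = 0"
proof -
  have "(2 :: 'f poly) = [:2:]" by (simp add: numeral_poly)
  then show ?thesis by (simp add: two)
qed

text \<open>An automorphism of the polynomial ring is substitution of the image of \<open>x\<close>, so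
  surjectivity forces that image to have degree one.\<close>

lemma iso_image_x:
  assumes \<kappa>: "\<kappa> \<in> ring_iso (B\<lparr>carrier := C\<rparr>) (B\<lparr>carrier := C\<rparr>)"
  shows "\<kappa> ore.x \<in> C"
    and "to_poly (\<kappa> ore.x) = [:0, 1:] \<or> to_poly (\<kappa> ore.x) = [:0, 1:] + 1"
proof -
  have closed: "\<kappa> c \<in> C" if "c \<in> C" for c
    using ring_iso_memE(1)[OF \<kappa>] that by simp
  have mult: "\<kappa> (c \<otimes>\<^bsub>B\<^esub> d) = \<kappa> c \<otimes>\<^bsub>B\<^esub> \<kappa> d" if "c \<in> C" "d \<in> C" for c d
    using ring_iso_memE(2)[OF \<kappa>] that by simp
  have \<kappa>_add: "\<kappa> (c \<oplus>\<^bsub>B\<^esub> d) = \<kappa> c \<oplus>\<^bsub>B\<^esub> \<kappa> d" if "c \<in> C" "d \<in> C" for c d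
    using ring_iso_memE(3)[OF \<kappa>, of c d] that by (simp del: ore_extension_simps(3))
  have one: "\<kappa> \<one>\<^bsub>B\<^esub> = \<one>\<^bsub>B\<^esub>" using ring_iso_memE(4)[OF \<kappa>] by simp
  have surj: "\<kappa> ` C = C" using ring_iso_memE(5)[OF \<kappa>] by (simp add: bij_betw_def)
  show x: "\<kappa> ore.x \<in> C" using closed x_closed by blast
  have pow: "to_poly (\<kappa> (monomial A \<one>\<^bsub>A\<^esub> i)) = to_poly (\<kappa> ore.x) ^ i" for i
  proof (induction i)
    case 0
    then show ?case using one to_poly_monomial[of 0] by (simp add: ore_extension_one)
  next
    case (Suc i)
    have mono: "monomial A \<one>\<^bsub>A\<^esub> i \<in> C" by (rule ore.C_monomial)
    have "monomial A \<one>\<^bsub>A\<^esub> (Suc i) = monomial A \<one>\<^bsub>A\<^esub> i \<otimes>\<^bsub>B\<^esub> ore.x"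
      by (simp only: ore.mult_x ore.C_up[OF mono] ore.shift_seq_monomial)
    then show ?case
      using mono x_closed(2) by (simp only: mult to_poly_mult closed Suc power_Suc2)
  qed
  have zero: "to_poly (\<kappa> \<zero>\<^bsub>B\<^esub>) = 0"
  proof -
    have "\<zero>\<^bsub>B\<^esub> \<in> C" using ore.C_zero by simp
    then have "to_poly (\<kappa> (\<zero>\<^bsub>B\<^esub> \<oplus>\<^bsub>B\<^esub> \<zero>\<^bsub>B\<^esub>)) = to_poly (\<kappa> \<zero>\<^bsub>B\<^esub>) + to_poly (\<kappa> \<zero>\<^bsub>B\<^esub>)"
      by (simp only: \<kappa>_add to_poly_add closed ore.C_up)
    then show ?thesis by (simp add: poly_two)
  qed
  have compose: "to_poly (\<kappa> c) = pcompose (to_poly c) (to_poly (\<kappa> ore.x))" if "c \<in> C" for c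
    using that
  proof (induction c rule: ore.C_induct)
    case zero
    then show ?case using to_poly_zero \<open>to_poly (\<kappa> \<zero>\<^bsub>B\<^esub>) = 0\<close> by simp
  next
    case (add c i)
    have mono: "monomial A \<one>\<^bsub>A\<^esub> i \<in> C" by (rule ore.C_monomial)
    have z_pow: "pcompose ([:0, 1:] ^ i) k = k ^ i" for k :: "'f poly"
      by (induction i) (simp_all add: pcompose_mult pcompose_1 pcompose_pCons)
    have "to_poly (\<kappa> (c \<oplus>\<^bsub>B\<^esub> monomial A \<one>\<^bsub>A\<^esub> i))
        = to_poly (\<kappa> c) + to_poly (\<kappa> (monomial A \<one>\<^bsub>A\<^esub> i))"
      using add.hyps mono by (simp only: \<kappa>_add to_poly_add ore.C_up closed)
    also have "\<dots> = pcompose (to_poly c) (to_poly (\<kappa> ore.x)) + to_poly (\<kappa> ore.x) ^ i"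
      by (simp only: add.IH pow[of i])
    also have "\<dots> = pcompose (to_poly c + [:0, 1:] ^ i) (to_poly (\<kappa> ore.x))"
      by (simp only: pcompose_add z_pow)
    also have "to_poly c + [:0, 1:] ^ i = to_poly (c \<oplus>\<^bsub>B\<^esub> monomial A \<one>\<^bsub>A\<^esub> i)"
      using add.hyps mono by (simp only: to_poly_add ore.C_up to_poly_monomial)
    finally show ?case by simp
  qed
  obtain c where c: "c \<in> C" "\<kappa> c = ore.x" using surj x_closed(2) by (metis imageE)
  have "degree (to_poly ore.x) = 1" using to_poly_monomial[of 1] by simp
  then have "degree (to_poly c) * degree (to_poly (\<kappa> ore.x)) = 1"
    using compose[OF c(1)] c(2) by (simp add: degree_pcompose)
  then have deg: "degree (to_poly (\<kappa> ore.x)) = 1" by simp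
  have bit: "coeff (to_poly (\<kappa> ore.x)) n = 0 \<or> coeff (to_poly (\<kappa> ore.x)) n = 1" for n
    using ore.C_coeff[OF x, of n] ore.C_up[OF x] by (auto simp: coeff_to_poly A_simps)
  obtain v u where uv: "to_poly (\<kappa> ore.x) = [:u, v:]" "v \<noteq> 0"
    by (rule degree1_coeffs[OF deg])
  then have "v = 1" using bit[of 1] by simp
  then show "to_poly (\<kappa> ore.x) = [:0, 1:] \<or> to_poly (\<kappa> ore.x) = [:0, 1:] + 1"
    using bit[of 0] uv(1) by (auto simp: one_pCons)
qed

text \<open>Provides s as a sum of x^i q_i, the form to which twisted left linearity
  applies.\<close>

lemma right_form_surj:
  assumes "s \<in> up A"
  obtains q where "q \<in> up A" "s = ore.right_form q"
proof -
  have "ore.right_form (ore_maps.right_form A \<sigma>_inv (\<lambda>X. \<delta> (\<sigma>_inv X)) s) = s"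
    using assms by (intro ore.right_form_inverse[OF inverse_maps]) (simp_all add: A_simps sq_entries_cube mat_add_self)
  moreover have "ore_maps.right_form A \<sigma>_inv (\<lambda>X. \<delta> (\<sigma>_inv X)) s \<in> up A"
    using ore_maps.right_form_closed[OF inverse_maps assms] .
  ultimately show thesis using that by metis
qed

end

text \<open>Here \<open>f\<close> is the image of 1 under a hypothetical Frobenius isomorphism and
  \<open>\<kappa>x\<close> the image of x under \<kappa>.\<close>

locale twisted_functional = field8 a for a :: "'f::field" +
  fixes f :: "(nat \<Rightarrow> 'f mat) \<Rightarrow> nat \<Rightarrow> 'f mat" and \<kappa>x :: "nat \<Rightarrow> 'f mat"
  assumes f_closed: "v \<in> up A \<Longrightarrow> f v \<in> C"
    and f_add: "v \<in> up A \<Longrightarrow> w \<in> up A \<Longrightarrow> f (v \<oplus>\<^bsub>B\<^esub> w) = f v \<oplus>\<^bsub>B\<^esub> f w"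
    and f_right: "v \<in> up A \<Longrightarrow> c \<in> C \<Longrightarrow> f (v \<otimes>\<^bsub>B\<^esub> c) = f v \<otimes>\<^bsub>B\<^esub> c"
    and f_left_x: "v \<in> up A \<Longrightarrow> f (ore.x \<otimes>\<^bsub>B\<^esub> v) = \<kappa>x \<otimes>\<^bsub>B\<^esub> f v"
    and \<kappa>x_closed: "\<kappa>x \<in> C"
    and \<kappa>x_cases: "to_poly \<kappa>x = [:0, 1:] \<or> to_poly \<kappa>x = [:0, 1:] + 1"
begin

abbreviation z :: "'f poly" where "z \<equiv> [:0, 1:]"

abbreviation k :: "'f poly" where "k \<equiv> to_poly \<kappa>x"

abbreviation pf :: "(nat \<Rightarrow> 'f mat) \<Rightarrow> 'f poly" where
  "pf v \<equiv> to_poly (f v)"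

lemma pf_add: "v \<in> up A \<Longrightarrow> w \<in> up A \<Longrightarrow> pf (v \<oplus>\<^bsub>B\<^esub> w) = pf v + pf w"
  using f_closed by (simp only: f_add to_poly_add ore.C_up)

lemma pf_left_x: "v \<in> up A \<Longrightarrow> pf (ore.x \<otimes>\<^bsub>B\<^esub> v) = k * pf v"
  using f_closed \<kappa>x_closed by (simp only: f_left_x to_poly_mult)

lemma pf_const_add:
  "X \<in> carrier_mat 2 2 \<Longrightarrow> Y \<in> carrier_mat 2 2 \<Longrightarrow> pf (const (X + Y)) = pf (const X) + pf (const Y)"
  by (simp only: const_add pf_add const_closed)

lemma pf_const_zero: "pf (const (0\<^sub>m 2 2)) = 0"
  using pf_const_add[of "0\<^sub>m 2 2" "0\<^sub>m 2 2"] by (simp add: poly_two)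

text \<open>Two evaluations of f on x X: twisted left linearity gives the right-hand side; the
  commutation rule followed by right linearity gives the left-hand side.\<close>

lemma pf_twist:
  assumes X: "X \<in> carrier_mat 2 2"
  shows "pf (const (sq_entries X)) * z + pf (const (\<delta> X)) = k * pf (const X)"
proof -
  have c: "const (sq_entries X) \<in> up A" "const (\<delta> X) \<in> up A" "const X \<in> up A" using X by simp_all
  have "k * pf (const X) = pf (const (sq_entries X) \<otimes>\<^bsub>B\<^esub> ore.x \<oplus>\<^bsub>B\<^esub> const (\<delta> X))"
    using pf_left_x[OF c(3)] x_const[OF X] by simp
  also have "\<dots> = pf (const (sq_entries X) \<otimes>\<^bsub>B\<^esub> ore.x) + pf (const (\<delta> X))"
    using c x_closed(1) by (intro pf_add ore.B_mult_closed)
  also have "pf (const (sq_entries X) \<otimes>\<^bsub>B\<^esub> ore.x) = pf (const (sq_entries X)) * z"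
    using c x_closed f_closed to_poly_monomial[of 1] by (simp only: f_right to_poly_mult power_one_right)
  finally show ?thesis by simp
qed

text \<open>With \<open>H\<close>, the values of f on matrices supported in the second column, the
  only ones that occur after multiplying by the matrix unit at (1, 1).\<close>

definition G :: "'f \<Rightarrow> 'f poly" where "G c = pf (const (elem_mat 0 1 c))"

definition H :: "'f \<Rightarrow> 'f poly" where "H c = pf (const (elem_mat 1 1 c))"

lemma GH_add: "G (c + d) = G c + G d" "H (c + d) = H c + H d"
  by (simp_all only: G_def H_def elem_mat_add pf_const_add elem_mat_closed)

lemma GH_zero: "G 0 = 0" "H 0 = 0"
  by (simp_all only: G_def H_def elem_mat_zero pf_const_zero)

lemma G_twist: "G (c ^ 2) * z + G (c ^ 2 * \<alpha> 0) = k * G c"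
  using pf_twist[of "elem_mat 0 1 c"] \<delta>_elem_row[of 1 c] by (simp add: sq_elem G_def \<alpha>_simps)

lemma H_twist: "H (c ^ 2) * z + H (\<alpha> 0 * c + c ^ 2 * \<alpha> 0) = k * H c"
proof -
  have "\<delta> (elem_mat 1 1 c) = elem_mat 1 1 (a * c + c ^ 2 * a)"
    by (intro mat2_eqI) (simp_all add: \<delta>_index[unfolded One_nat_def])
  then show ?thesis using pf_twist[of "elem_mat 1 1 c"] by (simp add: sq_elem H_def \<alpha>_simps)
qed

lemma z_nonzero: "z \<noteq> 0" "z + 1 \<noteq> 0"
  by (simp_all add: one_pCons)

lemma G_eq_0: "G c = 0"
proof -
  have eqs: "G (\<alpha> 1) * z + (G (\<alpha> 0) + G (\<alpha> 2)) = k * G (\<alpha> 0)"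
    "G (\<alpha> 2) * z + (G (\<alpha> 1) + G (\<alpha> 2)) = k * G (\<alpha> 1)"
    "G (\<alpha> 0) * z + G (\<alpha> 1) = k * G (\<alpha> 2)"
    using G_twist[of "\<alpha> 0"] G_twist[of "\<alpha> 1"] G_twist[of "\<alpha> 2"]
    by (simp_all only: \<alpha>_square \<alpha>_comm \<alpha>_mult GH_add)
  have "G (\<alpha> 0) = 0 \<and> G (\<alpha> 1) = 0 \<and> G (\<alpha> 2) = 0"
    by (rule off_diagonal_zero[OF poly_two z_nonzero \<kappa>x_cases eqs])
  then have "c \<in> {c. G c = 0}"
    by - (rule additive_subset_UNIV; simp add: GH_zero GH_add)
  then show ?thesis by simp
qed

lemma H_eqs:
  "H (\<alpha> 1) * z + (H (\<alpha> 1) + H (\<alpha> 0) + H (\<alpha> 2)) = k * H (\<alpha> 0)"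
  "H (\<alpha> 2) * z + (H (\<alpha> 0) + H (\<alpha> 1)) = k * H (\<alpha> 1)"
  "H (\<alpha> 0) * z + H (\<alpha> 2) = k * H (\<alpha> 2)"
proof -
  have "\<alpha> 0 * \<alpha> 0 + \<alpha> 1 * \<alpha> 0 = \<alpha> 1 + \<alpha> 0 + \<alpha> 2"
    unfolding \<alpha>_comm \<alpha>_mult by (simp only: add_ac)
  then show "H (\<alpha> 1) * z + (H (\<alpha> 1) + H (\<alpha> 0) + H (\<alpha> 2)) = k * H (\<alpha> 0)"
    using H_twist[of "\<alpha> 0"] by (simp only: \<alpha>_square GH_add)
  have "\<alpha> 0 * \<alpha> 1 + \<alpha> 2 * \<alpha> 0 = \<alpha> 0 + \<alpha> 1"
    unfolding \<alpha>_comm \<alpha>_mult by (simp add: add_ac)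
  then show "H (\<alpha> 2) * z + (H (\<alpha> 0) + H (\<alpha> 1)) = k * H (\<alpha> 1)"
    using H_twist[of "\<alpha> 1"] by (simp only: \<alpha>_square GH_add)
  have "\<alpha> 0 * \<alpha> 2 + \<alpha> 0 * \<alpha> 0 = \<alpha> 2"
    unfolding \<alpha>_comm \<alpha>_mult by (simp add: add_ac)
  then show "H (\<alpha> 0) * z + H (\<alpha> 2) = k * H (\<alpha> 2)"
    using H_twist[of "\<alpha> 2"] by (simp only: \<alpha>_square)
qed

text \<open>All three conjugates have trace 1, so a common coefficient l in degree D on them extends
  additively to l times the trace.\<close>

lemma H_cases:
  obtains "\<And>c. H c = 0"
  | D l where "k = z" "D \<ge> 1" "l \<noteq> 0" "\<And>c. coeff (H c) D = l * tr c" "\<And>c n. n > D \<Longrightarrow> coeff (H c) n = 0"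
proof (cases "H (\<alpha> 0) = 0 \<and> H (\<alpha> 1) = 0 \<and> H (\<alpha> 2) = 0")
  case True
  have "c \<in> {c. H c = 0}" for c
    using True by - (rule additive_subset_UNIV; simp add: GH_zero GH_add)
  then show thesis using that(1) by simp
next
  case False
  have k: "k = z"
  proof (rule ccontr)
    assume "k \<noteq> z"
    then have k1: "k = z + 1" using \<kappa>x_cases by blast
    show False
      using diagonal_twisted_zero[OF poly_two z_nonzero H_eqs[unfolded k1]] False by blast
  qed
  have "H (\<alpha> 0) \<noteq> 0 \<or> H (\<alpha> 1) \<noteq> 0 \<or> H (\<alpha> 2) \<noteq> 0" using False by blast
  then obtain D l where Dl: "D \<ge> 1" "l \<noteq> 0"
      "\<And>g. g \<in> {H (\<alpha> 0), H (\<alpha> 1), H (\<alpha> 2)} \<Longrightarrow> coeff g D = l \<and> degree g \<le> D"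
    using diagonal_leading_coeffs[OF poly_two _ H_eqs[unfolded k]] by blast
  have "c \<in> {c. coeff (H c) D = l * tr c \<and> degree (H c) \<le> D}" for c
    using Dl(3)
    by - (rule additive_subset_UNIV;
        simp add: GH_zero GH_add tr_\<alpha>[unfolded One_nat_def] tr_add distrib_left degree_add_le)
  then have H: "coeff (H c) D = l * tr c" "degree (H c) \<le> D" for c by simp_all
  have "coeff (H c) n = 0" if "n > D" for c n
    using le_less_trans[OF H(2) that] by (rule coeff_eq_0)
  with k Dl(1,2) H(1) show thesis by (rule that(2))
qed

text \<open>Each factor x comes out of f as \<open>k\<close>, so the summand x^i q_i contributes k^i
  f(q_i Y). Stating it for all large N avoids naming the support of \<open>q\<close>.\<close>

lemma pf_right_form:
  assumes "q \<in> up A" "Y \<in> carrier_mat 2 2"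
  shows "\<exists>N0. \<forall>N\<ge>N0. pf (ore.right_form q \<otimes>\<^bsub>B\<^esub> const Y) = (\<Sum>i\<le>N. k ^ i * pf (const (q i * Y)))"
proof -
  have Y: "const Y \<in> up A" using assms by simp
  have "range q \<subseteq> carrier A" using assms(1) ore.up_coeff_closed by blast
  with assms(1) show ?thesis
  proof (induction q rule: ore.up_shift_induct)
    case zero
    have "pf (ore.right_form (\<lambda>n. \<zero>\<^bsub>A\<^esub>) \<otimes>\<^bsub>B\<^esub> const Y) = 0"
      using pf_add[of "\<zero>\<^bsub>B\<^esub>" "\<zero>\<^bsub>B\<^esub>"] T.zero_closed
      by (simp add: ore.right_form_zero ore.B_zero_mult poly_two)
    then show ?case using assms(2) pf_const_zero by (simp add: A_simps left_mult_zero_mat)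
  next
    case (add p X)
    let ?q = "\<lambda>n. shift_seq A p n \<oplus>\<^bsub>A\<^esub> const X n"
    have X: "X \<in> carrier_mat 2 2" using add by (simp add: A_simps)
    obtain N0 where N0: "\<And>N. N \<ge> N0 \<Longrightarrow>
        pf (ore.right_form p \<otimes>\<^bsub>B\<^esub> const Y) = (\<Sum>i\<le>N. k ^ i * pf (const (p i * Y)))"
      using add.IH by blast
    have rp: "ore.right_form p \<in> up A" "const X \<in> up A" using add X by simp_all
    have "ore.right_form ?q = ore.x \<otimes>\<^bsub>B\<^esub> ore.right_form p \<oplus>\<^bsub>B\<^esub> const X"
      using add.hyps X rp
      by (simp add: ore.right_form_add ore.right_form_shift ore.right_form_monomial ore.x_mult
          del: One_nat_def)
    then have "ore.right_form ?q \<otimes>\<^bsub>B\<^esub> const Y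
        = ore.x \<otimes>\<^bsub>B\<^esub> (ore.right_form p \<otimes>\<^bsub>B\<^esub> const Y) \<oplus>\<^bsub>B\<^esub> const (X * Y)"
      using rp Y x_closed(1) X assms(2) by (simp add: ore.B_l_distr ore.B_assoc const_mult)
    then have "pf (ore.right_form ?q \<otimes>\<^bsub>B\<^esub> const Y)
        = pf (ore.x \<otimes>\<^bsub>B\<^esub> (ore.right_form p \<otimes>\<^bsub>B\<^esub> const Y)) + pf (const (X * Y))"
      using rp Y x_closed(1) X assms(2)
      by (simp only: pf_add ore.B_mult_closed const_closed mult_carrier_mat)
    also have "\<dots> = k * pf (ore.right_form p \<otimes>\<^bsub>B\<^esub> const Y) + pf (const (X * Y))"
      using rp Y by (simp only: pf_left_x ore.B_mult_closed)
    finally have step: "pf (ore.right_form ?q \<otimes>\<^bsub>B\<^esub> const Y)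
        = k * pf (ore.right_form p \<otimes>\<^bsub>B\<^esub> const Y) + pf (const (X * Y))" .
    have q: "?q 0 = X" "?q (Suc i) = p i" for i
      using X up_coeff[OF add.hyps(1), of i] by (simp_all add: shift_seq_def monomial_def A_simps)
    have "pf (ore.right_form ?q \<otimes>\<^bsub>B\<^esub> const Y) = (\<Sum>i\<le>N. k ^ i * pf (const (?q i * Y)))"
      if N: "N \<ge> Suc N0" for N
    proof -
      obtain N' where N': "N = Suc N'" "N' \<ge> N0" using N by (cases N) auto
      have "(\<Sum>i\<le>N. k ^ i * pf (const (?q i * Y)))
          = pf (const (X * Y)) + (\<Sum>i\<le>N'. k ^ Suc i * pf (const (p i * Y)))"
        unfolding N'(1) sum.atMost_Suc_shift q by simp
      also have "\<dots> = pf (const (X * Y)) + k * (\<Sum>i\<le>N'. k ^ i * pf (const (p i * Y)))"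
        by (simp add: sum_distrib_left mult.assoc)
      finally show ?thesis using step N0[OF N'(2)] by (simp add: add.commute)
    qed
    then show ?case by blast
  qed
qed

text \<open>On a constant at (1, 1) the excluded functional has a value of degree 0, whereas D is at
  least 1. A nonzero coefficient of degree m + D, for the last m with t m nonzero, contradicts
  this.\<close>

lemma not_surjective:
  assumes s: "s \<in> up A"
    and eq: "\<And>v. v \<in> up A \<Longrightarrow> f (s \<otimes>\<^bsub>B\<^esub> v) = (\<lambda>n. bit (tr (v n $$ (1, 1))))"
  shows False
proof -
  obtain q where q: "q \<in> up A" "s = ore.right_form q" using right_form_surj[OF s] by blast
  define t where "t i = q i $$ (1, 1)" for i
  have sum: "\<exists>N0. \<forall>N\<ge>N0. [:tr c:] = (\<Sum>i\<le>N. k ^ i * H (t i * c))" for c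
  proof -
    have c: "const (elem_mat 1 1 c) \<in> up A" by simp
    have "pf (s \<otimes>\<^bsub>B\<^esub> const (elem_mat 1 1 c)) = [:tr c:]"
      using tr_cases[of c] ore.C_up[OF f_closed[of "s \<otimes>\<^bsub>B\<^esub> const (elem_mat 1 1 c)"]] s c
      by (intro poly_eqI)
        (auto simp: coeff_to_poly eq coeff_pCons bit_def monomial_def A_simps split: nat.split)
    moreover have "pf (const (q i * elem_mat 1 1 c)) = H (t i * c)" for i
    proof -
      have qi: "q i \<in> carrier_mat 2 2" using up_coeff[OF q(1)] .
      have "q i * elem_mat 1 1 c = elem_mat 0 1 (q i $$ (0, 1) * c) + elem_mat 1 1 (t i * c)"
        using qi mult_carrier_mat[of "q i" 2 2 "elem_mat 1 1 c" 2]
        by (intro mat2_eqI) (simp_all add: mat2_mult_index t_def del: index_mult_mat)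
      then have "pf (const (q i * elem_mat 1 1 c)) = G (q i $$ (0, 1) * c) + H (t i * c)"
        by (simp only: pf_const_add elem_mat_closed G_def H_def)
      then show ?thesis by (simp add: G_eq_0)
    qed
    ultimately show ?thesis
      using pf_right_form[OF q(1), of "elem_mat 1 1 c"] q(2) by simp
  qed
  show False
  proof (cases rule: H_cases)
    case 1
    then show False using sum[of 1] by auto
  next
    case (2 D l)
    \<comment> \<open>Otherwise all values would vanish, although 1 has trace 1.\<close>
    have "\<exists>i. t i \<noteq> 0"
    proof (rule ccontr)
      assume "\<not> (\<exists>i. t i \<noteq> 0)"
      then show False using sum[of 1] GH_zero by auto
    qed
    moreover obtain N where "\<And>n. n > N \<Longrightarrow> q n = \<zero>\<^bsub>A\<^esub>" using ore.up_bounded[OF q(1)] by blast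
    then have bounded: "t n \<noteq> 0 \<Longrightarrow> n \<le> N" for n
      by (metis A_simps(4) index_zero_mat(1) not_le_imp_less one_less_numeral_iff semiring_norm(76) t_def)
    ultimately obtain m where m: "t m \<noteq> 0" "\<And>n. t n \<noteq> 0 \<Longrightarrow> n \<le> m"
      using Nat.ex_has_greatest_nat[of "\<lambda>n. t n \<noteq> 0" _ N] by metis
    \<comment> \<open>This choice makes the coefficient of degree m + D in the summand with i = m
      equal to l. Summands with i < m have degree at most i + D, and those with i > m are
      zero.\<close>
    obtain d where d: "tr (t m * d) = 1" using tr_nondegenerate[OF m(1)] .
    obtain N0 where N0: "\<And>N. N \<ge> N0 \<Longrightarrow> [:tr d:] = (\<Sum>i\<le>N. k ^ i * H (t i * d))" using sum by blast
    define N1 where "N1 = max N0 m"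
    have z_pow: "z ^ i = monom 1 i" for i
      by (simp add: monom_altdef)
    have "coeff [:tr d:] (m + D) = (\<Sum>i\<le>N1. coeff (k ^ i * H (t i * d)) (m + D))"
      using N0[of N1] by (simp add: N1_def coeff_sum)
    also have "\<dots> = (\<Sum>i\<le>N1. if i = m then l else 0)"
    proof (rule sum.cong)
      fix i
      consider "i < m" | "i = m" | "i > m" by linarith
      then show "coeff (k ^ i * H (t i * d)) (m + D) = (if i = m then l else 0)"
      proof cases
        case 3
        then have "t i = 0" using m(2)[of i] by force
        with 3 show ?thesis by (simp add: GH_zero)
      qed (use d in \<open>simp_all add: 2 z_pow coeff_monom_mult\<close>)
    qed simp
    also have "\<dots> = l" by (simp add: N1_def)
    finally show False using 2(2,3) by (simp add: coeff_pCons split: nat.splits)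
  qed
qed

end

section \<open>From a Frobenius isomorphism to a generating functional\<close>

context field8
begin

lemma not_frobenius_B: "\<not> frobenius_second_kind B C"
proof
  assume "frobenius_second_kind B C"
  then obtain \<kappa> \<phi> where \<kappa>: "\<kappa> \<in> ring_iso (B\<lparr>carrier := C\<rparr>) (B\<lparr>carrier := C\<rparr>)"
    and bij: "bij_betw \<phi> (carrier B) (right_dual B C)"
    and left: "\<phi> \<in> module_hom (B\<lparr>carrier := C\<rparr>)
           (left_mult_module B (carrier B)) (twisted_dual_left B C \<kappa>)"
    and right: "\<phi> \<in> module_hom (opposite_ring B)
           (right_mult_module B (carrier B)) (twisted_dual_right B C)"
    unfolding frobenius_second_kind_def kappa_frobenius_def by blast
  define f where "f = \<phi> \<one>\<^bsub>B\<^esub>"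
  have one: "\<one>\<^bsub>B\<^esub> \<in> up A" using T.one_closed by simp
  have f: "f \<in> right_dual B C" unfolding f_def using bij T.one_closed by (auto simp: bij_betw_def)
  \<comment> \<open>By right linearity over B, the isomorphism is determined by its value at
    1.\<close>
  have \<phi>: "\<phi> s v = f (s \<otimes>\<^bsub>B\<^esub> v)" if "s \<in> up A" "v \<in> up A" for s v
  proof -
    have "\<forall>b\<in>up A. \<forall>u\<in>up A. \<phi> (u \<otimes>\<^bsub>B\<^esub> b) = (\<lambda>v\<in>up A. \<phi> u (b \<otimes>\<^bsub>B\<^esub> v))"
      using right by (simp add: module_hom_def twisted_dual_right_def)
    then have "\<phi> (\<one>\<^bsub>B\<^esub> \<otimes>\<^bsub>B\<^esub> s) = (\<lambda>v\<in>up A. \<phi> \<one>\<^bsub>B\<^esub> (s \<otimes>\<^bsub>B\<^esub> v))"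
      using that(1) one by blast
    moreover have "\<one>\<^bsub>B\<^esub> \<otimes>\<^bsub>B\<^esub> s = s" using that T.l_one by simp
    ultimately show ?thesis using that by (simp add: f_def)
  qed
  have f_left: "f (c \<otimes>\<^bsub>B\<^esub> v) = \<kappa> c \<otimes>\<^bsub>B\<^esub> f v" if "c \<in> C" "v \<in> up A" for c v
  proof -
    have "\<forall>c\<in>C. \<forall>u\<in>up A. \<phi> (c \<otimes>\<^bsub>B\<^esub> u) = (\<lambda>v\<in>up A. \<kappa> c \<otimes>\<^bsub>B\<^esub> \<phi> u v)"
      using left by (simp add: module_hom_def twisted_dual_left_def)
    then have "\<phi> (c \<otimes>\<^bsub>B\<^esub> \<one>\<^bsub>B\<^esub>) = (\<lambda>v\<in>up A. \<kappa> c \<otimes>\<^bsub>B\<^esub> \<phi> \<one>\<^bsub>B\<^esub> v)"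
      using that(1) one by blast
    moreover have "c \<otimes>\<^bsub>B\<^esub> \<one>\<^bsub>B\<^esub> = c" using ore.C_up[OF that(1)] T.r_one by simp
    ultimately show ?thesis using that \<phi>[of c v] by (simp add: f_def)
  qed
  interpret tf: twisted_functional a f "\<kappa> ore.x"
  proof unfold_locales
    show "f v \<in> C" if "v \<in> up A" for v
      using f that by (auto simp: right_dual_def module_hom_def)
    show "f (v \<oplus>\<^bsub>B\<^esub> w) = f v \<oplus>\<^bsub>B\<^esub> f w" if "v \<in> up A" "w \<in> up A" for v w
      using f that by (simp add: right_dual_def module_hom_def)
    show "f (v \<otimes>\<^bsub>B\<^esub> c) = f v \<otimes>\<^bsub>B\<^esub> c" if "v \<in> up A" "c \<in> C" for v c
      using f that by (simp add: right_dual_def module_hom_def)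
    show "f (ore.x \<otimes>\<^bsub>B\<^esub> v) = \<kappa> ore.x \<otimes>\<^bsub>B\<^esub> f v" if "v \<in> up A" for v
      using f_left[OF x_closed(2) that] .
  qed (use iso_image_x[OF \<kappa>] in auto)
  let ?t = "\<lambda>X :: 'f mat. bit (tr (X $$ (1, 1)))"
  have t: "ore.F2_functional ?t" by (rule bit_functional) simp
  \<comment> \<open>The analogue, in the (1, 1) block, of the splitting map; surjectivity would
    require it to be f composed with left multiplication by some s.\<close>
  let ?g = "\<lambda>v\<in>up A. \<lambda>n. ?t (v n)"
  have "?g \<in> right_dual B C"
    using ore.coeffwise_closed[OF t] ore.coeffwise_add[OF t] ore.coeffwise_right_C_linear[OF t]
    by (auto simp: right_dual_def module_hom_def)
  also have "right_dual B C = \<phi> ` up A"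
    using bij by (simp add: bij_betw_def)
  finally obtain s where s: "?g = \<phi> s" "s \<in> up A"
    by (rule imageE)
  show False
  proof (rule tf.not_surjective[OF s(2)])
    fix v :: "nat \<Rightarrow> 'f mat" assume v: "v \<in> up A"
    have "f (s \<otimes>\<^bsub>B\<^esub> v) = \<phi> s v" using \<phi>[OF s(2) v] by (rule sym)
    also have "\<dots> = ?g v" by (simp only: s(1))
    also have "\<dots> = (\<lambda>n. bit (tr (v n $$ (1, 1))))" using v by (rule restrict_apply')
    finally show "f (s \<otimes>\<^bsub>B\<^esub> v) = (\<lambda>n. bit (tr (v n $$ (1, 1))))" .
  qed
qed

end

theorem mainTheorem3:
  fixes a :: "'f::field"
  assumes "card (UNIV :: 'f set) = 8"
    and "a^3 + a^2 + 1 = 0"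
  shows
    "let A = ring_mat TYPE('f) 2 ();
         B = ore_extension A sq_entries (inner_deriv (M_mat a) sq_entries);
         C = F2_polys A
     in ring_extension B C \<and> biseparable_extension B C \<and> \<not> frobenius_second_kind B C"
proof -
  interpret field8 a by unfold_locales (use assms in auto)
  show ?thesis
    unfolding Let_def using ore.B_ring_extension biseparable_B not_frobenius_B by blast
qed

end
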